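(* For every integer $n\ge 1$, let $A_n=(a_{\lambda\mu})_{\lambda,\mu\in P(n)}$ be the matrix defined by $$S_\lambda(t)=\sum_{\mu\in P(n)}a_{\lambda\mu}\,W_\mu(t)\qquad(\lambda\in P(n)),$$ where $W_\mu(t)=Q_{\mu^r}(t)\,S_{\mu^d}(t')$. Then $$|\det A_n|=2^{k_n},\qquad\text{where}\qquad k_n=\sum_{\lambda\in P(n)}\ell(\lambda^d)=\sum_{\lambda\in P(n)}\bigl(\ell(\widetilde{\lambda^r})-\ell(\lambda^r)\bigr).$$
   Context: $P(n)$ is the set of partitions of $n$, $SP(n)$ the set of strict partitions of $n$ (distinct parts), $OP(n)$ the set of partitions of $n$ with all parts odd. $\ell(\lambda)$ is the number of parts of $\lambda$ and $m_i(\lambda)$ the multiplicity of $i$ as a part. For $\lambda\in P(n)$, the partitions $\lambda^r$ (strict) and $\lambda^d$ are defined by: $m_i(\lambda^r)\in\{0,1\}$ with $m_i(\lambda^r)\equiv m_i(\lambda)\pmod 2$, and $m_i(\lambda^d)=(m_i(\lambda)-m_i(\lambda^r))/2$. The map $\lambda\mapsto(\lambda^r,\lambda^d)$ is a bijection $P(n)\to\bigcup_{n_0+2n_1=n}SP(n_0)\times P(n_1)$. 2-Glaisher map: for a strict partition $\lambda=(\lambda_1,\dots,\lambda_\ell)$ with $\lambda_i=2^{p_i}q_i$, $q_i$ odd, $\tilde\lambda$ is the odd partition with $m_{2j-1}(\tilde\lambda)=\sum_{i:\,q_i=2j-1}2^{p_i}$. $\widetilde{\lambda^r}$ is the image of $\lambda^r$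 under this map. $V(n)$ is the space of homogeneous polynomials of degree $n$ in $\mathbb{Q}[t_1,t_2,\dots]$ with $\deg t_j=j$. Schur function: for $\lambda\in P(n)$, $S_\lambda(t)=\sum_{\rho=(1^{m_1}2^{m_2}\cdots)\in P(n)}\chi^\lambda_\rho\frac{t_1^{m_1}t_2^{m_2}\cdots}{m_1!m_2!\cdots}$, where $\chi^\lambda_\rho$ is the value of the irreducible character of the symmetric group indexed by $\lambda$ at the class of cycle type $\rho$ (the usual Schur function with power sums $p_j=j t_j$). $S_\nu(t')$ denotes $S_\nu(t)$ with each $t_j$ replaced by $t_{2j}$. Schur $Q$-function: for a strict partition $\lambda$, $Q_\lambda(t)$ is the usual Schur $Q$-function written in odd power sums with $t_j=2p_j/j$. Explicitly, let $\sum_{m\ge0}q_m z^m=\exp\bigl(\sum_{j\text{ odd}}t_jz^j\bigr)$, $Q_{(r,s)}=q_rq_s+2\sum_{i=1}^{s}(-1)^iq_{r+i}q_{s-i}$ for $r>s\ge0$ (so $Q_{(r,0)}=q_r$), and let $Q_\lambda$ be the Pfaffian of the skew-symmetric matrix whose $(i,j)$ entry for $i<j$ is $Q_{(\lambda_i,\lambda_j)}$, where a part $0$ is appended to $\lambda$ if $\ell(\lambda)$ is odd; $Q_\emptyset=1$. The functions $W_\mu(t)$, $\mu\in P(n)$, form a basis of $V(n)$, so $A_n$ is well defined. *)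

theory Defs
  imports
    Jordan_Normal_Form.Determinant
    "HOL-Library.Poly_Mapping"
    "HOL-Library.Multiset"
    "HOL-Combinatorics.Permutations"
    "HOL-Combinatorics.Orbits"
    "HOL-Computational_Algebra.Formal_Power_Series"
begin

section \<open>Partitions\<close>

text \<open>A partition is the multiset of its (positive) parts, so that \<open>\<ell>(\<alpha>)\<close> is \<open>size \<alpha>\<close> and
  \<open>m\<^sub>i(\<alpha>)\<close> is \<open>count \<alpha> i\<close>.\<close>

type_synonym partition = "nat multiset"

definition partitions :: "nat \<Rightarrow> partition set" where
  "partitions n = {\<alpha>. 0 \<notin># \<alpha> \<and> sum_mset \<alpha> = n}"

definition parts_list :: "partition \<Rightarrow> nat list" where
  "parts_list \<alpha> = rev (sorted_list_of_multiset \<alpha>)"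

definition strict_part :: "partition \<Rightarrow> partition" where
  "strict_part \<alpha> = mset_set {i \<in> set_mset \<alpha>. odd (count \<alpha> i)}"

definition double_part :: "partition \<Rightarrow> partition" where
  "double_part \<alpha> =
     (\<Sum>i\<in>set_mset \<alpha>. replicate_mset ((count \<alpha> i - count (strict_part \<alpha>) i) div 2) i)"

lemma count_strict_part: "count (strict_part \<alpha>) i = count \<alpha> i mod 2"
proof -
  have "count \<alpha> i mod 2 = 0" if "i \<notin># \<alpha>"
    using that by (simp add: not_in_iff)
  then show ?thesis
    by (auto simp: strict_part_def count_mset_set' odd_iff_mod_2_eq_one)
qed

lemma count_double_part: "count (double_part \<alpha>) i = (count \<alpha> i - count (strict_part \<alpha>) i) div 2"
proof (cases "i \<in># \<alpha>")
  case True
  then show ?thesis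
    by (simp add: double_part_def count_sum if_distrib sum.delta cong: if_cong)
next
  case False
  then show ?thesis
    by (auto simp: double_part_def count_sum not_in_iff)
qed

text \<open>The 2-Glaisher map: each part \<open>2\<^sup>p q\<close> with \<open>q\<close> odd is replaced by \<open>2\<^sup>p\<close> copies of \<open>q\<close>.\<close>

definition glaisher :: "partition \<Rightarrow> partition" where
  "glaisher \<alpha> = (\<Sum>x\<in>#\<alpha>. replicate_mset (2 ^ multiplicity 2 x) (x div 2 ^ multiplicity 2 x))"

lemma count_glaisher:
  "count (glaisher \<alpha>) q =
     (\<Sum>x\<in>#filter_mset (\<lambda>x. x div 2 ^ multiplicity 2 x = q) \<alpha>. 2 ^ multiplicity 2 x)"
  unfolding glaisher_def by (induction \<alpha>) auto


section \<open>Irreducible characters of the symmetric group\<close>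

text \<open>The group algebra of the symmetric group on \<open>{..<n}\<close> over the rationals consists of the
  elements of \<open>(nat \<Rightarrow> nat) \<Rightarrow>\<^sub>0 rat\<close> supported on \<open>{p. p permutes {..<n}}\<close>. The type
  \<open>nat \<Rightarrow> nat\<close> is not a monoid in the sense of type classes, so the product is defined here.\<close>

type_synonym group_algebra = "(nat \<Rightarrow> nat) \<Rightarrow>\<^sub>0 rat"

definition alg_scale :: "rat \<Rightarrow> group_algebra \<Rightarrow> group_algebra" where
  "alg_scale c v = Poly_Mapping.map ((*) c) v"

lemma lookup_alg_scale [simp]:
  "Poly_Mapping.lookup (alg_scale c v) p = c * Poly_Mapping.lookup v p"
  by (simp add: alg_scale_def Poly_Mapping.map.rep_eq when_def)

interpretation alg: vector_space alg_scale
  by unfold_locales (auto intro!: poly_mapping_eqI simp: lookup_add algebra_simps)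

definition alg_mult :: "group_algebra \<Rightarrow> group_algebra \<Rightarrow> group_algebra" (infixl \<open>\<star>\<close> 70) where
  "x \<star> y = (\<Sum>p\<in>Poly_Mapping.keys x. \<Sum>q\<in>Poly_Mapping.keys y.
     Poly_Mapping.single (p \<circ> q) (Poly_Mapping.lookup x p * Poly_Mapping.lookup y q))"

text \<open>The trace of a linear operator \<open>f\<close> on a finite-dimensional invariant subspace \<open>V\<close>;
  it does not depend on the chosen basis.\<close>

definition trace_on :: "group_algebra set \<Rightarrow> (group_algebra \<Rightarrow> group_algebra) \<Rightarrow> rat" where
  "trace_on V f =
     (let B = (SOME B. B \<subseteq> V \<and> alg.independent B \<and> V \<subseteq> alg.span B)
      in \<Sum>b\<in>B. alg.representation B (f b) b)"

text \<open>The boxes of the Young diagram of \<open>\<alpha>\<close> are filled with \<open>0, 1, \<dots>, n - 1\<close> row by row;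
  \<open>tab_row\<close> and \<open>tab_col\<close> give the position of the entry \<open>k\<close>.\<close>

definition tab_row :: "partition \<Rightarrow> nat \<Rightarrow> nat" where
  "tab_row \<alpha> k = (LEAST i. k < sum_list (take (Suc i) (parts_list \<alpha>)))"

definition tab_col :: "partition \<Rightarrow> nat \<Rightarrow> nat" where
  "tab_col \<alpha> k = k - sum_list (take (tab_row \<alpha> k) (parts_list \<alpha>))"

definition row_group :: "partition \<Rightarrow> (nat \<Rightarrow> nat) set" where
  "row_group \<alpha> = {p. p permutes {..<sum_mset \<alpha>} \<and>
     (\<forall>k<sum_mset \<alpha>. tab_row \<alpha> (p k) = tab_row \<alpha> k)}"

definition col_group :: "partition \<Rightarrow> (nat \<Rightarrow> nat) set" where
  "col_group \<alpha> = {p. p permutes {..<sum_mset \<alpha>} \<and>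
     (\<forall>k<sum_mset \<alpha>. tab_col \<alpha> (p k) = tab_col \<alpha> k)}"

definition young_symmetrizer :: "partition \<Rightarrow> group_algebra" where
  "young_symmetrizer \<alpha> =
     (\<Sum>p\<in>row_group \<alpha>. Poly_Mapping.single p 1) \<star>
     (\<Sum>q\<in>col_group \<alpha>. Poly_Mapping.single q (of_int (sign q)))"

text \<open>The irreducible module indexed by \<open>\<alpha>\<close> is the left ideal generated by the Young symmetrizer
  (so \<open>(n)\<close> gives the trivial and \<open>(1\<^sup>n)\<close> the sign representation). It is absolutely irreducible,
  hence its character over the rationals is the complex irreducible character.\<close>

definition irr_module :: "partition \<Rightarrow> group_algebra set" where
  "irr_module \<alpha> =
     {x \<star> young_symmetrizer \<alpha> |x. Poly_Mapping.keys x \<subseteq> {p. p permutes {..<sum_mset \<alpha>}}}"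

definition cycle_type :: "nat \<Rightarrow> (nat \<Rightarrow> nat) \<Rightarrow> partition" where
  "cycle_type n p = image_mset card (mset_set (orbit p ` {..<n}))"

definition irr_char :: "partition \<Rightarrow> (nat \<Rightarrow> nat) \<Rightarrow> rat" where
  "irr_char \<alpha> p = trace_on (irr_module \<alpha>) (\<lambda>v. Poly_Mapping.single p 1 \<star> v)"

definition irr_char_class :: "partition \<Rightarrow> partition \<Rightarrow> rat" where
  "irr_char_class \<alpha> \<rho> = irr_char \<alpha>
     (SOME p. p permutes {..<sum_mset \<alpha>} \<and> cycle_type (sum_mset \<alpha>) p = \<rho>)"


section \<open>Polynomials in \<open>t\<^sub>1, t\<^sub>2, \<dots>\<close>\<close>

text \<open>A polynomial maps exponent vectors to coefficients. The variable with index \<open>0\<close> is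
  never used.\<close>

type_synonym qpoly = "(nat \<Rightarrow>\<^sub>0 nat) \<Rightarrow>\<^sub>0 rat"

definition const :: "rat \<Rightarrow> qpoly" where
  "const c = Poly_Mapping.single 0 c"

definition tvar :: "nat \<Rightarrow> qpoly" where
  "tvar j = Poly_Mapping.single (Poly_Mapping.single j 1) 1"

definition poly_subst :: "(nat \<Rightarrow> qpoly) \<Rightarrow> qpoly \<Rightarrow> qpoly" where
  "poly_subst f P = (\<Sum>m\<in>Poly_Mapping.keys P. const (Poly_Mapping.lookup P m) *
     (\<Prod>j\<in>Poly_Mapping.keys m. f j ^ Poly_Mapping.lookup m j))"

definition schur :: "partition \<Rightarrow> qpoly" where
  "schur \<alpha> = (\<Sum>\<rho>\<in>partitions (sum_mset \<alpha>). const (irr_char_class \<alpha> \<rho>) *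
     (\<Prod>j\<in>set_mset \<rho>. const (1 / fact (count \<rho> j)) * tvar j ^ count \<rho> j))"

definition schur' :: "partition \<Rightarrow> qpoly" where
  "schur' \<nu> = poly_subst (\<lambda>j. tvar (2 * j)) (schur \<nu>)"


section \<open>Schur Q-functions\<close>

text \<open>The library's \<open>fps_exp\<close> needs coefficients in a field, so the exponential of a series without
  constant term is written as a composition.\<close>

definition q_gen :: "qpoly fps" where
  "q_gen = Abs_fps (\<lambda>k. const (1 / fact k)) oo Abs_fps (\<lambda>j. if odd j then tvar j else 0)"

definition q_fun :: "nat \<Rightarrow> qpoly" where
  "q_fun m = fps_nth q_gen m"

text \<open>Used for \<open>r > s\<close> only.\<close>

definition Q_pair :: "nat \<Rightarrow> nat \<Rightarrow> qpoly" where
  "Q_pair r s = q_fun r * q_fun s + 2 * (\<Sum>i=1..s. (- 1) ^ i * q_fun (r + i) * q_fun (s - i))"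

text \<open>The Pfaffian of the skew-symmetric \<open>2m \<times> 2m\<close> matrix with entries \<open>a i j\<close> for \<open>i < j\<close>
  (indices from \<open>0\<close>), as a sum over perfect matchings of \<open>{..<2m}\<close>; only entries above the
  diagonal occur.\<close>

definition pfaffian :: "nat \<Rightarrow> (nat \<Rightarrow> nat \<Rightarrow> qpoly) \<Rightarrow> qpoly" where
  "pfaffian m a = (\<Sum>\<sigma> | \<sigma> permutes {..<2 * m} \<and>
       (\<forall>i<m. \<sigma> (2 * i) < \<sigma> (2 * i + 1)) \<and>
       (\<forall>i<m. \<forall>j<m. i < j \<longrightarrow> \<sigma> (2 * i) < \<sigma> (2 * j)).
     of_int (sign \<sigma>) * (\<Prod>i<m. a (\<sigma> (2 * i)) (\<sigma> (2 * i + 1))))"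

definition schur_Q :: "partition \<Rightarrow> qpoly" where
  "schur_Q \<alpha> =
     (let ls = parts_list \<alpha> @ (if odd (size \<alpha>) then [0] else [])
      in pfaffian (length ls div 2) (\<lambda>i j. Q_pair (ls ! i) (ls ! j)))"


section \<open>The transition matrix\<close>

definition W :: "partition \<Rightarrow> qpoly" where
  "W \<mu> = schur_Q (strict_part \<mu>) * schur' (double_part \<mu>)"

text \<open>\<open>ps\<close> is an enumeration of the partitions of \<open>n\<close>, used to index both rows and columns.\<close>

definition transition_matrix :: "partition list \<Rightarrow> rat mat" where
  "transition_matrix ps = (THE A. A \<in> carrier_mat (length ps) (length ps) \<and>
     (\<forall>i<length ps. schur (ps ! i) = (\<Sum>j<length ps. const (A $$ (i, j)) * W (ps ! j))))"

end

theory Submission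
  imports Defs
begin

text \<open>Write \<open>det F\<close> for the determinant of the coefficients of a family \<open>F\<close> of homogeneous
  polynomials with respect to the monomials in \<open>t\<close>, so that \<open>det A\<^sub>n = det S / det W\<close>.

  The characteristics \<open>h\<^sub>\<alpha>\<close> of the permutation characters on cosets of Young subgroups are
  unitriangular in the \<open>S\<^sub>\<beta>\<close> (Young's lemma on row and column groups), and unitriangular in the
  monomials, ordered by the number of parts. Hence \<open>|det S| = 1\<close>.

  The integral lattice spanned by the \<open>Q\<^sub>\<alpha>\<close> with \<open>\<alpha>\<close> strict is that of all products of the
  \<open>q\<^sub>m\<close>. The relation \<open>q\<^sub>m\<^sup>2 = 2 q\<^bsub>m-1\<^esub> q\<^bsub>m+1\<^esub> - \<dots> \<plusminus> 2 q\<^bsub>2m\<^esub>\<close> allows replacing the generator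
  \<open>q\<^bsub>2m\<^esub>\<close> by \<open>q\<^sub>m\<^sup>2 / 2\<close>, and by iteration \<open>q\<^sub>m\<close> for \<open>m = 2\<^sup>p r\<close>, \<open>r\<close> odd, by the \<open>2\<^sup>p\<close>-th power of
  \<open>q\<^sub>r\<close> divided by two to the power \<open>2\<^sup>p - 1\<close>. A product over the parts of \<open>\<mu>\<^sup>r\<close> then becomes a
  product of \<open>q\<^sub>x\<close> over the parts \<open>x\<close> of the Glaisher image of \<open>\<mu>\<^sup>r\<close>, divided by two to the
  difference of the lengths; multiplied by \<open>h\<close> of \<open>\<mu>\<^sup>d\<close> in the variables \<open>t\<^bsub>2j\<^esub>\<close> this is again
  triangular in the monomials. The two expressions for \<open>k\<^sub>n\<close> agree because joining the Glaisher
  image of \<open>\<mu>\<^sup>r\<close> with \<open>2 \<mu>\<^sup>d\<close> permutes the partitions \<open>\<mu>\<close> of \<open>n\<close>, so that the lengths on both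
  sides have equal sums.\<close>

section \<open>The group algebra\<close>

unbundle no m_inv_syntax

abbreviation coef :: "('a \<Rightarrow>\<^sub>0 'b::zero) \<Rightarrow> 'a \<Rightarrow> 'b" where
  "coef \<equiv> Poly_Mapping.lookup"

abbreviation delta :: "(nat \<Rightarrow> nat) \<Rightarrow> group_algebra" (\<open>\<delta>\<close>) where
  "\<delta> p \<equiv> Poly_Mapping.single p 1"

abbreviation Sym :: "nat \<Rightarrow> (nat \<Rightarrow> nat) set" where
  "Sym n \<equiv> {p. p permutes {..<n}}"

lemma finite_Sym [simp]: "finite (Sym n)"
  by (simp add: finite_permutations)

lemma alg_mult_superset:
  assumes "finite P" "finite Q" "Poly_Mapping.keys x \<subseteq> P" "Poly_Mapping.keys y \<subseteq> Q"
  shows "x \<star> y = (\<Sum>p\<in>P. \<Sum>q\<in>Q. Poly_Mapping.single (p \<circ> q) (coef x p * coef y q))"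
proof -
  have "x \<star> y = (\<Sum>p\<in>Poly_Mapping.keys x. \<Sum>q\<in>Q. Poly_Mapping.single (p \<circ> q) (coef x p * coef y q))"
    unfolding alg_mult_def
    by (intro sum.cong refl sum.mono_neutral_left) (use assms in \<open>auto simp: in_keys_iff\<close>)
  also have "\<dots> = (\<Sum>p\<in>P. \<Sum>q\<in>Q. Poly_Mapping.single (p \<circ> q) (coef x p * coef y q))"
    by (intro sum.mono_neutral_left) (use assms in \<open>auto simp: in_keys_iff\<close>)
  finally show ?thesis .
qed

lemma alg_mult_add_left: "(x + y) \<star> z = x \<star> z + y \<star> z"
proof -
  let ?P = "Poly_Mapping.keys x \<union> Poly_Mapping.keys y" and ?Q = "Poly_Mapping.keys z"
  have "Poly_Mapping.keys (x + y) \<subseteq> ?P" by (rule keys_add)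
  then show ?thesis
    by (simp add: alg_mult_superset[where P = ?P and Q = ?Q] lookup_add distrib_right
        single_add sum.distrib)
qed

lemma alg_mult_add_right: "z \<star> (x + y) = z \<star> x + z \<star> y"
proof -
  let ?P = "Poly_Mapping.keys x \<union> Poly_Mapping.keys y" and ?Q = "Poly_Mapping.keys z"
  have "Poly_Mapping.keys (x + y) \<subseteq> ?P" by (rule keys_add)
  then show ?thesis
    by (simp add: alg_mult_superset[where P = ?Q and Q = ?P] lookup_add distrib_left
        single_add sum.distrib)
qed

lemma alg_mult_zero_left [simp]: "0 \<star> x = 0"
  by (simp add: alg_mult_def)

lemma alg_mult_zero_right [simp]: "x \<star> 0 = 0"
  by (simp add: alg_mult_def)

lemma alg_mult_sum_left: "(\<Sum>i\<in>I. f i) \<star> z = (\<Sum>i\<in>I. f i \<star> z)"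
  by (induction I rule: infinite_finite_induct) (simp_all add: alg_mult_add_left)

lemma alg_mult_sum_right: "z \<star> (\<Sum>i\<in>I. f i) = (\<Sum>i\<in>I. z \<star> f i)"
  by (induction I rule: infinite_finite_induct) (simp_all add: alg_mult_add_right)

lemma alg_mult_single [simp]:
  "Poly_Mapping.single p c \<star> Poly_Mapping.single q d = Poly_Mapping.single (p \<circ> q) (c * d)"
  by (simp add: alg_mult_superset[where P = "{p}" and Q = "{q}"])

lemma alg_scale_single [simp]: "alg_scale c (Poly_Mapping.single p d) = Poly_Mapping.single p (c * d)"
  by (rule poly_mapping_eqI) (simp add: lookup_single when_def)

lemma sum_single_coef:
  assumes "finite P" "Poly_Mapping.keys x \<subseteq> P"
  shows "(\<Sum>p\<in>P. Poly_Mapping.single p (coef x p)) = x"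
proof (rule poly_mapping_eqI)
  fix q
  have "(\<Sum>p\<in>P. coef x p when p = q) = (if q \<in> P then coef x q else 0)"
    using assms(1) by (simp add: when_def)
  moreover have "coef x q = 0" if "q \<notin> P"
    using that assms(2) by (auto simp: in_keys_iff)
  ultimately show "coef (\<Sum>p\<in>P. Poly_Mapping.single p (coef x p)) q = coef x q"
    by (simp add: lookup_sum lookup_single)
qed

lemma alg_mult_expand:
  "(\<Sum>i\<in>I. f i) \<star> (\<Sum>j\<in>J. g j) = (\<Sum>i\<in>I. \<Sum>j\<in>J. f i \<star> g j)"
  unfolding alg_mult_sum_left by (simp add: alg_mult_sum_right)

lemma group_algebra_induct [case_names zero add]:
  assumes "P 0" and "\<And>x p c. P x \<Longrightarrow> P (x + Poly_Mapping.single p c)"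
  shows "P (x :: group_algebra)"
proof -
  have "P (\<Sum>p\<in>A. Poly_Mapping.single p (coef x p))" if "finite A" for A
    using that
  proof (induction A)
    case (insert q A)
    from assms(2)[OF insert.IH, of q "coef x q"] insert.hyps show ?case
      by (simp add: add.commute)
  qed (simp add: assms(1))
  from this[of "Poly_Mapping.keys x"] show ?thesis
    by (simp add: sum_single_coef)
qed

lemma alg_mult_assoc: "(x \<star> y) \<star> z = x \<star> (y \<star> z)"
proof (induction x rule: group_algebra_induct)
  case (add x p c)
  have "(Poly_Mapping.single p c \<star> y) \<star> z = Poly_Mapping.single p c \<star> (y \<star> z)"
  proof (induction y rule: group_algebra_induct)
    case (add y q d)
    have "(Poly_Mapping.single p c \<star> Poly_Mapping.single q d) \<star> z =
      Poly_Mapping.single p c \<star> (Poly_Mapping.single q d \<star> z)"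
    proof (induction z rule: group_algebra_induct)
      case (add z r e)
      then show ?case by (simp add: alg_mult_add_right comp_assoc mult.assoc)
    qed simp
    then show ?case using add by (simp add: alg_mult_add_right alg_mult_add_left)
  qed simp
  then show ?case using add by (simp add: alg_mult_add_left)
qed simp

lemma alg_mult_scale_left: "alg_scale c x \<star> y = alg_scale c (x \<star> y)"
proof (induction x rule: group_algebra_induct)
  case (add x p d)
  have "alg_scale c (Poly_Mapping.single p d) \<star> y = alg_scale c (Poly_Mapping.single p d \<star> y)"
    by (induction y rule: group_algebra_induct)
      (simp_all add: alg_mult_add_right alg.scale_right_distrib mult.assoc)
  then show ?case using add
    by (simp add: alg.scale_right_distrib alg_mult_add_left)
qed simp

lemma alg_mult_scale_right: "x \<star> alg_scale c y = alg_scale c (x \<star> y)"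
proof (induction x rule: group_algebra_induct)
  case (add x p d)
  have "Poly_Mapping.single p d \<star> alg_scale c y = alg_scale c (Poly_Mapping.single p d \<star> y)"
    by (induction y rule: group_algebra_induct)
      (simp_all add: alg_mult_add_right alg.scale_right_distrib mult.left_commute)
  then show ?case using add
    by (simp add: alg.scale_right_distrib alg_mult_add_left)
qed simp

lemma comp_eq_iff_left: "bij p \<Longrightarrow> p \<circ> q = g \<longleftrightarrow> q = inv p \<circ> g"
  by (metis bij_is_inj bij_is_surj comp_assoc id_comp inv_o_cancel surj_iff)

lemma comp_eq_iff_right: "bij p \<Longrightarrow> q \<circ> p = g \<longleftrightarrow> q = g \<circ> inv p"
  by (metis bij_is_inj bij_is_surj comp_assoc comp_id inv_o_cancel surj_iff)

lemma coef_mult: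
  assumes "Poly_Mapping.keys x \<subseteq> Sym n" "Poly_Mapping.keys y \<subseteq> Sym n" "g \<in> Sym n"
  shows "coef (x \<star> y) g = (\<Sum>p\<in>Sym n. coef x p * coef y (inv p \<circ> g))"
proof -
  have "coef (x \<star> y) g = (\<Sum>p\<in>Sym n. \<Sum>q\<in>Sym n. (coef x p * coef y q) when p \<circ> q = g)"
    using assms by (simp add: alg_mult_superset[where P = "Sym n" and Q = "Sym n"] lookup_sum lookup_single)
  also have "\<dots> = (\<Sum>p\<in>Sym n. \<Sum>q\<in>Sym n. if q = inv p \<circ> g then coef x p * coef y q else 0)"
  proof (intro sum.cong refl)
    fix p q assume p: "p \<in> Sym n"
    then have "p \<circ> q = g \<longleftrightarrow> q = inv p \<circ> g"
      by (auto intro: comp_eq_iff_left permutes_bij)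
    then show "(coef x p * coef y q when p \<circ> q = g) = (if q = inv p \<circ> g then coef x p * coef y q else 0)"
      by (simp add: when_def)
  qed
  also have "\<dots> = (\<Sum>p\<in>Sym n. coef x p * coef y (inv p \<circ> g))"
  proof (intro sum.cong refl)
    fix p assume "p \<in> Sym n"
    then have "inv p \<circ> g \<in> Sym n" using assms(3) by (auto intro: permutes_compose permutes_inv)
    then show "(\<Sum>q\<in>Sym n. if q = inv p \<circ> g then coef x p * coef y q else 0) = coef x p * coef y (inv p \<circ> g)"
      by simp
  qed
  finally show ?thesis .
qed

lemma keys_mult_Sym:
  assumes "Poly_Mapping.keys x \<subseteq> Sym n" "Poly_Mapping.keys y \<subseteq> Sym n"
  shows "Poly_Mapping.keys (x \<star> y) \<subseteq> Sym n"
proof -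
  have "Poly_Mapping.keys (x \<star> y) \<subseteq> (\<Union>p\<in>Sym n. \<Union>q\<in>Sym n.
      Poly_Mapping.keys (Poly_Mapping.single (p \<circ> q) (coef x p * coef y q)))"
    unfolding alg_mult_superset[OF finite_Sym finite_Sym assms]
    by (intro order.trans[OF keys_sum] UN_mono order.refl)
  also have "\<dots> \<subseteq> Sym n"
    by (auto intro: permutes_compose split: if_splits)
  finally show ?thesis .
qed

lemma coef_delta_mult:
  assumes "bij p" shows "coef (\<delta> p \<star> x) g = coef x (inv p \<circ> g)"
proof (induction x rule: group_algebra_induct)
  case (add x q c)
  have "p \<circ> q = g \<longleftrightarrow> q = inv p \<circ> g"
    by (rule comp_eq_iff_left[OF assms])
  then show ?case using add
    by (simp add: alg_mult_add_right lookup_add lookup_single when_def) (simp add: comp_def)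
qed simp

lemma coef_mult_delta:
  assumes "bij p" shows "coef (x \<star> \<delta> p) g = coef x (g \<circ> inv p)"
proof (induction x rule: group_algebra_induct)
  case (add x q c)
  have "q \<circ> p = g \<longleftrightarrow> q = g \<circ> inv p"
    by (rule comp_eq_iff_right[OF assms])
  then show ?case using add
    by (simp add: alg_mult_add_left lookup_add lookup_single when_def) (simp add: comp_def)
qed simp

subsection \<open>Class functions and traces\<close>

definition conj_sum :: "nat \<Rightarrow> group_algebra \<Rightarrow> (nat \<Rightarrow> nat) \<Rightarrow> rat" where
  "conj_sum n x p = (\<Sum>h\<in>Sym n. coef x (inv h \<circ> inv p \<circ> h))"

lemma trace_on_left_ideal:
  assumes e: "Poly_Mapping.keys e \<subseteq> Sym n" "e \<star> e = e" and p: "p \<in> Sym n"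
  shows "trace_on {x \<star> e |x. Poly_Mapping.keys x \<subseteq> Sym n} (\<lambda>v. \<delta> p \<star> v) = conj_sum n e p"
proof -
  let ?V = "{x \<star> e |x. Poly_Mapping.keys x \<subseteq> Sym n}"
  define B where "B = (SOME B. B \<subseteq> ?V \<and> alg.independent B \<and> ?V \<subseteq> alg.span B)"
  have "\<exists>B. B \<subseteq> ?V \<and> alg.independent B \<and> ?V \<subseteq> alg.span B"
    by (rule alg.maximal_independent_subset[of ?V]) (intro exI conjI)
  then have "B \<subseteq> ?V \<and> alg.independent B \<and> ?V \<subseteq> alg.span B"
    unfolding B_def by (rule someI_ex)
  then have B: "B \<subseteq> ?V" "alg.independent B" "?V \<subseteq> alg.span B" by auto
  have keysV: "Poly_Mapping.keys v \<subseteq> Sym n" if "v \<in> ?V" for v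
    using that keys_mult_Sym[OF _ e(1)] unfolding mem_Collect_eq by (elim exE conjE) simp
  have "v \<in> alg.span (\<delta> ` Sym n)" if "Poly_Mapping.keys v \<subseteq> Sym n" for v
  proof -
    have "(\<Sum>p\<in>Sym n. alg_scale (coef v p) (\<delta> p)) \<in> alg.span (\<delta> ` Sym n)"
      by (intro alg.span_sum alg.span_scale alg.span_base) auto
    then show ?thesis using that by (simp add: sum_single_coef)
  qed
  then have "B \<subseteq> alg.span (\<delta> ` Sym n)"
    using keysV[OF subsetD[OF B(1)]] by (intro subsetI) blast
  then have finB: "finite B"
    using alg.independent_span_bound[OF finite_imageI[OF finite_Sym] B(2)] by simp
  have he: "\<delta> h \<star> e \<in> ?V" if "h \<in> Sym n" for h
    using that by (intro CollectI exI[of _ "\<delta> h"]) simp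
  let ?\<phi> = "alg.representation B"
  have b_exp: "\<delta> p \<star> b = (\<Sum>h\<in>Sym n. alg_scale (coef b h) (\<delta> (p \<circ> h) \<star> e))" if "b \<in> B" for b
  proof -
    have "b \<in> ?V" using that B(1) by (rule subsetD[rotated])
    then obtain x where "b = x \<star> e" unfolding mem_Collect_eq by (elim exE conjE)
    then have "b = b \<star> e" by (simp add: alg_mult_assoc e)
    moreover have "b = (\<Sum>h\<in>Sym n. alg_scale (coef b h) (\<delta> h))"
      using sum_single_coef[OF finite_Sym keysV[OF \<open>b \<in> ?V\<close>]] by simp
    ultimately have "\<delta> p \<star> b = \<delta> p \<star> ((\<Sum>h\<in>Sym n. alg_scale (coef b h) (\<delta> h)) \<star> e)"
      by metis
    then show ?thesis
      by (simp add: alg_mult_sum_left alg_mult_sum_right alg_mult_scale_left alg_mult_scale_right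
          flip: alg_mult_assoc del: alg_scale_single)
  qed
  have phe: "\<delta> (p \<circ> h) \<star> e \<in> ?V" if "h \<in> Sym n" for h
    using that p by (intro he) (auto intro: permutes_compose)
  have span: "\<delta> (p \<circ> h) \<star> e \<in> alg.span B" if "h \<in> Sym n" for h
    using phe[OF that] B(3) by (rule subsetD[rotated])
  have "trace_on ?V (\<lambda>v. \<delta> p \<star> v) = (\<Sum>b\<in>B. ?\<phi> (\<delta> p \<star> b) b)"
    by (simp add: trace_on_def B_def Let_def)
  also have "\<dots> = (\<Sum>b\<in>B. \<Sum>h\<in>Sym n. coef b h * ?\<phi> (\<delta> (p \<circ> h) \<star> e) b)"
  proof (intro sum.cong refl)
    fix b assume "b \<in> B"
    show "?\<phi> (\<delta> p \<star> b) b = (\<Sum>h\<in>Sym n. coef b h * ?\<phi> (\<delta> (p \<circ> h) \<star> e) b)"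
      unfolding b_exp[OF \<open>b \<in> B\<close>]
      by (subst alg.representation_sum[OF B(2)], rule alg.span_scale, erule span)
        (rule sum.cong[OF refl], simp only: alg.representation_scale[OF B(2) span])
  qed
  also have "\<dots> = (\<Sum>h\<in>Sym n. \<Sum>b\<in>B. coef b h * ?\<phi> (\<delta> (p \<circ> h) \<star> e) b)"
    by (rule sum.swap)
  also have "\<dots> = (\<Sum>h\<in>Sym n. coef (\<delta> (p \<circ> h) \<star> e) h)"
  proof (intro sum.cong refl)
    fix h assume "h \<in> Sym n"
    then have "(\<Sum>b\<in>B. alg_scale (?\<phi> (\<delta> (p \<circ> h) \<star> e) b) b) = \<delta> (p \<circ> h) \<star> e"
      using finB by (intro alg.sum_representation_eq B(2) span) simp_all
    then have "coef (\<delta> (p \<circ> h) \<star> e) h = coef (\<Sum>b\<in>B. alg_scale (?\<phi> (\<delta> (p \<circ> h) \<star> e) b) b) h"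
      by simp
    then show "(\<Sum>b\<in>B. coef b h * ?\<phi> (\<delta> (p \<circ> h) \<star> e) b) = coef (\<delta> (p \<circ> h) \<star> e) h"
      by (simp add: lookup_sum mult.commute)
  qed
  also have "\<dots> = conj_sum n e p"
    unfolding conj_sum_def
  proof (intro sum.cong refl)
    fix h assume "h \<in> Sym n"
    with p have "bij p" "bij h" by (auto intro: permutes_bij)
    then show "coef (\<delta> (p \<circ> h) \<star> e) h = coef e (inv h \<circ> inv p \<circ> h)"
      by (simp add: coef_delta_mult bij_comp o_inv_distrib)
  qed
  finally show ?thesis .
qed

lemma sum_Sym_compose_right:
  "k \<in> Sym n \<Longrightarrow> (\<Sum>h\<in>Sym n. f (h \<circ> k)) = (\<Sum>h\<in>Sym n. f h)"
  by (rule sum.reindex_bij_witness[of _ "\<lambda>h. h \<circ> inv k" "\<lambda>h. h \<circ> k"])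
    (auto simp: comp_assoc permutes_inv_o intro: permutes_compose permutes_inv)

lemma sum_Sym_compose_left:
  "k \<in> Sym n \<Longrightarrow> (\<Sum>h\<in>Sym n. f (k \<circ> h)) = (\<Sum>h\<in>Sym n. f h)"
  by (rule sum.reindex_bij_witness[of _ "\<lambda>h. inv k \<circ> h" "\<lambda>h. k \<circ> h"])
    (auto simp: permutes_inv_o permutes_compose permutes_inv simp flip: comp_assoc)

lemma sum_Sym_inv: "(\<Sum>h\<in>Sym n. f (inv h)) = (\<Sum>h\<in>Sym n. f h)"
  by (rule sum.reindex_bij_witness[of _ inv inv])
    (auto simp: permutes_inv permutes_inv_inv)

lemma conj_sum_conj:
  assumes "p \<in> Sym n" "k \<in> Sym n"
  shows "conj_sum n x (k \<circ> p \<circ> inv k) = conj_sum n x p"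
proof -
  have "conj_sum n x (k \<circ> p \<circ> inv k) = (\<Sum>h\<in>Sym n. coef x (inv (inv k \<circ> h) \<circ> inv p \<circ> (inv k \<circ> h)))"
    unfolding conj_sum_def
  proof (intro sum.cong refl)
    fix h assume "h \<in> Sym n"
    with assms have "bij p" "bij k" "bij h" by (auto intro: permutes_bij)
    then show "coef x (inv h \<circ> inv (k \<circ> p \<circ> inv k) \<circ> h) =
        coef x (inv (inv k \<circ> h) \<circ> inv p \<circ> (inv k \<circ> h))"
      by (simp add: o_inv_distrib bij_comp bij_imp_bij_inv inv_inv_eq comp_assoc)
  qed
  also have "\<dots> = conj_sum n x p"
    unfolding conj_sum_def using assms(2)
    by (intro sum_Sym_compose_left) (auto intro: permutes_inv)
  finally show ?thesis .
qed

lemma conj_sum_scale: "conj_sum n (alg_scale c x) p = c * conj_sum n x p"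
  by (simp add: conj_sum_def sum_distrib_left)

lemma conj_sum_inner:
  assumes x: "Poly_Mapping.keys x \<subseteq> Sym n" and y: "Poly_Mapping.keys y \<subseteq> Sym n"
  shows "(\<Sum>g\<in>Sym n. conj_sum n x g * conj_sum n y (inv g)) =
    fact n * (\<Sum>s\<in>Sym n. coef (x \<star> \<delta> (inv s) \<star> y \<star> \<delta> s) id)"
proof -
  have "(\<Sum>g\<in>Sym n. conj_sum n x g * conj_sum n y (inv g)) =
      (\<Sum>g\<in>Sym n. \<Sum>h\<in>Sym n. \<Sum>k\<in>Sym n. coef x (inv h \<circ> inv g \<circ> h) * coef y (inv k \<circ> g \<circ> k))"
    unfolding conj_sum_def sum_product
    by (intro sum.cong refl) (auto simp: permutes_inv_inv)
  also have "\<dots> = (\<Sum>h\<in>Sym n. \<Sum>g\<in>Sym n. \<Sum>k\<in>Sym n. coef x (inv h \<circ> inv g \<circ> h) * coef y (inv k \<circ> g \<circ> k))"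
    by (rule sum.swap)
  also have "\<dots> = (\<Sum>h\<in>Sym n. \<Sum>s\<in>Sym n. \<Sum>u\<in>Sym n. coef x u * coef y (s \<circ> inv u \<circ> inv s))"
  proof (rule sum.cong[OF refl])
    fix h assume h: "h \<in> Sym n"
    have hb: "bij h" using h by (auto intro: permutes_bij)
    have hi: "h \<circ> (inv h \<circ> z) = z" "inv h \<circ> (h \<circ> z) = z" for z
      using h by (auto simp: fun_eq_iff permutes_inverses)
    have "(\<Sum>g\<in>Sym n. \<Sum>k\<in>Sym n. coef x (inv h \<circ> inv g \<circ> h) * coef y (inv k \<circ> g \<circ> k)) =
       (\<Sum>u\<in>Sym n. \<Sum>k\<in>Sym n. coef x u * coef y (inv k \<circ> (h \<circ> inv u \<circ> inv h) \<circ> k))"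
    proof (rule sum.reindex_bij_witness[of _ "\<lambda>u. h \<circ> inv u \<circ> inv h" "\<lambda>g. inv h \<circ> inv g \<circ> h"])
      fix g assume g: "g \<in> Sym n"
      then have "bij g" by (auto intro: permutes_bij)
      show 1: "h \<circ> inv (inv h \<circ> inv g \<circ> h) \<circ> inv h = g"
        using hb \<open>bij g\<close> h by (simp add: o_inv_distrib bij_comp bij_imp_bij_inv inv_inv_eq comp_assoc hi)
          (auto simp: fun_eq_iff permutes_inverses)
      show "inv h \<circ> inv g \<circ> h \<in> Sym n" using g h by (auto intro: permutes_compose permutes_inv)
      show "(\<Sum>k\<in>Sym n. coef x (inv h \<circ> inv g \<circ> h) *
           coef y (inv k \<circ> (h \<circ> inv (inv h \<circ> inv g \<circ> h) \<circ> inv h) \<circ> k)) =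
         (\<Sum>k\<in>Sym n. coef x (inv h \<circ> inv g \<circ> h) * coef y (inv k \<circ> g \<circ> k))"
        by (simp only: 1)
    next
      fix u assume u: "u \<in> Sym n"
      then have "bij u" by (auto intro: permutes_bij)
      show "inv h \<circ> inv (h \<circ> inv u \<circ> inv h) \<circ> h = u"
        using hb \<open>bij u\<close> h by (simp add: o_inv_distrib bij_comp bij_imp_bij_inv inv_inv_eq comp_assoc hi)
          (auto simp: fun_eq_iff permutes_inverses)
      show "h \<circ> inv u \<circ> inv h \<in> Sym n" using u h by (auto intro: permutes_compose permutes_inv)
    qed
    also have "\<dots> = (\<Sum>k\<in>Sym n. \<Sum>u\<in>Sym n. coef x u * coef y (inv k \<circ> (h \<circ> inv u \<circ> inv h) \<circ> k))"
      by (rule sum.swap)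
    also have "\<dots> = (\<Sum>s\<in>Sym n. \<Sum>u\<in>Sym n. coef x u * coef y (s \<circ> (h \<circ> inv u \<circ> inv h) \<circ> inv s))"
      by (subst (2) sum_Sym_inv[symmetric]) (auto simp: permutes_inv_inv intro!: sum.cong)
    also have "\<dots> = (\<Sum>s\<in>Sym n. \<Sum>u\<in>Sym n. coef x u * coef y ((s \<circ> h) \<circ> inv u \<circ> inv (s \<circ> h)))"
      using hb by (auto simp: o_inv_distrib permutes_bij comp_assoc intro!: sum.cong)
    also have "\<dots> = (\<Sum>s\<in>Sym n. \<Sum>u\<in>Sym n. coef x u * coef y (s \<circ> inv u \<circ> inv s))"
      by (rule sum_Sym_compose_right[OF h])
    finally show "(\<Sum>g\<in>Sym n. \<Sum>k\<in>Sym n. coef x (inv h \<circ> inv g \<circ> h) * coef y (inv k \<circ> g \<circ> k)) =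
      (\<Sum>s\<in>Sym n. \<Sum>u\<in>Sym n. coef x u * coef y (s \<circ> inv u \<circ> inv s))" .
  qed
  also have "\<dots> = fact n * (\<Sum>s\<in>Sym n. \<Sum>u\<in>Sym n. coef x u * coef y (s \<circ> inv u \<circ> inv s))"
    by (simp add: card_permutations)
  also have "(\<Sum>s\<in>Sym n. \<Sum>u\<in>Sym n. coef x u * coef y (s \<circ> inv u \<circ> inv s)) =
     (\<Sum>s\<in>Sym n. coef (x \<star> \<delta> (inv s) \<star> y \<star> \<delta> s) id)"
  proof (rule sum.cong[OF refl])
    fix s assume s: "s \<in> Sym n"
    then have sb: "bij s" "bij (inv s)" by (auto intro: permutes_bij bij_imp_bij_inv)
    have ks: "Poly_Mapping.keys (\<delta> (inv s) \<star> y \<star> \<delta> s) \<subseteq> Sym n"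
      using s by (intro keys_mult_Sym y) (auto intro: permutes_inv)
    have "coef (x \<star> (\<delta> (inv s) \<star> y \<star> \<delta> s)) id = (\<Sum>u\<in>Sym n. coef x u * coef y (s \<circ> inv u \<circ> inv s))"
      by (subst coef_mult[OF x ks])
        (auto simp: permutes_id coef_mult_delta coef_delta_mult sb inv_inv_eq comp_assoc intro!: sum.cong)
    then show "(\<Sum>u\<in>Sym n. coef x u * coef y (s \<circ> inv u \<circ> inv s)) =
        coef (x \<star> \<delta> (inv s) \<star> y \<star> \<delta> s) id"
      by (simp add: alg_mult_assoc)
  qed
  finally show ?thesis .
qed

text \<open>If every \<open>x \<delta>\<^bsub>s\<inverse>\<^esub> y\<close> is a multiple \<open>\<kappa>(s) y\<close>, then \<open>x y y = (\<Sum>\<^bsub>s\<^esub> \<kappa>(s) y(s\<inverse>)) y\<close>, so the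
  inner sum of the previous lemma is \<open>1\<close>.\<close>

lemma conj_sum_inner_eq_fact:
  assumes x: "Poly_Mapping.keys x \<subseteq> Sym n" and y: "Poly_Mapping.keys y \<subseteq> Sym n"
    and mult: "\<And>s. s \<in> Sym n \<Longrightarrow> \<exists>c. x \<star> \<delta> (inv s) \<star> y = alg_scale c y"
    and xyy: "x \<star> y \<star> y = y" and "y \<noteq> 0"
  shows "(\<Sum>g\<in>Sym n. conj_sum n x g * conj_sum n y (inv g)) = fact n"
proof -
  from mult obtain k where k: "\<And>s. s \<in> Sym n \<Longrightarrow> x \<star> \<delta> (inv s) \<star> y = alg_scale (k s) y"
    by metis
  let ?S = "\<Sum>s\<in>Sym n. k s * coef y (inv s)"
  have "(\<Sum>s\<in>Sym n. coef (x \<star> \<delta> (inv s) \<star> y \<star> \<delta> s) id) = ?S"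
  proof (intro sum.cong refl)
    fix s assume s: "s \<in> Sym n"
    then have "bij s" by (auto intro: permutes_bij)
    then show "coef (x \<star> \<delta> (inv s) \<star> y \<star> \<delta> s) id = k s * coef y (inv s)"
      by (simp add: k[OF s] alg_mult_scale_left coef_mult_delta)
  qed
  moreover have "y = alg_scale ?S y"
  proof -
    have "y = (\<Sum>s\<in>Sym n. alg_scale (coef y s) (\<delta> s))"
      using sum_single_coef[OF finite_Sym y] by simp
    also have "\<dots> = (\<Sum>s\<in>Sym n. alg_scale (coef y (inv s)) (\<delta> (inv s)))"
      by (rule sum_Sym_inv[symmetric])
    finally have y_eq: "y = (\<Sum>s\<in>Sym n. alg_scale (coef y (inv s)) (\<delta> (inv s)))" .
    have "y = x \<star> y \<star> y" using xyy by simp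
    also have "\<dots> = x \<star> (\<Sum>s\<in>Sym n. alg_scale (coef y (inv s)) (\<delta> (inv s))) \<star> y"
      using y_eq by simp
    also have "\<dots> = (\<Sum>s\<in>Sym n. alg_scale (coef y (inv s)) (x \<star> \<delta> (inv s) \<star> y))"
      by (simp add: alg_mult_sum_left alg_mult_sum_right alg_mult_scale_left alg_mult_scale_right
          del: alg_scale_single)
    also have "\<dots> = (\<Sum>s\<in>Sym n. alg_scale (k s * coef y (inv s)) y)"
      by (intro sum.cong refl) (simp add: k mult.commute)
    also have "\<dots> = alg_scale ?S y"
      by (simp add: alg.scale_sum_left)
    finally show ?thesis .
  qed
  ultimately have "alg_scale (?S - 1) y = 0"
    by (simp add: alg.scale_left_diff_distrib)
  with \<open>y \<noteq> 0\<close> have "?S = 1" by simp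
  then show ?thesis
    using conj_sum_inner[OF x y] \<open>_ = ?S\<close> by simp
qed

subsection \<open>The anti-involution inverting group elements\<close>

definition star :: "group_algebra \<Rightarrow> group_algebra" where
  "star x = (\<Sum>p\<in>Poly_Mapping.keys x. Poly_Mapping.single (inv p) (coef x p))"

lemma star_superset:
  assumes "finite P" "Poly_Mapping.keys x \<subseteq> P"
  shows "star x = (\<Sum>p\<in>P. Poly_Mapping.single (inv p) (coef x p))"
  unfolding star_def by (intro sum.mono_neutral_left) (use assms in \<open>auto simp: in_keys_iff\<close>)

lemma star_add: "star (x + y) = star x + star y"
proof -
  let ?P = "Poly_Mapping.keys x \<union> Poly_Mapping.keys y"
  have "Poly_Mapping.keys (x + y) \<subseteq> ?P" by (rule keys_add)
  then show ?thesis
    by (simp add: star_superset[where P = ?P] lookup_add single_add sum.distrib)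
qed

lemma star_zero [simp]: "star 0 = 0"
  by (simp add: star_def)

lemma star_sum: "star (\<Sum>i\<in>I. f i) = (\<Sum>i\<in>I. star (f i))"
  by (induction I rule: infinite_finite_induct) (simp_all add: star_add)

lemma star_single [simp]: "star (Poly_Mapping.single p c) = Poly_Mapping.single (inv p) c"
  by (simp add: star_def)

lemma star_mult:
  assumes "Poly_Mapping.keys x \<subseteq> Sym n" "Poly_Mapping.keys y \<subseteq> Sym n"
  shows "star (x \<star> y) = star y \<star> star x"
proof -
  have "star (x \<star> y) = (\<Sum>p\<in>Sym n. \<Sum>q\<in>Sym n. Poly_Mapping.single (inv (p \<circ> q)) (coef x p * coef y q))"
    by (simp add: alg_mult_superset[OF finite_Sym finite_Sym assms] star_sum)
  also have "\<dots> = (\<Sum>p\<in>Sym n. \<Sum>q\<in>Sym n. Poly_Mapping.single (inv q) (coef y q) \<star> Poly_Mapping.single (inv p) (coef x p))"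
    by (intro sum.cong refl) (auto simp: o_inv_distrib permutes_bij mult.commute)
  also have "\<dots> = star y \<star> star x"
    unfolding star_superset[OF finite_Sym assms(1)] star_superset[OF finite_Sym assms(2)] alg_mult_expand
    by (rule sum.swap)
  finally show ?thesis .
qed

lemma coef_star:
  assumes "Poly_Mapping.keys x \<subseteq> Sym n" "p \<in> Sym n"
  shows "coef (star x) p = coef x (inv p)"
proof -
  have "coef (star x) p = (\<Sum>q\<in>Sym n. coef x q when inv q = p)"
    by (simp add: star_superset[OF finite_Sym assms(1)] lookup_sum lookup_single)
  also have "\<dots> = (\<Sum>q\<in>Sym n. if q = inv p then coef x q else 0)"
    using assms(2) by (intro sum.cong refl) (auto simp: when_def permutes_inv_inv)
  also have "\<dots> = coef x (inv p)"
    using assms(2) by (simp add: permutes_inv)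
  finally show ?thesis .
qed

lemma keys_star:
  assumes "Poly_Mapping.keys x \<subseteq> Sym n"
  shows "Poly_Mapping.keys (star x) \<subseteq> Sym n"
proof -
  have "Poly_Mapping.keys (star x) \<subseteq> (\<Union>p\<in>Sym n. Poly_Mapping.keys (Poly_Mapping.single (inv p) (coef x p)))"
    unfolding star_superset[OF finite_Sym assms] by (rule keys_sum)
  also have "\<dots> \<subseteq> Sym n" by (auto intro: permutes_inv split: if_splits)
  finally show ?thesis .
qed

lemma mult_star_nonzero:
  assumes x: "Poly_Mapping.keys x \<subseteq> Sym n" and "x \<noteq> 0"
  shows "x \<star> star x \<noteq> 0"
proof -
  have "coef (x \<star> star x) id = (\<Sum>p\<in>Sym n. coef x p * coef x p)"
    using x by (subst coef_mult[OF x keys_star[OF x]])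
      (auto simp: coef_star permutes_id permutes_inv permutes_inv_inv intro!: sum.cong)
  moreover obtain p where "coef x p \<noteq> 0"
    using \<open>x \<noteq> 0\<close> poly_mapping_eqI[of x 0] by auto
  moreover from this have "p \<in> Sym n" using x by (auto simp: in_keys_iff)
  ultimately have "coef (x \<star> star x) id > 0"
    by (auto intro!: sum_pos2[of _ p] simp: zero_less_mult_iff linorder_neq_iff)
  then show ?thesis by auto
qed

subsection \<open>Tableaux\<close>

lemma finite_partition_sum: "x \<in># \<alpha> \<Longrightarrow> x \<le> sum_mset (\<alpha> :: partition)"
  by (induction \<alpha>) auto

lemma mset_parts_list [simp]: "mset (parts_list \<alpha>) = \<alpha>"
  by (simp add: parts_list_def)

lemma length_parts_list [simp]: "length (parts_list \<alpha>) = size \<alpha>"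
  by (metis mset_parts_list size_mset)

lemma sum_list_parts_list [simp]: "sum_list (parts_list \<alpha>) = sum_mset \<alpha>"
  by (metis mset_parts_list sum_mset_sum_list)

lemma parts_list_antimono: "i \<le> j \<Longrightarrow> j < size \<alpha> \<Longrightarrow> parts_list \<alpha> ! j \<le> parts_list \<alpha> ! i"
  by (rule sorted_rev_nth_mono) (simp_all, simp add: parts_list_def)

abbreviation row_start :: "partition \<Rightarrow> nat \<Rightarrow> nat" where
  "row_start \<alpha> i \<equiv> sum_list (take i (parts_list \<alpha>))"

lemma row_start_Suc: "i < size \<alpha> \<Longrightarrow> row_start \<alpha> (Suc i) = row_start \<alpha> i + parts_list \<alpha> ! i"
  by (simp add: take_Suc_conv_app_nth)

lemma row_start_mono: "i \<le> j \<Longrightarrow> row_start \<alpha> i \<le> row_start \<alpha> j"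
  by (metis append_take_drop_id le_add1 min.absorb1 sum_list_append take_take)

lemma row_start_le: "row_start \<alpha> i \<le> sum_mset \<alpha>"
  using row_start_mono[of i "max i (size \<alpha>)" \<alpha>] by simp

lemma tab_row_bounds:
  assumes "k < sum_mset \<alpha>"
  shows "tab_row \<alpha> k < size \<alpha>" "row_start \<alpha> (tab_row \<alpha> k) \<le> k" "k < row_start \<alpha> (Suc (tab_row \<alpha> k))"
proof -
  let ?r = "tab_row \<alpha> k"
  have "k < row_start \<alpha> (Suc (size \<alpha>))" using assms by simp
  then show 1: "k < row_start \<alpha> (Suc ?r)" unfolding tab_row_def by (rule LeastI)
  show 2: "row_start \<alpha> ?r \<le> k"
  proof (cases ?r)
    case (Suc i)
    then have "\<not> k < row_start \<alpha> (Suc i)"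
      using not_less_Least[of i "\<lambda>i. k < row_start \<alpha> (Suc i)"] by (simp add: tab_row_def)
    with Suc show ?thesis by simp
  qed simp
  then show "?r < size \<alpha>" using assms by (rule_tac ccontr) simp
qed

lemma tab_row_eqI:
  assumes "row_start \<alpha> i \<le> k" "k < row_start \<alpha> (Suc i)"
  shows "tab_row \<alpha> k = i"
  unfolding tab_row_def
proof (rule Least_equality)
  fix j assume "k < row_start \<alpha> (Suc j)"
  show "i \<le> j"
  proof (rule ccontr)
    assume "\<not> i \<le> j"
    then have "row_start \<alpha> (Suc j) \<le> row_start \<alpha> i" by (intro row_start_mono) simp
    with \<open>k < row_start \<alpha> (Suc j)\<close> assms(1) show False by simp
  qed
qed (rule assms)

lemma tab_row_row_start_add:
  assumes "i < size \<alpha>" "c < parts_list \<alpha> ! i"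
  shows "tab_row \<alpha> (row_start \<alpha> i + c) = i" "tab_col \<alpha> (row_start \<alpha> i + c) = c"
    "row_start \<alpha> i + c < sum_mset \<alpha>"
proof -
  show 1: "tab_row \<alpha> (row_start \<alpha> i + c) = i"
    using assms by (intro tab_row_eqI) (simp_all add: row_start_Suc)
  then show "tab_col \<alpha> (row_start \<alpha> i + c) = c" by (simp add: tab_col_def)
  have "row_start \<alpha> i + c < row_start \<alpha> (Suc i)" using assms by (simp add: row_start_Suc)
  then show "row_start \<alpha> i + c < sum_mset \<alpha>" using row_start_le[of "Suc i" \<alpha>] by linarith
qed

lemma row_start_add_tab_col:
  "k < sum_mset \<alpha> \<Longrightarrow> row_start \<alpha> (tab_row \<alpha> k) + tab_col \<alpha> k = k"
  using tab_row_bounds[of k \<alpha>] by (simp add: tab_col_def)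

lemma tab_col_less:
  "k < sum_mset \<alpha> \<Longrightarrow> tab_col \<alpha> k < parts_list \<alpha> ! tab_row \<alpha> k"
  using tab_row_bounds[of k \<alpha>] row_start_Suc[of "tab_row \<alpha> k" \<alpha>] by (simp add: tab_col_def)

lemma tab_inj:
  "x < sum_mset \<alpha> \<Longrightarrow> y < sum_mset \<alpha> \<Longrightarrow> tab_row \<alpha> x = tab_row \<alpha> y \<Longrightarrow>
    tab_col \<alpha> x = tab_col \<alpha> y \<Longrightarrow> x = y"
  by (metis row_start_add_tab_col)

lemma tab_col_downward:
  assumes "x < sum_mset \<alpha>" "i < tab_row \<alpha> x"
  shows "\<exists>y<sum_mset \<alpha>. tab_row \<alpha> y = i \<and> tab_col \<alpha> y = tab_col \<alpha> x"
proof -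
  have "i < size \<alpha>" using tab_row_bounds(1)[OF assms(1)] assms(2) by simp
  moreover have "tab_col \<alpha> x < parts_list \<alpha> ! i"
    using tab_col_less[OF assms(1)] parts_list_antimono[of i "tab_row \<alpha> x" \<alpha>] assms(2)
      tab_row_bounds(1)[OF assms(1)] by simp
  ultimately show ?thesis using tab_row_row_start_add by blast
qed

lemma tab_row_fiber:
  "i < size \<alpha> \<Longrightarrow> {x. x < sum_mset \<alpha> \<and> tab_row \<alpha> x = i} = {row_start \<alpha> i..<row_start \<alpha> (Suc i)}"
  using tab_row_bounds tab_row_eqI row_start_le[of "Suc i" \<alpha>]
  by (auto simp del: take_Suc_conv_app_nth)

lemma card_tab_row_fiber:
  "card {x. x < sum_mset \<alpha> \<and> tab_row \<alpha> x = i} = (if i < size \<alpha> then parts_list \<alpha> ! i else 0)"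
proof (cases "i < size \<alpha>")
  case True
  then show ?thesis using tab_row_fiber[OF True] by (simp add: row_start_Suc)
next
  case False
  then have "{x. x < sum_mset \<alpha> \<and> tab_row \<alpha> x = i} = {}" using tab_row_bounds(1) by auto
  then have "card {x. x < sum_mset \<alpha> \<and> tab_row \<alpha> x = i} = 0" by (simp only: card.empty)
  with False show ?thesis by simp
qed

lemma partition_eqI:
  assumes "0 \<notin># \<alpha>" "0 \<notin># \<beta>"
    and eq: "\<And>i. (if i < size \<alpha> then parts_list \<alpha> ! i else 0) = (if i < size \<beta> then parts_list \<beta> ! i else 0)"
  shows "\<alpha> = \<beta>"
proof -
  have pos: "0 < parts_list \<gamma> ! i" if "0 \<notin># \<gamma>" "i < size \<gamma>" for \<gamma> i
  proof -
    have "parts_list \<gamma> ! i \<in> set (parts_list \<gamma>)" using that(2) by simp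
    then have "parts_list \<gamma> ! i \<in># \<gamma>" by (metis mset_parts_list set_mset_mset)
    with that(1) show ?thesis by (metis gr0I)
  qed
  have "size \<alpha> = size \<beta>"
    using eq[of "size \<alpha>"] eq[of "size \<beta>"] pos[OF assms(1), of "size \<beta>"] pos[OF assms(2), of "size \<alpha>"]
    by (cases "size \<alpha>" "size \<beta>" rule: linorder_cases) auto
  then have "parts_list \<alpha> = parts_list \<beta>"
    using eq by (intro nth_equalityI) (auto split: if_splits, metis)
  then show ?thesis by (metis mset_parts_list)
qed

subsection \<open>Young's lemma\<close>

definition row_stat :: "partition \<Rightarrow> nat" where
  "row_stat \<alpha> = (\<Sum>x<sum_mset \<alpha>. tab_row \<alpha> x)"

lemma sum_nat_set_ge:
  assumes "finite A"
  shows "\<Sum>{..<card A} \<le> \<Sum>A \<and> (\<Sum>{..<card A} = \<Sum>A \<longrightarrow> A = {..<card A})"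
  using assms
proof (induction "card A" arbitrary: A)
  case (Suc k)
  then have fin: "finite A" "A \<noteq> {}" by auto
  let ?m = "Max A" and ?A = "A - {Max A}"
  have mA: "?m \<in> A" using fin by simp
  have card: "card ?A = k" using Suc.hyps(2) mA fin by simp
  have "A \<subseteq> {..?m}" using fin by auto
  then have "card A \<le> Suc ?m" using card_mono[of "{..?m}" A] by simp
  then have m: "k \<le> ?m" using Suc.hyps(2) by simp
  have IH: "\<Sum>{..<k} \<le> \<Sum>?A" "\<Sum>{..<k} = \<Sum>?A \<longrightarrow> ?A = {..<k}"
    using Suc.hyps(1)[of ?A] card fin by auto
  have sumA: "\<Sum>A = ?m + \<Sum>?A" by (rule sum.remove[OF fin(1) mA])
  have card_A: "card A = Suc k" using Suc.hyps(2) by simp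
  have s: "\<Sum>{..<Suc k} = k + \<Sum>{..<k}" by (simp add: lessThan_Suc)
  have "A = {..<Suc k}" if "\<Sum>{..<Suc k} = \<Sum>A"
  proof -
    have mk: "?m = k" and "\<Sum>{..<k} = \<Sum>?A" using that m IH(1) sumA s by linarith+
    then have "?A = {..<k}" using IH(2) by blast
    moreover have "A = insert ?m ?A" using mA by (simp add: insert_absorb)
    ultimately show ?thesis unfolding mk by (simp add: lessThan_Suc)
  qed
  moreover have "\<Sum>{..<Suc k} \<le> \<Sum>A" using m IH(1) sumA s by linarith
  ultimately show ?case unfolding card_A by blast
qed simp

lemma downward_closed_eq_lessThan:
  assumes "finite S" and "\<And>i j. j \<in> S \<Longrightarrow> i < j \<Longrightarrow> i \<in> (S :: nat set)"
  shows "S = {..<card S}"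
proof (cases "S = {}")
  case False
  then have M: "Max S \<in> S" using assms(1) by simp
  have "i \<in> S" if "i \<le> Max S" for i
    using assms(2)[OF M, of i] M that by (cases "i = Max S") auto
  then have "S = {..Max S}" using assms(1) by auto
  then show ?thesis by (metis card_atMost lessThan_Suc_atMost)
qed simp

lemma column_sum_le:
  fixes r r' c :: "nat \<Rightarrow> nat"
  assumes inj: "\<And>x y. x < n \<Longrightarrow> y < n \<Longrightarrow> r x = r y \<Longrightarrow> c x = c y \<Longrightarrow> x = y"
    and inj': "\<And>x y. x < n \<Longrightarrow> y < n \<Longrightarrow> r' x = r' y \<Longrightarrow> c x = c y \<Longrightarrow> x = y"
    and down: "\<And>x i. x < n \<Longrightarrow> i < r' x \<Longrightarrow> \<exists>y<n. r' y = i \<and> c y = c x"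
  shows "(\<Sum>x<n. r' x) \<le> (\<Sum>x<n. r x)"
    and "(\<Sum>x<n. r' x) = (\<Sum>x<n. r x) \<Longrightarrow> r ` {x. x < n \<and> c x = j} = r' ` {x. x < n \<and> c x = j}"
proof -
  let ?X = "\<lambda>j. {x. x < n \<and> c x = j}"
  have injX: "inj_on r (?X j)" "inj_on r' (?X j)" for j
    by (intro inj_onI; elim CollectE conjE; rule inj inj'; simp)+
  have split: "(\<Sum>x<n. f x) = (\<Sum>j\<in>c ` {..<n}. \<Sum>x\<in>?X j. f x)" for f :: "nat \<Rightarrow> nat"
    using sum.image_gen[of "{..<n}" f c] by simp
  have fin: "finite (?X j)" for j by simp
  have r': "r' ` ?X j = {..<card (?X j)}" for j
  proof -
    have "r' ` ?X j = {..<card (r' ` ?X j)}"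
    proof (rule downward_closed_eq_lessThan)
      fix i k assume "k \<in> r' ` ?X j" "i < k"
      then obtain x where "x < n" "c x = j" "i < r' x" by auto
      with down[of x i] show "i \<in> r' ` ?X j" by auto
    qed simp
    then show ?thesis using card_image[OF injX(2)] by metis
  qed
  have sum_r: "(\<Sum>x\<in>?X j. r x) = \<Sum>(r ` ?X j)" "(\<Sum>x\<in>?X j. r' x) = \<Sum>(r' ` ?X j)" for j
    using injX by (simp_all add: sum.reindex)
  have card_r: "card (r ` ?X j) = card (?X j)" for j
    by (rule card_image[OF injX(1)])
  have le: "(\<Sum>x\<in>?X j. r' x) \<le> (\<Sum>x\<in>?X j. r x)" for j
    using sum_nat_set_ge[of "r ` ?X j"] unfolding sum_r r' card_r by simp
  then show "(\<Sum>x<n. r' x) \<le> (\<Sum>x<n. r x)"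
    unfolding split by (rule sum_mono)
  assume eq: "(\<Sum>x<n. r' x) = (\<Sum>x<n. r x)"
  show "r ` ?X j = r' ` ?X j"
  proof (cases "j \<in> c ` {..<n}")
    case True
    have "(\<Sum>x\<in>?X j. r' x) = (\<Sum>x\<in>?X j. r x)"
      by (rule sum_mono_inv[OF eq[unfolded split] le True]) simp
    then have "\<Sum>{..<card (r ` ?X j)} = \<Sum>(r ` ?X j)" unfolding sum_r r' card_r .
    then have "r ` ?X j = {..<card (r ` ?X j)}" using sum_nat_set_ge[of "r ` ?X j"] by simp
    then show ?thesis unfolding r' card_r .
  next
    case False
    then have "?X j = {}" by auto
    then show ?thesis by (simp only: image_empty)
  qed
qed

definition perm_group :: "nat \<Rightarrow> (nat \<Rightarrow> nat) set \<Rightarrow> bool" where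
  "perm_group n H \<longleftrightarrow> H \<subseteq> Sym n \<and> id \<in> H \<and> (\<forall>p\<in>H. \<forall>q\<in>H. p \<circ> q \<in> H) \<and> (\<forall>p\<in>H. inv p \<in> H)"

lemma perm_groupD:
  assumes "perm_group n H"
  shows "finite H" "p \<in> H \<Longrightarrow> p permutes {..<n}" "p \<in> H \<Longrightarrow> q \<in> H \<Longrightarrow> p \<circ> q \<in> H" "p \<in> H \<Longrightarrow> inv p \<in> H"
    "id \<in> H"
  using assms finite_subset[of H "Sym n"] by (auto simp: perm_group_def)

lemma perm_group_fixing:
  "perm_group n {p. p permutes {..<n} \<and> (\<forall>k<n. f (p k) = f k)}"
  unfolding perm_group_def
proof (intro conjI ballI)
  fix p assume p: "p \<in> {p. p permutes {..<n} \<and> (\<forall>k<n. f (p k) = f k)}"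
  have "f (inv p k) = f k" if "k < n" for k
  proof -
    have "inv p k < n" using p that permutes_in_image[OF permutes_inv, of p "{..<n}" k] by simp
    then have "f (p (inv p k)) = f (inv p k)" using p by simp
    moreover have "p (inv p k) = k" using p by (auto intro: permutes_inverses)
    ultimately show ?thesis by simp
  qed
  with p show "inv p \<in> {p. p permutes {..<n} \<and> (\<forall>k<n. f (p k) = f k)}"
    by (simp add: permutes_inv)
next
  fix p q
  assume p: "p \<in> {p. p permutes {..<n} \<and> (\<forall>k<n. f (p k) = f k)}"
    and q: "q \<in> {p. p permutes {..<n} \<and> (\<forall>k<n. f (p k) = f k)}"
  have "q k < n" if "k < n" for k
    using q that permutes_in_image[of q "{..<n}" k] by simp
  with p q show "p \<circ> q \<in> {p. p permutes {..<n} \<and> (\<forall>k<n. f (p k) = f k)}"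
    by (simp add: permutes_compose)
qed (auto simp: permutes_id)

lemma perm_group_row: "perm_group (sum_mset \<alpha>) (row_group \<alpha>)"
  unfolding row_group_def by (rule perm_group_fixing)

lemma perm_group_col: "perm_group (sum_mset \<alpha>) (col_group \<alpha>)"
  unfolding col_group_def by (rule perm_group_fixing)

lemma perm_group_sum_right:
  assumes "perm_group n H" "t \<in> H" shows "(\<Sum>p\<in>H. f (p \<circ> t)) = (\<Sum>p\<in>H. f p)"
  by (rule sum.reindex_bij_witness[of _ "\<lambda>h. h \<circ> inv t" "\<lambda>h. h \<circ> t"])
    (use assms perm_groupD[OF assms(1)] in
      \<open>auto simp: comp_assoc permutes_inv_o[OF perm_groupD(2)[OF assms]]\<close>)

lemma perm_group_sum_left:
  assumes "perm_group n H" "t \<in> H" shows "(\<Sum>p\<in>H. f (t \<circ> p)) = (\<Sum>p\<in>H. f p)"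
  by (rule sum.reindex_bij_witness[of _ "\<lambda>h. inv t \<circ> h" "\<lambda>h. t \<circ> h"])
    (use assms perm_groupD[OF assms(1)] in
      \<open>auto simp: permutes_inv_o[OF perm_groupD(2)[OF assms]] simp flip: comp_assoc\<close>)

lemma perm_group_sum_inv:
  assumes "perm_group n H" shows "(\<Sum>p\<in>H. f (inv p)) = (\<Sum>p\<in>H. f p)"
  by (rule sum.reindex_bij_witness[of _ inv inv])
    (use assms perm_groupD[OF assms(1)] in
      \<open>auto simp: permutes_inv_inv[OF perm_groupD(2)[OF assms]]\<close>)

abbreviation sgn_of :: "(nat \<Rightarrow> nat) \<Rightarrow> rat" where
  "sgn_of p \<equiv> of_int (sign p)"

lemma sgn_of_square: "sgn_of p * sgn_of p = 1"
  by (simp add: sign_def)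

definition row_sum :: "partition \<Rightarrow> group_algebra" where
  "row_sum \<alpha> = (\<Sum>p\<in>row_group \<alpha>. \<delta> p)"

definition col_sum :: "partition \<Rightarrow> group_algebra" where
  "col_sum \<alpha> = (\<Sum>q\<in>col_group \<alpha>. Poly_Mapping.single q (sgn_of q))"

lemma young_symmetrizer_eq: "young_symmetrizer \<alpha> = row_sum \<alpha> \<star> col_sum \<alpha>"
  by (simp add: young_symmetrizer_def row_sum_def col_sum_def)

lemma row_sum_absorb:
  assumes "t \<in> row_group \<alpha>"
  shows "row_sum \<alpha> \<star> \<delta> t = row_sum \<alpha>" "\<delta> t \<star> row_sum \<alpha> = row_sum \<alpha>"
  using perm_group_sum_right[OF perm_group_row assms, of \<delta>] perm_group_sum_left[OF perm_group_row assms, of \<delta>]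
  by (simp_all add: row_sum_def alg_mult_sum_left alg_mult_sum_right)

lemma col_sum_absorb:
  assumes t: "t \<in> col_group \<alpha>"
  shows "col_sum \<alpha> \<star> \<delta> t = alg_scale (sgn_of t) (col_sum \<alpha>)"
    "\<delta> t \<star> col_sum \<alpha> = alg_scale (sgn_of t) (col_sum \<alpha>)"
proof -
  note perm = perm_groupD(2)[OF perm_group_col]
  have sg: "sgn_of (p \<circ> q) = sgn_of p * sgn_of q" if "p \<in> col_group \<alpha>" "q \<in> col_group \<alpha>" for p q
    using that perm by (subst sign_compose) (auto intro: permutation_permutes[THEN iffD2])
  let ?f = "\<lambda>q. Poly_Mapping.single q (sgn_of q)"
  have "alg_scale (sgn_of t) (col_sum \<alpha>) = (\<Sum>q\<in>col_group \<alpha>. alg_scale (sgn_of t) (?f (q \<circ> t)))"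
    unfolding col_sum_def
    by (subst perm_group_sum_right[OF perm_group_col t, symmetric]) (simp only: alg.scale_sum_right)
  also have "\<dots> = col_sum \<alpha> \<star> \<delta> t"
    unfolding col_sum_def alg_mult_sum_left
    by (intro sum.cong refl) (simp add: sg t sgn_of_square mult.left_commute)
  finally show "col_sum \<alpha> \<star> \<delta> t = alg_scale (sgn_of t) (col_sum \<alpha>)" by simp
  have "alg_scale (sgn_of t) (col_sum \<alpha>) = (\<Sum>q\<in>col_group \<alpha>. alg_scale (sgn_of t) (?f (t \<circ> q)))"
    unfolding col_sum_def
    by (subst perm_group_sum_left[OF perm_group_col t, symmetric]) (simp only: alg.scale_sum_right)
  also have "\<dots> = \<delta> t \<star> col_sum \<alpha>"
    unfolding col_sum_def alg_mult_sum_right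
    by (intro sum.cong refl) (simp add: sg t sgn_of_square flip: mult.assoc)
  finally show "\<delta> t \<star> col_sum \<alpha> = alg_scale (sgn_of t) (col_sum \<alpha>)" by simp
qed

lemma keys_row_sum: "Poly_Mapping.keys (row_sum \<alpha>) \<subseteq> Sym (sum_mset \<alpha>)"
proof -
  have "Poly_Mapping.keys (row_sum \<alpha>) \<subseteq> (\<Union>p\<in>row_group \<alpha>. Poly_Mapping.keys (\<delta> p))"
    unfolding row_sum_def by (rule keys_sum)
  then show ?thesis using perm_groupD(2)[OF perm_group_row] by auto
qed

lemma keys_col_sum: "Poly_Mapping.keys (col_sum \<alpha>) \<subseteq> Sym (sum_mset \<alpha>)"
proof -
  have "Poly_Mapping.keys (col_sum \<alpha>) \<subseteq> (\<Union>p\<in>col_group \<alpha>. Poly_Mapping.keys (Poly_Mapping.single p (sgn_of p)))"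
    unfolding col_sum_def by (rule keys_sum)
  then show ?thesis using perm_groupD(2)[OF perm_group_col] by (auto split: if_splits)
qed

lemma keys_young: "Poly_Mapping.keys (young_symmetrizer \<alpha>) \<subseteq> Sym (sum_mset \<alpha>)"
  unfolding young_symmetrizer_eq by (intro keys_mult_Sym keys_row_sum keys_col_sum)

lemma row_mult_col_zero:
  assumes g: "g \<in> Sym n" and sums: "sum_mset \<alpha> = n" "sum_mset \<beta> = n"
    and xy: "x < n" "y < n" "x \<noteq> y" "tab_row \<alpha> x = tab_row \<alpha> y"
      "tab_col \<beta> (inv g x) = tab_col \<beta> (inv g y)"
  shows "row_sum \<alpha> \<star> \<delta> g \<star> col_sum \<beta> = 0"
proof -
  have gb: "bij g" and gp: "g permutes {..<n}" using g by (auto intro: permutes_bij)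
  let ?t = "Transposition.transpose x y" and ?u = "Transposition.transpose (inv g x) (inv g y)"
  have lt: "inv g x < n" "inv g y < n"
    using permutes_in_image[OF permutes_inv[OF gp]] xy by auto
  have t: "?t \<in> row_group \<alpha>"
    using xy sums by (auto simp: row_group_def transpose_def intro: permutes_swap_id)
  have u: "?u \<in> col_group \<beta>"
    using xy sums lt by (auto simp: col_group_def transpose_def intro: permutes_swap_id)
  have ne: "inv g x \<noteq> inv g y" using xy(3) permutes_inj[OF permutes_inv[OF gp]] by (auto dest: injD)
  have comm: "?t \<circ> g = g \<circ> ?u"
  proof
    fix z
    show "(?t \<circ> g) z = (g \<circ> ?u) z"
      using permutes_inverses[OF gp] by (auto simp: transpose_def)
  qed
  let ?z = "row_sum \<alpha> \<star> \<delta> g \<star> col_sum \<beta>"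
  have "?z = row_sum \<alpha> \<star> (\<delta> ?t \<star> \<delta> g) \<star> col_sum \<beta>"
    by (simp only: alg_mult_assoc[symmetric] row_sum_absorb[OF t])
  also have "\<delta> ?t \<star> \<delta> g = \<delta> g \<star> \<delta> ?u"
    by (simp add: comm)
  also have "row_sum \<alpha> \<star> (\<delta> g \<star> \<delta> ?u) \<star> col_sum \<beta> = row_sum \<alpha> \<star> \<delta> g \<star> (\<delta> ?u \<star> col_sum \<beta>)"
    by (simp only: alg_mult_assoc)
  also have "\<dots> = alg_scale (sgn_of ?u) ?z"
    by (simp only: col_sum_absorb(2)[OF u] alg_mult_scale_right)
  also have "sgn_of ?u = - 1"
    using ne by (simp add: sign_swap_id)
  finally have z: "?z = alg_scale (- 1) ?z" .
  have "alg_scale (1 - (- 1)) ?z = 0"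
    unfolding alg.scale_left_diff_distrib z[symmetric] by simp
  then show ?thesis by simp
qed

lemma row_mult_col_nonzero:
  assumes g: "g \<in> Sym n" and part: "\<alpha> \<in> partitions n" "\<beta> \<in> partitions n"
    and nz: "row_sum \<alpha> \<star> \<delta> g \<star> col_sum \<beta> \<noteq> 0"
  shows "row_stat \<beta> \<le> row_stat \<alpha>"
    and "row_stat \<beta> = row_stat \<alpha> \<Longrightarrow> \<alpha> = \<beta> \<and> (\<exists>p\<in>row_group \<alpha>. \<exists>q\<in>col_group \<alpha>. g = p \<circ> q)"
proof -
  have sums: "sum_mset \<alpha> = n" "sum_mset \<beta> = n" and z: "0 \<notin># \<alpha>" "0 \<notin># \<beta>"
    using part by (auto simp: partitions_def)
  have gp: "g permutes {..<n}" using g by simp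
  define r where "r = tab_row \<alpha>"
  define r' where "r' = (\<lambda>x. tab_row \<beta> (inv g x))"
  define c where "c = (\<lambda>x. tab_col \<beta> (inv g x))"
  have lt: "inv g x < n" "g x < n" if "x < n" for x
    using permutes_in_image[OF permutes_inv[OF gp]] permutes_in_image[OF gp] that by auto
  have inj: "x = y" if "x < n" "y < n" "r x = r y" "c x = c y" for x y
    using row_mult_col_zero[OF g sums, of x y] that nz by (auto simp: r_def c_def)
  have inj': "x = y" if "x < n" "y < n" "r' x = r' y" "c x = c y" for x y
    using tab_inj[of "inv g x" \<beta> "inv g y"] that lt sums permutes_inj[OF permutes_inv[OF gp]]
    by (auto simp: r'_def c_def dest: injD)
  have down: "\<exists>y<n. r' y = i \<and> c y = c x" if xi: "x < n" "i < r' x" for x i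
  proof -
    obtain y where "y < n" "tab_row \<beta> y = i" "tab_col \<beta> y = c x"
      using tab_col_downward[of "inv g x" \<beta> i, unfolded sums] xi lt by (auto simp: r'_def c_def)
    then show ?thesis using lt by (intro exI[of _ "g y"]) (auto simp: r'_def c_def permutes_inverses[OF gp])
  qed
  have stat: "row_stat \<alpha> = (\<Sum>x<n. r x)" "row_stat \<beta> = (\<Sum>x<n. r' x)"
  proof -
    show "row_stat \<alpha> = (\<Sum>x<n. r x)" by (simp add: row_stat_def r_def sums)
    show "row_stat \<beta> = (\<Sum>x<n. r' x)"
      unfolding row_stat_def sums r'_def using permutes_inv[OF gp]
      by (subst sum.permute) (auto simp: comp_def)
  qed
  show "row_stat \<beta> \<le> row_stat \<alpha>"
    unfolding stat by (rule column_sum_le(1)[where r = r and r' = r' and c = c, OF inj inj' down])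
  assume "row_stat \<beta> = row_stat \<alpha>"
  then have im: "r ` {x. x < n \<and> c x = j} = r' ` {x. x < n \<and> c x = j}" for j
    unfolding stat by (rule column_sum_le(2)[where r = r and r' = r' and c = c, rotated 3])
      (erule (3) inj, erule (3) inj', erule (1) down)
  have "\<exists>y<n. c y = c x \<and> r y = r' x" if "x < n" for x
    using im[of "c x"] that by (auto simp: image_iff set_eq_iff) metis
  then obtain f where f: "\<And>x. x < n \<Longrightarrow> f x < n \<and> c (f x) = c x \<and> r (f x) = r' x" by metis
  define q where "q = (\<lambda>x. if x < n then f x else x)"
  have "inj_on q {..<n}"
  proof (rule inj_onI)
    fix x y assume "x \<in> {..<n}" "y \<in> {..<n}" "q x = q y"
    then have xy: "x < n" "y < n" "f x = f y" by (auto simp: q_def)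
    have "r' x = r' y" "c x = c y" using f[OF xy(1)] f[OF xy(2)] xy(3) by auto
    with xy(1,2) show "x = y" by (rule inj')
  qed
  moreover have "q ` {..<n} \<subseteq> {..<n}" using f by (auto simp: q_def)
  ultimately have "bij_betw q {..<n} {..<n}"
    by (simp add: bij_betw_def endo_inj_surj)
  then have qp: "q permutes {..<n}"
    by (intro bij_imp_permutes) (auto simp: q_def)
  have q: "q x < n" "c (q x) = c x" "r (q x) = r' x" if "x < n" for x
    using f that by (auto simp: q_def)
  have "\<alpha> = \<beta>"
  proof (rule partition_eqI[OF z])
    fix i
    have "card {x. x < n \<and> tab_row \<alpha> x = i} = card {x. x < n \<and> tab_row \<beta> x = i}"
    proof (rule bij_betw_same_card[symmetric])
      have "q \<circ> g permutes {..<n}" by (rule permutes_compose[OF gp qp])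
      moreover have "tab_row \<alpha> (q (g x)) = tab_row \<beta> x" if "x < n" for x
        using q(3)[of "g x"] lt that by (simp add: r_def r'_def permutes_inverses[OF gp])
      ultimately have 1: "q \<circ> g permutes {..<n}" "\<And>x. x < n \<Longrightarrow> tab_row \<alpha> ((q \<circ> g) x) = tab_row \<beta> x"
        by auto
      have "(q \<circ> g) ` {x. x < n \<and> tab_row \<beta> x = i} = {x. x < n \<and> tab_row \<alpha> x = i}" (is "?L = ?R")
      proof (intro equalityI subsetI)
        fix y assume y: "y \<in> ?R"
        then have "y \<in> (q \<circ> g) ` {..<n}" unfolding permutes_image[OF 1(1)] by simp
        then obtain x where x: "x < n" "y = (q \<circ> g) x" by (elim imageE) simp
        with y 1(2)[OF x(1)] have "x \<in> {x. x < n \<and> tab_row \<beta> x = i}" by simp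
        with x(2) show "y \<in> ?L" by (rule image_eqI)
      qed (use 1 permutes_in_image[OF 1(1)] in auto)
      then show "bij_betw (q \<circ> g) {x. x < n \<and> tab_row \<beta> x = i} {x. x < n \<and> tab_row \<alpha> x = i}"
        using permutes_inj_on[OF 1(1)] by (simp add: bij_betw_def)
    qed
    then show "(if i < size \<alpha> then parts_list \<alpha> ! i else 0) = (if i < size \<beta> then parts_list \<beta> ! i else 0)"
      using card_tab_row_fiber[of \<alpha> i] card_tab_row_fiber[of \<beta> i] sums by simp
  qed
  define p where "p = q \<circ> g"
  define q' where "q' = inv (inv g \<circ> q \<circ> g)"
  have "p \<in> row_group \<alpha>"
    using q(3) lt gp qp permutes_inverses[OF gp] sums \<open>\<alpha> = \<beta>\<close>
    by (auto simp: row_group_def p_def r_def r'_def intro: permutes_compose)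
  moreover have "inv g \<circ> q \<circ> g \<in> col_group \<alpha>"
    using q lt gp qp permutes_inverses[OF gp] sums \<open>\<alpha> = \<beta>\<close>
    by (auto simp: col_group_def c_def intro!: permutes_compose permutes_inv)
  then have "q' \<in> col_group \<alpha>" unfolding q'_def by (rule perm_groupD(4)[OF perm_group_col])
  moreover have "g = p \<circ> q'"
  proof -
    have "q' = inv g \<circ> inv q \<circ> g"
      using permutes_bij[OF gp] permutes_bij[OF qp]
      by (simp add: q'_def o_inv_distrib bij_comp bij_imp_bij_inv inv_inv_eq comp_assoc)
    then show ?thesis
      by (auto simp: p_def fun_eq_iff permutes_inverses[OF gp] permutes_inverses[OF qp])
  qed
  ultimately show "\<alpha> = \<beta> \<and> (\<exists>p\<in>row_group \<alpha>. \<exists>q\<in>col_group \<alpha>. g = p \<circ> q)"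
    using \<open>\<alpha> = \<beta>\<close> by blast
qed

subsection \<open>Irreducible characters\<close>

lemma partitions_sum_mset: "\<alpha> \<in> partitions n \<Longrightarrow> sum_mset \<alpha> = n"
  by (simp add: partitions_def)

lemma finite_col_group: "finite (col_group \<alpha>)"
  and finite_row_group: "finite (row_group \<alpha>)"
  using perm_groupD(1)[OF perm_group_col] perm_groupD(1)[OF perm_group_row] by auto

lemma sandwich_expand:
  assumes "Poly_Mapping.keys x \<subseteq> Sym n"
  shows "u \<star> x \<star> v = (\<Sum>g\<in>Sym n. alg_scale (coef x g) (u \<star> \<delta> g \<star> v))"
proof -
  have "x = (\<Sum>g\<in>Sym n. alg_scale (coef x g) (\<delta> g))"
    using sum_single_coef[OF finite_Sym assms] by simp
  then have "u \<star> x \<star> v = u \<star> (\<Sum>g\<in>Sym n. alg_scale (coef x g) (\<delta> g)) \<star> v"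
    by simp
  then show ?thesis
    by (simp only: alg_mult_sum_left alg_mult_sum_right alg_mult_scale_left alg_mult_scale_right)
qed

lemma row_sandwich_col:
  assumes "\<alpha> \<in> partitions n" "Poly_Mapping.keys x \<subseteq> Sym n"
  shows "\<exists>c. row_sum \<alpha> \<star> x \<star> col_sum \<alpha> = alg_scale c (young_symmetrizer \<alpha>)"
proof -
  have "\<exists>c. row_sum \<alpha> \<star> \<delta> g \<star> col_sum \<alpha> = alg_scale c (young_symmetrizer \<alpha>)" if g: "g \<in> Sym n" for g
  proof (cases "row_sum \<alpha> \<star> \<delta> g \<star> col_sum \<alpha> = 0")
    case False
    then obtain p q where pq: "p \<in> row_group \<alpha>" "q \<in> col_group \<alpha>" "g = p \<circ> q"
      using row_mult_col_nonzero(2)[OF g assms(1) assms(1)] by auto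
    have "row_sum \<alpha> \<star> \<delta> g \<star> col_sum \<alpha> = row_sum \<alpha> \<star> (\<delta> p \<star> \<delta> q) \<star> col_sum \<alpha>"
      by (simp add: pq(3))
    also have "\<dots> = (row_sum \<alpha> \<star> \<delta> p) \<star> (\<delta> q \<star> col_sum \<alpha>)"
      by (simp only: alg_mult_assoc)
    also have "\<dots> = alg_scale (sgn_of q) (young_symmetrizer \<alpha>)"
      by (simp only: row_sum_absorb[OF pq(1)] col_sum_absorb[OF pq(2)] alg_mult_scale_right young_symmetrizer_eq)
    finally show ?thesis by blast
  qed (auto intro: exI[of _ 0])
  then obtain c where "\<And>g. g \<in> Sym n \<Longrightarrow> row_sum \<alpha> \<star> \<delta> g \<star> col_sum \<alpha> = alg_scale (c g) (young_symmetrizer \<alpha>)"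
    by metis
  then have "row_sum \<alpha> \<star> x \<star> col_sum \<alpha> = (\<Sum>g\<in>Sym n. alg_scale (coef x g * c g) (young_symmetrizer \<alpha>))"
    unfolding sandwich_expand[OF assms(2)] by (intro sum.cong refl) simp
  then show ?thesis by (metis alg.scale_sum_left)
qed

lemma row_sandwich_col_zero:
  assumes "\<alpha> \<in> partitions n" "\<beta> \<in> partitions n" "Poly_Mapping.keys x \<subseteq> Sym n"
    and "\<alpha> \<noteq> \<beta>" "\<not> row_stat \<beta> < row_stat \<alpha>"
  shows "row_sum \<alpha> \<star> x \<star> col_sum \<beta> = 0"
proof -
  have "row_sum \<alpha> \<star> \<delta> g \<star> col_sum \<beta> = 0" if "g \<in> Sym n" for g
    using row_mult_col_nonzero[OF that assms(1,2)] assms(4,5) by (metis le_neq_implies_less)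
  then show ?thesis
    unfolding sandwich_expand[OF assms(3)] by (intro sum.neutral) simp
qed

lemma row_sum_square: "row_sum \<alpha> \<star> row_sum \<alpha> = alg_scale (of_nat (card (row_group \<alpha>))) (row_sum \<alpha>)"
proof -
  have "row_sum \<alpha> \<star> row_sum \<alpha> = (\<Sum>p\<in>row_group \<alpha>. row_sum \<alpha> \<star> \<delta> p)"
    by (subst (2) row_sum_def) (simp only: alg_mult_sum_right)
  also have "\<dots> = (\<Sum>p\<in>row_group \<alpha>. row_sum \<alpha>)"
    by (intro sum.cong refl row_sum_absorb(1))
  finally show ?thesis by (simp add: alg.sum_constant_scale)
qed

lemma col_sum_square: "col_sum \<alpha> \<star> col_sum \<alpha> = alg_scale (of_nat (card (col_group \<alpha>))) (col_sum \<alpha>)"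
proof -
  have "col_sum \<alpha> \<star> col_sum \<alpha> = (\<Sum>p\<in>col_group \<alpha>. col_sum \<alpha> \<star> alg_scale (sgn_of p) (\<delta> p))"
    by (subst (2) col_sum_def) (simp add: alg_mult_sum_right)
  also have "\<dots> = (\<Sum>p\<in>col_group \<alpha>. col_sum \<alpha>)"
    by (intro sum.cong refl)
      (simp only: alg_mult_scale_right col_sum_absorb(1) alg.scale_scale sgn_of_square alg.scale_one)
  finally show ?thesis by (simp add: alg.sum_constant_scale)
qed

lemma star_row_sum: "star (row_sum \<alpha>) = row_sum \<alpha>"
  using perm_group_sum_inv[OF perm_group_row, of \<delta>] by (simp add: row_sum_def star_sum)

lemma star_col_sum: "star (col_sum \<alpha>) = col_sum \<alpha>"
proof -
  have "star (col_sum \<alpha>) = (\<Sum>q\<in>col_group \<alpha>. Poly_Mapping.single (inv q) (sgn_of (inv q)))"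
    unfolding col_sum_def star_sum
    by (intro sum.cong refl)
      (metis finite_lessThan perm_groupD(2) perm_group_col permutation_permutes sign_inverse star_single)
  then show ?thesis
    using perm_group_sum_inv[OF perm_group_col, of "\<lambda>q. Poly_Mapping.single q (sgn_of q)"]
    by (simp add: col_sum_def)
qed

lemma row_col_group_trivial:
  assumes "p \<in> row_group \<alpha>" "p \<in> col_group \<alpha>" shows "p = id"
proof
  fix k
  show "p k = id k"
  proof (cases "k < sum_mset \<alpha>")
    case True
    moreover have "p k < sum_mset \<alpha>"
      using True permutes_in_image[OF perm_groupD(2)[OF perm_group_row assms(1)], of k] by simp
    ultimately show ?thesis
      using assms tab_inj[of "p k" \<alpha> k] by (simp add: row_group_def col_group_def)
  next
    case False
    then show ?thesis
      using permutes_not_in[OF perm_groupD(2)[OF perm_group_row assms(1)], of k] by simp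
  qed
qed

lemma young_symmetrizer_nonzero: "young_symmetrizer \<alpha> \<noteq> 0"
proof -
  have "coef (young_symmetrizer \<alpha>) id =
      (\<Sum>p\<in>row_group \<alpha>. \<Sum>q\<in>col_group \<alpha>. (sgn_of q when p \<circ> q = id))"
    unfolding young_symmetrizer_eq row_sum_def col_sum_def alg_mult_expand
    by (simp add: lookup_sum lookup_single)
  also have "\<dots> = (\<Sum>p\<in>row_group \<alpha>. \<Sum>q\<in>col_group \<alpha>. if p = id \<and> q = id then 1 else 0)"
  proof (intro sum.cong refl)
    fix p q assume p: "p \<in> row_group \<alpha>" and q: "q \<in> col_group \<alpha>"
    have "p = id \<and> q = id" if eq: "p \<circ> q = id"
    proof -
      have "bij p" using perm_groupD(2)[OF perm_group_row p] by (rule permutes_bij)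
      from eq have "q = inv p \<circ> id" unfolding comp_eq_iff_left[OF \<open>bij p\<close>] .
      then have "q \<in> row_group \<alpha>" using perm_groupD(4)[OF perm_group_row p] by simp
      then have "q = id" using q by (rule row_col_group_trivial)
      with eq show ?thesis by simp
    qed
    then show "(sgn_of q when p \<circ> q = id) = (if p = id \<and> q = id then 1 else 0)"
      by (auto simp: when_def)
  qed
  also have "\<dots> = (\<Sum>p\<in>row_group \<alpha>. if p = id then 1 else 0)"
    using perm_groupD(5)[OF perm_group_col, of \<alpha>] finite_col_group
    by (intro sum.cong refl) (simp add: sum.delta)
  also have "\<dots> = 1"
    using perm_groupD(5)[OF perm_group_row, of \<alpha>] finite_row_group by (simp add: sum.delta)
  finally show ?thesis by auto
qed

lemma young_symmetrizer_square:
  assumes "\<alpha> \<in> partitions n"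
  shows "\<exists>k. k \<noteq> 0 \<and> young_symmetrizer \<alpha> \<star> young_symmetrizer \<alpha> = alg_scale k (young_symmetrizer \<alpha>)"
proof -
  define a b y where "a = row_sum \<alpha>" and "b = col_sum \<alpha>" and "y = young_symmetrizer \<alpha>"
  have n: "sum_mset \<alpha> = n" by (rule partitions_sum_mset[OF assms])
  have y: "y = a \<star> b" by (simp add: y_def a_def b_def young_symmetrizer_eq)
  have keys: "Poly_Mapping.keys a \<subseteq> Sym n" "Poly_Mapping.keys b \<subseteq> Sym n" "Poly_Mapping.keys y \<subseteq> Sym n"
    using keys_row_sum[of \<alpha>] keys_col_sum[of \<alpha>] keys_young[of \<alpha>] by (simp_all add: a_def b_def y_def n)
  have sa: "star a = a" "star b = b" by (simp_all add: a_def b_def star_row_sum star_col_sum)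
  have sy: "star y = b \<star> a" using star_mult[OF keys(1,2)] by (simp add: y sa)
  define d where "d = y \<star> a"
  have kd: "Poly_Mapping.keys d \<subseteq> Sym n" unfolding d_def by (intro keys_mult_Sym keys)
  have "y \<star> star y = a \<star> (b \<star> b) \<star> a"
    unfolding sy unfolding y by (simp only: alg_mult_assoc)
  also have "\<dots> = alg_scale (of_nat (card (col_group \<alpha>))) d"
    using col_sum_square[of \<alpha>, folded b_def]
    by (simp only: alg_mult_scale_right alg_mult_scale_left d_def y)
  finally have "d \<noteq> 0"
    using mult_star_nonzero[OF keys(3)] young_symmetrizer_nonzero[of \<alpha>] by (auto simp: y_def)
  have sd: "star d = d"
    using star_mult[OF keys(3) keys(1)] unfolding d_def sy sa unfolding y by (simp only: alg_mult_assoc)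
  have "d \<star> d = a \<star> b \<star> (a \<star> a) \<star> b \<star> a"
    by (simp only: d_def y alg_mult_assoc)
  also have "\<dots> = alg_scale (of_nat (card (row_group \<alpha>))) (y \<star> y \<star> a)"
    using row_sum_square[of \<alpha>, folded a_def]
    by (simp only: alg_mult_scale_right alg_mult_scale_left y alg_mult_assoc)
  finally have "d \<star> d = alg_scale (of_nat (card (row_group \<alpha>))) (y \<star> y \<star> a)" .
  moreover have "d \<star> d \<noteq> 0" using mult_star_nonzero[OF kd \<open>d \<noteq> 0\<close>] unfolding sd .
  ultimately have "y \<star> y \<star> a \<noteq> 0" by auto
  then have nz: "y \<star> y \<noteq> 0" by auto
  have "Poly_Mapping.keys (b \<star> a) \<subseteq> Sym n" by (intro keys_mult_Sym keys)
  then obtain k where "a \<star> (b \<star> a) \<star> b = alg_scale k y"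
    using row_sandwich_col[OF assms] unfolding a_def b_def y_def by metis
  then have "y \<star> y = alg_scale k y" by (simp only: y alg_mult_assoc)
  with nz show ?thesis unfolding y_def by (intro exI[of _ k]) auto
qed

text \<open>The idempotent spanning the same left ideal as the Young symmetrizer.\<close>

definition young_idem :: "partition \<Rightarrow> group_algebra" where
  "young_idem \<alpha> = (SOME e. e \<star> e = e \<and> (\<exists>k. k \<noteq> 0 \<and> e = alg_scale k (young_symmetrizer \<alpha>)))"

lemma young_idem:
  assumes "\<alpha> \<in> partitions n"
  shows "young_idem \<alpha> \<star> young_idem \<alpha> = young_idem \<alpha>"
    and "\<exists>k. k \<noteq> 0 \<and> young_idem \<alpha> = alg_scale k (young_symmetrizer \<alpha>)"
proof -
  obtain k where k: "k \<noteq> 0" "young_symmetrizer \<alpha> \<star> young_symmetrizer \<alpha> = alg_scale k (young_symmetrizer \<alpha>)"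
    using young_symmetrizer_square[OF assms] by (elim exE conjE)
  let ?e = "alg_scale (1 / k) (young_symmetrizer \<alpha>)"
  have "?e \<star> ?e = ?e"
    using k(1) by (simp add: alg_mult_scale_left alg_mult_scale_right k(2))
  moreover have "\<exists>k. k \<noteq> 0 \<and> ?e = alg_scale k (young_symmetrizer \<alpha>)"
    using k(1) by (intro exI[of _ "1 / k"]) simp
  ultimately have "\<exists>e. e \<star> e = e \<and> (\<exists>k. k \<noteq> 0 \<and> e = alg_scale k (young_symmetrizer \<alpha>))"
    by (intro exI[of _ ?e] conjI)
  then have "young_idem \<alpha> \<star> young_idem \<alpha> = young_idem \<alpha> \<and> (\<exists>k. k \<noteq> 0 \<and> young_idem \<alpha> = alg_scale k (young_symmetrizer \<alpha>))"
    unfolding young_idem_def by (rule someI_ex)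
  then show "young_idem \<alpha> \<star> young_idem \<alpha> = young_idem \<alpha>"
    "\<exists>k. k \<noteq> 0 \<and> young_idem \<alpha> = alg_scale k (young_symmetrizer \<alpha>)"
    by (rule conjunct1, rule conjunct2)
qed

lemma keys_alg_scale: "Poly_Mapping.keys x \<subseteq> A \<Longrightarrow> Poly_Mapping.keys (alg_scale c x) \<subseteq> A"
  by (auto simp: in_keys_iff)

lemma keys_young_idem:
  assumes "\<alpha> \<in> partitions n" shows "Poly_Mapping.keys (young_idem \<alpha>) \<subseteq> Sym n"
proof -
  obtain k where "young_idem \<alpha> = alg_scale k (young_symmetrizer \<alpha>)"
    using young_idem(2)[OF assms] by (elim exE conjE)
  then show ?thesis
    using keys_alg_scale[OF keys_young[of \<alpha>]] by (simp add: partitions_sum_mset[OF assms])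
qed

lemma young_idem_nonzero: "\<alpha> \<in> partitions n \<Longrightarrow> young_idem \<alpha> \<noteq> 0"
  using young_idem(2)[of \<alpha> n] young_symmetrizer_nonzero[of \<alpha>] by auto

lemma irr_char_eq:
  assumes "\<alpha> \<in> partitions n" "p \<in> Sym n"
  shows "irr_char \<alpha> p = conj_sum n (young_idem \<alpha>) p"
proof -
  obtain k where k: "k \<noteq> 0" "young_idem \<alpha> = alg_scale k (young_symmetrizer \<alpha>)"
    using young_idem(2)[OF assms(1)] by (elim exE conjE)
  have "irr_module \<alpha> = {x \<star> young_idem \<alpha> |x. Poly_Mapping.keys x \<subseteq> Sym n}"
  proof (intro equalityI subsetI)
    fix v assume "v \<in> irr_module \<alpha>"
    then obtain x where x: "v = x \<star> young_symmetrizer \<alpha>" "Poly_Mapping.keys x \<subseteq> Sym n"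
      unfolding irr_module_def partitions_sum_mset[OF assms(1)] by blast
    have "v = alg_scale (1 / k) x \<star> young_idem \<alpha>"
      using k by (simp add: x(1) alg_mult_scale_left alg_mult_scale_right)
    with keys_alg_scale[OF x(2)] show "v \<in> {x \<star> young_idem \<alpha> |x. Poly_Mapping.keys x \<subseteq> Sym n}"
      by blast
  next
    fix v assume "v \<in> {x \<star> young_idem \<alpha> |x. Poly_Mapping.keys x \<subseteq> Sym n}"
    then obtain x where x: "v = x \<star> young_idem \<alpha>" "Poly_Mapping.keys x \<subseteq> Sym n"
      by blast
    have "v = alg_scale k x \<star> young_symmetrizer \<alpha>"
      by (simp add: x(1) k(2) alg_mult_scale_left alg_mult_scale_right)
    with keys_alg_scale[OF x(2)] show "v \<in> irr_module \<alpha>"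
      unfolding irr_module_def partitions_sum_mset[OF assms(1)] by blast
  qed
  then show ?thesis
    unfolding irr_char_def
    using trace_on_left_ideal[OF keys_young_idem[OF assms(1)] young_idem(1)[OF assms(1)] assms(2)] by simp
qed

definition perm_char :: "partition \<Rightarrow> (nat \<Rightarrow> nat) \<Rightarrow> rat" where
  "perm_char \<alpha> p = conj_sum (sum_mset \<alpha>) (alg_scale (1 / of_nat (card (row_group \<alpha>))) (row_sum \<alpha>)) p"

lemma sum_Sym_irr_char_orth:
  assumes "\<alpha> \<in> partitions n" "\<beta> \<in> partitions n"
  shows "(\<Sum>g\<in>Sym n. irr_char \<alpha> g * irr_char \<beta> (inv g)) = (if \<alpha> = \<beta> then fact n else 0)"
proof -
  let ?I = "\<lambda>\<alpha> \<beta>. \<Sum>g\<in>Sym n. conj_sum n (young_idem \<alpha>) g * conj_sum n (young_idem \<beta>) (inv g)"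
  have "(\<Sum>g\<in>Sym n. irr_char \<alpha> g * irr_char \<beta> (inv g)) = ?I \<alpha> \<beta>"
    by (intro sum.cong refl) (simp add: irr_char_eq[OF assms(1)] irr_char_eq[OF assms(2)] permutes_inv)
  moreover have "?I \<alpha> \<alpha> = fact n" if \<alpha>: "\<alpha> \<in> partitions n" for \<alpha>
  proof (rule conj_sum_inner_eq_fact[OF keys_young_idem[OF \<alpha>] keys_young_idem[OF \<alpha>] _ _ young_idem_nonzero[OF \<alpha>]])
    obtain k where k: "k \<noteq> 0" "young_idem \<alpha> = alg_scale k (young_symmetrizer \<alpha>)"
      using young_idem(2)[OF \<alpha>] by (elim exE conjE)
    fix s assume "s \<in> Sym n"
    then have "Poly_Mapping.keys (col_sum \<alpha> \<star> \<delta> (inv s) \<star> row_sum \<alpha>) \<subseteq> Sym n"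
      using keys_row_sum[of \<alpha>] keys_col_sum[of \<alpha>]
      by (intro keys_mult_Sym) (auto simp: partitions_sum_mset[OF \<alpha>] permutes_inv)
    from row_sandwich_col[OF \<alpha> this]
    obtain c where c: "row_sum \<alpha> \<star> (col_sum \<alpha> \<star> \<delta> (inv s) \<star> row_sum \<alpha>) \<star> col_sum \<alpha> = alg_scale c (young_symmetrizer \<alpha>)" ..
    then have "young_idem \<alpha> \<star> \<delta> (inv s) \<star> young_idem \<alpha> = alg_scale (k * (k * c)) (young_symmetrizer \<alpha>)"
      by (simp only: k(2) alg_mult_scale_left alg_mult_scale_right young_symmetrizer_eq alg_mult_assoc alg.scale_scale mult.assoc)
    also have "\<dots> = alg_scale (k * c) (young_idem \<alpha>)"
      by (simp add: k(2) mult_ac)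
    finally show "\<exists>c. young_idem \<alpha> \<star> \<delta> (inv s) \<star> young_idem \<alpha> = alg_scale c (young_idem \<alpha>)" by blast
  qed (simp add: young_idem(1)[OF \<alpha>])
  moreover have zero: "?I \<alpha> \<beta> = 0"
    if \<alpha>: "\<alpha> \<in> partitions n" and \<beta>: "\<beta> \<in> partitions n" and ne: "\<alpha> \<noteq> \<beta>" "\<not> row_stat \<beta> < row_stat \<alpha>" for \<alpha> \<beta>
  proof -
    obtain k where k: "young_idem \<alpha> = alg_scale k (young_symmetrizer \<alpha>)"
      using young_idem(2)[OF \<alpha>] by (elim exE conjE)
    obtain l where l: "young_idem \<beta> = alg_scale l (young_symmetrizer \<beta>)"
      using young_idem(2)[OF \<beta>] by (elim exE conjE)
    have "young_idem \<alpha> \<star> \<delta> (inv s) \<star> young_idem \<beta> = 0" if "s \<in> Sym n" for s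
    proof -
      have "Poly_Mapping.keys (col_sum \<alpha> \<star> \<delta> (inv s) \<star> row_sum \<beta>) \<subseteq> Sym n"
        using that keys_row_sum[of \<beta>] keys_col_sum[of \<alpha>]
        by (intro keys_mult_Sym) (auto simp: partitions_sum_mset[OF \<alpha>] partitions_sum_mset[OF \<beta>] permutes_inv)
      from row_sandwich_col_zero[OF \<alpha> \<beta> this ne] show ?thesis
        by (simp only: k l alg_mult_scale_left alg_mult_scale_right young_symmetrizer_eq alg_mult_assoc alg.scale_zero_right)
    qed
    then show ?thesis
      by (subst conj_sum_inner[OF keys_young_idem[OF \<alpha>] keys_young_idem[OF \<beta>]]) simp
  qed
  moreover have "?I \<alpha> \<beta> = ?I \<beta> \<alpha>"
    by (subst sum_Sym_inv[symmetric]) (auto simp: permutes_inv_inv mult.commute intro!: sum.cong)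
  ultimately show ?thesis
    using assms zero[of \<alpha> \<beta>] zero[of \<beta> \<alpha>] by (cases "row_stat \<beta> < row_stat \<alpha>") auto
qed

lemma sum_Sym_perm_char_irr_char:
  assumes "\<alpha> \<in> partitions n" "\<beta> \<in> partitions n" "\<not> row_stat \<beta> < row_stat \<alpha>"
  shows "(\<Sum>g\<in>Sym n. perm_char \<alpha> g * irr_char \<beta> (inv g)) = (if \<alpha> = \<beta> then fact n else 0)"
proof -
  define c :: rat where "c = of_nat (card (row_group \<alpha>))"
  have "card (row_group \<alpha>) \<noteq> 0"
    using perm_groupD(5)[OF perm_group_row, of \<alpha>] finite_row_group[of \<alpha>] by auto
  then have c: "c \<noteq> 0" by (simp add: c_def)
  define x where "x = alg_scale (1 / c) (row_sum \<alpha>)"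
  have n: "sum_mset \<alpha> = n" "sum_mset \<beta> = n" using assms by (simp_all add: partitions_sum_mset)
  have kx: "Poly_Mapping.keys x \<subseteq> Sym n"
    unfolding x_def using keys_row_sum[of \<alpha>] by (intro keys_alg_scale) (simp add: n)
  have inner: "(\<Sum>g\<in>Sym n. perm_char \<alpha> g * irr_char \<beta> (inv g)) =
      (\<Sum>g\<in>Sym n. conj_sum n x g * conj_sum n (young_idem \<beta>) (inv g))"
    by (intro sum.cong refl) (simp add: irr_char_eq[OF assms(2)] permutes_inv perm_char_def x_def c_def n)
  obtain k where k: "k \<noteq> 0" "young_idem \<beta> = alg_scale k (young_symmetrizer \<beta>)"
    using young_idem(2)[OF assms(2)] by (elim exE conjE)
  have key: "Poly_Mapping.keys (\<delta> (inv s) \<star> row_sum \<beta>) \<subseteq> Sym n" if "s \<in> Sym n" for s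
    using that keys_row_sum[of \<beta>] by (intro keys_mult_Sym) (auto simp: n permutes_inv)
  have xy: "x \<star> \<delta> (inv s) \<star> young_idem \<beta> =
      alg_scale (k * (1 / c)) (row_sum \<alpha> \<star> (\<delta> (inv s) \<star> row_sum \<beta>) \<star> col_sum \<beta>)" for s
    by (simp only: k(2) x_def alg_mult_scale_left alg_mult_scale_right young_symmetrizer_eq alg_mult_assoc alg.scale_scale)
  show ?thesis
  proof (cases "\<alpha> = \<beta>")
    case True
    have "(\<Sum>g\<in>Sym n. conj_sum n x g * conj_sum n (young_idem \<beta>) (inv g)) = fact n"
    proof (rule conj_sum_inner_eq_fact[OF kx keys_young_idem[OF assms(2)] _ _ young_idem_nonzero[OF assms(2)]])
      fix s assume "s \<in> Sym n"
      from row_sandwich_col[OF assms(2) key[OF this]] True obtain d where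
        "row_sum \<alpha> \<star> (\<delta> (inv s) \<star> row_sum \<beta>) \<star> col_sum \<beta> = alg_scale d (young_symmetrizer \<beta>)"
        by blast
      then have "x \<star> \<delta> (inv s) \<star> young_idem \<beta> = alg_scale (1 / c * d) (young_idem \<beta>)"
        unfolding xy by (simp add: k(2) mult_ac)
      then show "\<exists>d. x \<star> \<delta> (inv s) \<star> young_idem \<beta> = alg_scale d (young_idem \<beta>)" by blast
    next
      have "x \<star> young_symmetrizer \<beta> = alg_scale (1 / c) (row_sum \<alpha> \<star> row_sum \<alpha> \<star> col_sum \<alpha>)"
        by (simp only: True x_def young_symmetrizer_eq alg_mult_scale_left alg_mult_assoc)
      also have "\<dots> = young_symmetrizer \<beta>"
        using c unfolding c_def True[symmetric]
        by (simp add: row_sum_square alg_mult_scale_left young_symmetrizer_eq)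
      finally have "x \<star> young_idem \<beta> = young_idem \<beta>"
        by (simp only: k(2) alg_mult_scale_right)
      then show "x \<star> young_idem \<beta> \<star> young_idem \<beta> = young_idem \<beta>"
        by (simp add: young_idem(1)[OF assms(2)])
    qed
    then show ?thesis using True inner by simp
  next
    case False
    have "x \<star> \<delta> (inv s) \<star> young_idem \<beta> = 0" if "s \<in> Sym n" for s
      unfolding xy row_sandwich_col_zero[OF assms(1,2) key[OF that] False assms(3)] by simp
    then show ?thesis
      unfolding inner using False by (subst conj_sum_inner[OF kx keys_young_idem[OF assms(2)]]) simp
  qed
qed

subsection \<open>Cycle types\<close>

lemma finite_partitions: "finite (partitions n)"
proof -
  have "partitions n \<subseteq> {\<alpha>. set_mset \<alpha> \<subseteq> {..n} \<and> size \<alpha> \<le> n}"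
  proof safe
    fix \<alpha> x assume "\<alpha> \<in> partitions n" and x: "x \<in># \<alpha>"
    then show "x \<le> n" using finite_partition_sum[OF x] by (simp add: partitions_def)
  next
    fix \<alpha> assume "\<alpha> \<in> partitions n"
    then have "0 \<notin># \<alpha>" "sum_mset \<alpha> = n" by (auto simp: partitions_def)
    then show "size \<alpha> \<le> n"
    proof (induction \<alpha> arbitrary: n)
      case (add x \<alpha>)
      then have "size \<alpha> \<le> sum_mset \<alpha>" "x \<ge> 1" by auto
      with add.prems show ?case by auto
    qed simp
  qed
  moreover have "{\<alpha>. set_mset \<alpha> \<subseteq> {..n} \<and> size \<alpha> \<le> n} \<subseteq> mset ` {xs. set xs \<subseteq> {..n} \<and> length xs \<le> n}"
  proof
    fix \<alpha> :: partition assume a: "\<alpha> \<in> {\<alpha>. set_mset \<alpha> \<subseteq> {..n} \<and> size \<alpha> \<le> n}"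
    obtain xs where "mset xs = \<alpha>" using ex_mset by blast
    with a show "\<alpha> \<in> mset ` {xs. set xs \<subseteq> {..n} \<and> length xs \<le> n}"
      by (intro image_eqI[of _ _ xs]) auto
  qed
  moreover have "finite {xs. set xs \<subseteq> {..n} \<and> length xs \<le> n}"
    by (rule finite_lists_length_le) simp
  ultimately show ?thesis by (meson finite_imageI finite_subset)
qed

lemma Sym_permutation: "p \<in> Sym n \<Longrightarrow> permutation p"
  by (auto simp: permutation_permutes)

lemma orbit_eq_iff:
  assumes "permutation p" shows "orbit p y = orbit p x \<longleftrightarrow> y \<in> orbit p x"
proof
  assume "y \<in> orbit p x"
  then show "orbit p y = orbit p x"
    using orbit_trans[of _ p] orbit_swap[OF permutation_self_in_orbit[OF assms], of y x] by blast
next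
  assume "orbit p y = orbit p x"
  then show "y \<in> orbit p x" using permutation_self_in_orbit[OF assms, of y] by simp
qed

abbreviation orbits :: "nat \<Rightarrow> (nat \<Rightarrow> nat) \<Rightarrow> nat set set" where
  "orbits n p \<equiv> orbit p ` {..<n}"

lemma orbit_subset_lessThan: "p \<in> Sym n \<Longrightarrow> x < n \<Longrightarrow> orbit p x \<subseteq> {..<n}"
  using permutes_orbit_subset[of p "{..<n}" x] by simp

lemma orbit_eq_fiber:
  assumes "p \<in> Sym n" "x < n"
  shows "orbit p x = {y. y < n \<and> orbit p y = orbit p x}"
  using orbit_subset_lessThan[OF assms] orbit_eq_iff[OF Sym_permutation[OF assms(1)]] by auto

lemma cycle_type_partition:
  assumes "p \<in> Sym n" shows "cycle_type n p \<in> partitions n"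
proof -
  have fin: "finite (orbit p x)" if "x < n" for x
    using orbit_subset_lessThan[OF assms that] finite_subset by blast
  have "card (orbit p x) \<noteq> 0" if "x < n" for x
    using fin[OF that] orbit_nonempty[of p x] by (metis card_0_eq)
  then have nz: "0 \<notin># cycle_type n p"
  proof -
    have "\<exists>x<n. card (orbit p x) = 0" if "0 \<in># cycle_type n p"
      using that by (auto simp: cycle_type_def)
    then show ?thesis using \<open>\<And>x. x < n \<Longrightarrow> card (orbit p x) \<noteq> 0\<close> by metis
  qed
  have "sum_mset (cycle_type n p) = (\<Sum>c\<in>orbits n p. card c)"
    by (simp add: cycle_type_def sum_unfold_sum_mset)
  also have "\<dots> = (\<Sum>c\<in>orbits n p. \<Sum>y | y \<in> {..<n} \<and> orbit p y = c. 1)"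
  proof (intro sum.cong refl)
    fix c assume "c \<in> orbits n p"
    then obtain x where x: "x < n" "c = orbit p x" by auto
    have "card c = card {y. y < n \<and> orbit p y = orbit p x}"
      unfolding x(2) using orbit_eq_fiber[OF assms x(1)] by simp
    then show "card c = (\<Sum>y | y \<in> {..<n} \<and> orbit p y = c. 1)" by (simp add: x(2))
  qed
  also have "\<dots> = n"
    using sum.image_gen[of "{..<n}" "\<lambda>_. 1::nat" "orbit p"] by simp
  finally show ?thesis using nz by (simp add: partitions_def)
qed

lemma cycle_type_inv:
  assumes "p \<in> Sym n" shows "cycle_type n (inv p) = cycle_type n p"
  by (simp add: cycle_type_def orbit_inv_eq[OF Sym_permutation[OF assms]] cong: image_cong)

lemma funpow_conj:
  assumes "bij h" shows "((h \<circ> p \<circ> inv h) ^^ m) (h x) = h ((p ^^ m) x)"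
  using assms by (induction m) (auto simp: bij_is_inj inv_f_f)

lemma cycle_type_conj:
  assumes p: "p \<in> Sym n" and h: "h \<in> Sym n"
  shows "cycle_type n (h \<circ> p \<circ> inv h) = cycle_type n p"
proof -
  have hb: "bij h" and hp: "h permutes {..<n}" using h by (auto intro: permutes_bij)
  have orb: "orbit (h \<circ> p \<circ> inv h) (h x) = h ` orbit p x" for x
    unfolding orbit_altdef by (auto simp: funpow_conj[OF hb])
  have "orbits n (h \<circ> p \<circ> inv h) = (\<lambda>x. orbit (h \<circ> p \<circ> inv h) (h x)) ` {..<n}"
    by (subst permutes_image[OF hp, symmetric]) (simp add: image_image)
  also have "\<dots> = (`) h ` orbits n p" by (simp add: orb image_image)
  finally have 1: "orbits n (h \<circ> p \<circ> inv h) = (`) h ` orbits n p" .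
  have inj: "inj_on ((`) h) (orbits n p)"
    using inj_image_eq_iff[OF bij_is_inj[OF hb]] by (auto intro: inj_onI)
  have "card (h ` c) = card c" for c
    by (rule card_image) (rule inj_on_subset[OF bij_is_inj[OF hb]], simp)
  then show ?thesis
    unfolding cycle_type_def 1 image_mset_mset_set[OF inj, symmetric]
    by (simp add: multiset.map_comp comp_def)
qed

lemma weight_preserving_bij:
  assumes "finite A" "finite B" "image_mset f (mset_set A) = image_mset g (mset_set B)"
  shows "\<exists>F. bij_betw F A B \<and> (\<forall>a\<in>A. g (F a) = f a)"
  using assms
proof (induction A arbitrary: B rule: finite_induct)
  case empty
  then have "B = {}" by (simp add: mset_set_empty_iff)
  then show ?case by (auto simp: bij_betw_def)
next
  case (insert a A)
  have "f a \<in># image_mset g (mset_set B)"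
    using insert.prems(2) insert.hyps by (metis finite_insert image_mset_add_mset mset_set.insert union_single_eq_member)
  then obtain b where b: "b \<in> B" "g b = f a" using insert.prems(1) by auto
  have "mset_set B = add_mset b (mset_set (B - {b}))"
    using b insert.prems(1) by (simp add: mset_set.remove)
  then have "image_mset f (mset_set A) = image_mset g (mset_set (B - {b}))"
    using insert.prems(2) insert.hyps b by simp
  then obtain F where F: "bij_betw F A (B - {b})" "\<forall>a\<in>A. g (F a) = f a"
    using insert.IH[of "B - {b}"] insert.prems(1) by auto
  have "bij_betw (F(a := b)) A (B - {b})"
    using F(1) insert.hyps(2) by (subst bij_betw_cong[of _ _ F]) auto
  from notIn_Un_bij_betw[OF insert.hyps(2) _ this]
  have "bij_betw (F(a := b)) (insert a A) (insert b (B - {b}))" by simp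
  then have "bij_betw (F(a := b)) (insert a A) B" using insert_Diff[OF b(1)] by (simp only:)
  moreover have "\<forall>x\<in>insert a A. g ((F(a := b)) x) = f x" using F(2) b insert.hyps(2) by auto
  ultimately show ?case by blast
qed

lemma funpow_eq_iff_mod_card_orbit:
  assumes "permutation q"
  shows "(q ^^ i) y = (q ^^ j) y \<longleftrightarrow> i mod card (orbit q y) = j mod card (orbit q y)"
proof -
  let ?d = "funpow_dist1 q y y"
  have self: "y \<in> orbit q y" by (rule permutation_self_in_orbit[OF assms])
  have inj: "inj_on (\<lambda>n. (q ^^ n) y) {0..<?d}" by (rule inj_on_funpow_dist1[OF self])
  have "orbit q y = (\<lambda>n. (q ^^ n) y) ` {0..<?d}" by (rule orbit_conv_funpow_dist1[OF self])
  then have card: "card (orbit q y) = ?d" using card_image[OF inj] by simp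
  have "(q ^^ ?d) y = y" by (rule funpow_dist1_prop[OF self])
  then have mod: "(q ^^ (m mod ?d)) y = (q ^^ m) y" for m by (rule funpow_mod_eq)
  have "(q ^^ i) y = (q ^^ j) y \<longleftrightarrow> (q ^^ (i mod ?d)) y = (q ^^ (j mod ?d)) y"
    by (simp only: mod)
  also have "\<dots> \<longleftrightarrow> i mod ?d = j mod ?d"
    using inj by (auto dest: inj_onD simp del: funpow.simps)
  finally show ?thesis by (simp only: card)
qed

lemma same_cycle_type_conj:
  assumes p: "p \<in> Sym n" and p': "p' \<in> Sym n" and type: "cycle_type n p = cycle_type n p'"
  shows "\<exists>h\<in>Sym n. p' = h \<circ> p \<circ> inv h"
proof -
  have perm: "permutation p" "permutation p'" using p p' by (auto intro: Sym_permutation)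
  have pp: "p permutes {..<n}" and pp': "p' permutes {..<n}" using p p' by auto
  obtain F where F: "bij_betw F (orbits n p) (orbits n p')" "\<forall>c\<in>orbits n p. card (F c) = card c"
    using weight_preserving_bij[of "orbits n p" "orbits n p'" card card] type by (auto simp: cycle_type_def)
  define base where "base c = (SOME x. x < n \<and> orbit p x = c)" for c
  define base' where "base' c = (SOME x. x < n \<and> orbit p' x = c)" for c
  have base: "base c < n \<and> orbit p (base c) = c" if "c \<in> orbits n p" for c
    unfolding base_def by (rule someI_ex) (use that in auto)
  have base': "base' c < n \<and> orbit p' (base' c) = c" if "c \<in> orbits n p'" for c
    unfolding base'_def by (rule someI_ex) (use that in auto)
  let ?b = "\<lambda>x. base (orbit p x)" and ?b' = "\<lambda>x. base' (F (orbit p x))"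
  have orbF: "F (orbit p x) \<in> orbits n p'" if "x < n" for x
    using F(1) that by (auto simp: bij_betw_def)
  define idx where "idx x = (SOME i. (p ^^ i) (?b x) = x)" for x
  have idx: "(p ^^ idx x) (?b x) = x" if "x < n" for x
  proof -
    have "x \<in> orbit p (?b x)"
      using base[of "orbit p x"] that permutation_self_in_orbit[OF perm(1), of x] by auto
    then obtain m where "x = (p ^^ m) (?b x)"
      unfolding orbit_altdef_permutation[OF perm(1), of "?b x"] by (elim CollectE exE conjE)
    then have "(p ^^ m) (?b x) = x" by (rule sym)
    then show ?thesis unfolding idx_def by (rule someI)
  qed
  define h where "h x = (if x < n then (p' ^^ idx x) (?b' x) else x)" for x
  have hx: "h x = (p' ^^ idx x) (?b' x)" "orbit p' (h x) = F (orbit p x)" "h x < n" if "x < n" for x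
  proof -
    show 1: "h x = (p' ^^ idx x) (?b' x)" using that by (simp add: h_def)
    have "h x \<in> orbit p' (?b' x)" unfolding 1 orbit_altdef_permutation[OF perm(2), of "?b' x"] by blast
    then show 2: "orbit p' (h x) = F (orbit p x)"
      using orbit_eq_iff[OF perm(2)] base'[OF orbF[OF that]] by metis
    have "h x \<in> orbit p' (h x)" by (rule permutation_self_in_orbit[OF perm(2)])
    moreover have "F (orbit p x) \<subseteq> {..<n}"
      using base'[OF orbF[OF that]] orbit_subset_lessThan[OF p'] by metis
    ultimately show "h x < n" unfolding 2 by auto
  qed
  have cards: "card (orbit p' (?b' x)) = card (orbit p (?b x))" if "x < n" for x
    using base[of "orbit p x"] base'[OF orbF[OF that]] F(2) that by simp
  have idx_iff: "(p' ^^ i) (?b' x) = (p' ^^ j) (?b' x) \<longleftrightarrow> (p ^^ i) (?b x) = (p ^^ j) (?b x)" if "x < n" for x i j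
    unfolding funpow_eq_iff_mod_card_orbit[OF perm(1)] funpow_eq_iff_mod_card_orbit[OF perm(2)] cards[OF that] ..
  have "inj_on h {..<n}"
  proof (rule inj_onI)
    fix x y assume xy: "x \<in> {..<n}" "y \<in> {..<n}" and eq: "h x = h y"
    then have lt: "x < n" "y < n" by auto
    have "F (orbit p x) = F (orbit p y)" using hx(2)[OF lt(1)] hx(2)[OF lt(2)] eq by simp
    then have oo: "orbit p x = orbit p y"
      using inj_onD[OF bij_betw_imp_inj_on[OF F(1)]] lt by blast
    have "(p' ^^ idx x) (?b' x) = (p' ^^ idx y) (?b' x)"
      using eq hx(1)[OF lt(1)] hx(1)[OF lt(2)] oo by simp
    then have "(p ^^ idx x) (?b x) = (p ^^ idx y) (?b x)" unfolding idx_iff[OF lt(1)] .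
    also have "\<dots> = (p ^^ idx y) (?b y)" by (simp only: oo)
    finally show "x = y" unfolding idx[OF lt(1)] idx[OF lt(2)] .
  qed
  moreover have "h ` {..<n} \<subseteq> {..<n}" using hx(3) by auto
  ultimately have "bij_betw h {..<n} {..<n}" by (simp add: bij_betw_def endo_inj_surj)
  then have hp: "h permutes {..<n}" by (rule bij_imp_permutes) (simp add: h_def)
  have comm: "h (p x) = p' (h x)" for x
  proof (cases "x < n")
    case True
    then have px: "p x < n" using permutes_in_image[OF pp, of x] by simp
    have oo: "orbit p (p x) = orbit p x" by (rule permutation_orbit_step[OF perm(1)])
    have "(p ^^ idx (p x)) (?b x) = (p ^^ Suc (idx x)) (?b x)"
      using idx[OF px] idx[OF True] oo by simp
    then have "(p' ^^ idx (p x)) (?b' x) = (p' ^^ Suc (idx x)) (?b' x)"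
      unfolding idx_iff[OF True] .
    then show ?thesis using hx(1)[OF px] hx(1)[OF True] oo by simp
  next
    case False
    then show ?thesis using permutes_not_in[OF pp, of x] permutes_not_in[OF pp', of x] by (simp add: h_def)
  qed
  have "h \<circ> p = p' \<circ> h" by (rule ext) (simp only: comp_apply comm)
  then have "p' \<circ> h = h \<circ> p" ..
  then have "p' = h \<circ> p \<circ> inv h"
    unfolding comp_eq_iff_right[OF permutes_bij[OF hp]] .
  with hp show ?thesis by blast
qed

lemma card_fun_preserving_permutations:
  assumes "finite A"
  shows "card {\<pi>. \<pi> permutes A \<and> (\<forall>x\<in>A. f (\<pi> x) = f x)} = (\<Prod>c\<in>f ` A. fact (card {x\<in>A. f x = c}))"
  using assms
proof (induction A rule: finite_induct)
  case empty
  then show ?case by simp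
next
  case (insert a A)
  let ?S = "\<lambda>A. {\<pi>. \<pi> permutes A \<and> (\<forall>x\<in>A. f (\<pi> x) = f x)}"
  let ?B = "{b \<in> insert a A. f b = f a}"
  let ?g = "\<lambda>(b, \<pi>). Transposition.transpose a b \<circ> \<pi>"
  have tr: "f (Transposition.transpose a b x) = f x" if "f b = f a" for b x
    using that by (auto simp: transpose_def)
  have "?S (insert a A) = ?g ` (?B \<times> ?S A)"
  proof (intro equalityI subsetI)
    fix \<pi> assume "\<pi> \<in> ?S (insert a A)"
    then have \<pi>: "\<pi> permutes insert a A" "\<And>x. x \<in> insert a A \<Longrightarrow> f (\<pi> x) = f x" by auto
    let ?\<tau> = "Transposition.transpose a (\<pi> a) \<circ> \<pi>"
    have "?\<tau> permutes A" by (rule permutes_insert_lemma[OF \<pi>(1)])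
    moreover have "f (\<pi> a) = f a" using \<pi>(2)[of a] by simp
    moreover have "\<pi> a \<in> insert a A" using permutes_in_image[OF \<pi>(1), of a] by simp
    moreover have "\<pi> = Transposition.transpose a (\<pi> a) \<circ> ?\<tau>"
      by (simp add: fun_eq_iff)
    ultimately have "(\<pi> a, ?\<tau>) \<in> ?B \<times> ?S A" "\<pi> = ?g (\<pi> a, ?\<tau>)" using \<pi>(2) tr by auto
    then show "\<pi> \<in> ?g ` (?B \<times> ?S A)" by (rule image_eqI[rotated])
  next
    fix \<pi> assume "\<pi> \<in> ?g ` (?B \<times> ?S A)"
    then obtain b \<tau> where b: "b \<in> insert a A" "f b = f a" and \<tau>: "\<tau> permutes A" "\<forall>x\<in>A. f (\<tau> x) = f x"
      and \<pi>: "\<pi> = Transposition.transpose a b \<circ> \<tau>" by auto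
    have "\<pi> permutes insert a A"
      unfolding \<pi> using b(1) by (intro permutes_compose permutes_swap_id permutes_subset[OF \<tau>(1)]) auto
    moreover have "f (\<tau> x) = f x" for x using \<tau> permutes_not_in[OF \<tau>(1), of x] by (cases "x \<in> A") auto
    ultimately show "\<pi> \<in> ?S (insert a A)" using tr[OF b(2)] by (simp add: \<pi>)
  qed
  moreover have "inj_on ?g (?B \<times> ?S A)"
  proof (rule inj_onI)
    fix u v assume "u \<in> ?B \<times> ?S A" "v \<in> ?B \<times> ?S A" and eq: "?g u = ?g v"
    then obtain b c \<sigma> \<tau> where uv: "u = (b, \<sigma>)" "v = (c, \<tau>)" and perm: "\<sigma> permutes A" "\<tau> permutes A"
      by auto
    have "\<sigma> a = a" "\<tau> a = a" using permutes_not_in[OF perm(1) insert.hyps(2)] permutes_not_in[OF perm(2) insert.hyps(2)] .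
    then have "b = c" using fun_cong[OF eq, of a] by (simp add: uv)
    moreover have "\<sigma> x = \<tau> x" for x
      using fun_cong[OF eq, of x] \<open>b = c\<close> by (simp add: uv) (metis transpose_involutory)
    ultimately show "u = v" by (auto simp: uv)
  qed
  ultimately have "card (?S (insert a A)) = card ?B * card (?S A)"
    by (simp add: card_image card_cartesian_product)
  also have "card ?B = Suc (card {x\<in>A. f x = f a})"
  proof -
    have "?B = insert a {x\<in>A. f x = f a}" by auto
    then show ?thesis using insert.hyps by simp
  qed
  also have "card (?S A) = (\<Prod>c\<in>f ` A. fact (card {x\<in>A. f x = c}))" by (rule insert.IH)
  also have "\<dots> = (\<Prod>c\<in>insert (f a) (f ` A). fact (card {x\<in>A. f x = c}))"
  proof (rule prod.mono_neutral_left)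
    have "f x \<noteq> f a" if "f a \<notin> f ` A" "x \<in> A" for x using that by (metis imageI)
    then have e: "{x\<in>A. f x = f a} = {}" if "f a \<notin> f ` A" using that by blast
    have "fact (card {x\<in>A. f x = f a}) = (1::nat)" if nf: "f a \<notin> f ` A"
      unfolding e[OF nf] by simp
    then show "\<forall>c\<in>insert (f a) (f ` A) - f ` A. fact (card {x\<in>A. f x = c}) = (1::nat)" by auto
  qed (use insert.hyps in auto)
  also have "\<dots> = fact (card {x\<in>A. f x = f a}) * (\<Prod>c\<in>insert (f a) (f ` A) - {f a}. fact (card {x\<in>A. f x = c}))"
    by (rule prod.remove) (use insert.hyps in auto)
  also have "(\<Prod>c\<in>insert (f a) (f ` A) - {f a}. fact (card {x\<in>A. f x = c}) :: nat) =
      (\<Prod>c\<in>insert (f a) (f ` A) - {f a}. fact (card {x\<in>insert a A. f x = c}))"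
  proof (rule prod.cong[OF refl])
    fix c assume "c \<in> insert (f a) (f ` A) - {f a}"
    then have "{x\<in>A. f x = c} = {x\<in>insert a A. f x = c}" by auto
    then show "fact (card {x\<in>A. f x = c}) = (fact (card {x\<in>insert a A. f x = c}) :: nat)" by simp
  qed
  also have "Suc (card {x\<in>A. f x = f a}) * (fact (card {x\<in>A. f x = f a}) * (\<Prod>c\<in>insert (f a) (f ` A) - {f a}. fact (card {x\<in>insert a A. f x = c}))) =
     fact (Suc (card {x\<in>A. f x = f a})) * (\<Prod>c\<in>insert (f a) (f ` A) - {f a}. fact (card {x\<in>insert a A. f x = c}))"
    by (simp only: fact_Suc of_nat_id mult.assoc)
  also have "Suc (card {x\<in>A. f x = f a}) = card ?B"
    by (rule \<open>card ?B = _\<close>[symmetric])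
  also have "fact (card ?B) * (\<Prod>c\<in>insert (f a) (f ` A) - {f a}. fact (card {x\<in>insert a A. f x = c})) =
      (\<Prod>c\<in>insert (f a) (f ` A). fact (card {x\<in>insert a A. f x = c}))"
    by (rule prod.remove[symmetric]) (use insert.hyps in auto)
  finally show ?case by simp
qed

subsection \<open>Permutation characters\<close>

definition row_set :: "partition \<Rightarrow> nat \<Rightarrow> nat set" where
  "row_set \<alpha> i = {x. x < sum_mset \<alpha> \<and> tab_row \<alpha> x = i}"

lemma card_row_set: "i < size \<alpha> \<Longrightarrow> card (row_set \<alpha> i) = parts_list \<alpha> ! i"
  by (simp add: row_set_def card_tab_row_fiber)

lemma parts_list_pos:
  assumes "0 \<notin># \<alpha>" "i < size \<alpha>" shows "0 < parts_list \<alpha> ! i"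
proof -
  have "parts_list \<alpha> ! i \<in> set (parts_list \<alpha>)" using assms(2) by simp
  then have "parts_list \<alpha> ! i \<in># \<alpha>" by (metis mset_parts_list set_mset_mset)
  with assms(1) show ?thesis by (metis gr0I)
qed

lemma row_start_in_row_set:
  assumes "0 \<notin># \<alpha>" "i < size \<alpha>"
  shows "row_start \<alpha> i < sum_mset \<alpha>" "tab_row \<alpha> (row_start \<alpha> i) = i"
  using tab_row_row_start_add[OF assms(2) parts_list_pos[OF assms]] by simp_all

lemma row_sets_type:
  assumes "0 \<notin># \<alpha>"
  shows "image_mset card (mset_set (row_set \<alpha> ` {..<size \<alpha>})) = \<alpha>"
proof -
  have inj: "inj_on (row_set \<alpha>) {..<size \<alpha>}"
  proof (rule inj_onI)
    fix i j assume ij: "i \<in> {..<size \<alpha>}" "j \<in> {..<size \<alpha>}" "row_set \<alpha> i = row_set \<alpha> j"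
    have "row_start \<alpha> i \<in> row_set \<alpha> i"
      using row_start_in_row_set[OF assms, of i] ij(1) by (simp add: row_set_def)
    then have "row_start \<alpha> i \<in> row_set \<alpha> j" using ij(3) by simp
    then show "i = j" using row_start_in_row_set(2)[OF assms, of i] ij(1) by (simp add: row_set_def)
  qed
  have "image_mset card (mset_set (row_set \<alpha> ` {..<size \<alpha>})) =
      image_mset (\<lambda>i. card (row_set \<alpha> i)) (mset_set {..<size \<alpha>})"
    unfolding image_mset_mset_set[OF inj, symmetric] by (simp add: multiset.map_comp comp_def)
  also have "\<dots> = image_mset (\<lambda>i. parts_list \<alpha> ! i) (mset_set {..<size \<alpha>})"
    by (intro image_mset_cong) (simp add: card_row_set)
  also have "\<dots> = mset (map ((!) (parts_list \<alpha>)) [0..<size \<alpha>])"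
    by (simp add: atLeast0LessThan flip: mset_set_upto_eq_mset_upto)
  also have "map ((!) (parts_list \<alpha>)) [0..<size \<alpha>] = parts_list \<alpha>"
    by (metis length_parts_list map_nth)
  finally show ?thesis by simp
qed

lemma ex_permutation_with_row_orbits:
  assumes "0 \<notin># \<alpha>"
  shows "\<exists>p\<in>Sym (sum_mset \<alpha>). \<forall>x<sum_mset \<alpha>. orbit p x = row_set \<alpha> (tab_row \<alpha> x)"
proof -
  let ?n = "sum_mset \<alpha>" and ?l = "\<lambda>x. parts_list \<alpha> ! tab_row \<alpha> x"
  define p where "p x = (if x < ?n then row_start \<alpha> (tab_row \<alpha> x) + (tab_col \<alpha> x + 1) mod ?l x else x)" for x
  have pos: "0 < ?l x" if "x < ?n" for x
    using parts_list_pos[OF assms tab_row_bounds(1)[OF that]] .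
  have p: "p x < ?n" "tab_row \<alpha> (p x) = tab_row \<alpha> x" "tab_col \<alpha> (p x) = (tab_col \<alpha> x + 1) mod ?l x"
    if "x < ?n" for x
    using tab_row_row_start_add[OF tab_row_bounds(1)[OF that], of "(tab_col \<alpha> x + 1) mod ?l x"] pos[OF that] that
    by (simp_all add: p_def)
  have pow: "(p ^^ j) x < ?n \<and> tab_row \<alpha> ((p ^^ j) x) = tab_row \<alpha> x \<and>
      tab_col \<alpha> ((p ^^ j) x) = (tab_col \<alpha> x + j) mod ?l x" if "x < ?n" for x j
  proof (induction j)
    case 0
    then show ?case using that tab_col_less[OF that] by simp
  next
    case (Suc j)
    then show ?case using p[of "(p ^^ j) x"] by (simp add: mod_Suc_eq)
  qed
  have orb: "orbit p x = row_set \<alpha> (tab_row \<alpha> x)" if x: "x < ?n" for x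
  proof (intro equalityI subsetI)
    fix y assume "y \<in> orbit p x"
    then show "y \<in> row_set \<alpha> (tab_row \<alpha> x)"
      using pow[OF x] by (auto simp: orbit_altdef row_set_def)
  next
    fix y assume "y \<in> row_set \<alpha> (tab_row \<alpha> x)"
    then have y: "y < ?n" "tab_row \<alpha> y = tab_row \<alpha> x" by (auto simp: row_set_def)
    have cx: "tab_col \<alpha> x < ?l x" by (rule tab_col_less[OF x])
    have cy: "tab_col \<alpha> y < ?l x" using tab_col_less[OF y(1)] unfolding y(2) .
    define j where "j = tab_col \<alpha> y + (?l x - tab_col \<alpha> x)"
    have "tab_col \<alpha> x + j = tab_col \<alpha> y + ?l x" unfolding j_def using cx by linarith
    then have "(tab_col \<alpha> x + j) mod ?l x = tab_col \<alpha> y" using cy by (simp only: mod_add_self2 mod_less)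
    then have "(p ^^ j) x = y"
      using pow[OF x, of j] y by - (rule tab_inj[of _ \<alpha>], simp_all)
    moreover have "0 < j" unfolding j_def using cx by linarith
    ultimately show "y \<in> orbit p x" unfolding orbit_altdef by blast
  qed
  have "{..<?n} \<subseteq> p ` {..<?n}"
  proof
    fix y assume "y \<in> {..<?n}"
    then have y: "y < ?n" by simp
    have "y \<in> orbit p y" unfolding orb[OF y] using y by (simp add: row_set_def)
    then obtain j where j: "0 < j" "y = (p ^^ j) y"
      unfolding orbit_altdef by (elim CollectE exE conjE)
    have j': "j = Suc (j - 1)" using j(1) by linarith
    define x where "x = (p ^^ (j - 1)) y"
    have "(p ^^ j) y = p x" unfolding x_def by (subst j') (simp only: funpow.simps comp_apply)
    then have "y = p x" using j(2) by (rule trans[rotated])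
    moreover have "x < ?n" unfolding x_def using pow[OF y, of "j - 1"] by (rule conjunct1)
    ultimately show "y \<in> p ` {..<?n}" by (rule image_eqI[OF _ lessThan_iff[THEN iffD2]])
  qed
  moreover have "p ` {..<?n} \<subseteq> {..<?n}"
    by (rule image_subsetI) (simp only: lessThan_iff p(1))
  ultimately have im: "p ` {..<?n} = {..<?n}" by (intro equalityI)
  then have "inj_on p {..<?n}" by (intro eq_card_imp_inj_on) (simp_all only: finite_lessThan)
  with im have "bij_betw p {..<?n} {..<?n}" by (simp add: bij_betw_def)
  then have "p permutes {..<?n}" by (rule bij_imp_permutes) (simp add: p_def)
  with orb show ?thesis by blast
qed

lemma cycle_type_row_orbits:
  assumes "0 \<notin># \<alpha>" "\<forall>x<sum_mset \<alpha>. orbit p x = row_set \<alpha> (tab_row \<alpha> x)"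
  shows "cycle_type (sum_mset \<alpha>) p = \<alpha>"
proof -
  have "orbits (sum_mset \<alpha>) p = row_set \<alpha> ` tab_row \<alpha> ` {..<sum_mset \<alpha>}"
    unfolding image_image using assms(2) by (intro image_cong) auto
  also have "tab_row \<alpha> ` {..<sum_mset \<alpha>} = {..<size \<alpha>}"
  proof (intro equalityI subsetI)
    fix i assume "i \<in> {..<size \<alpha>}"
    then show "i \<in> tab_row \<alpha> ` {..<sum_mset \<alpha>}"
      using row_start_in_row_set[OF assms(1), of i] by (intro image_eqI[of _ _ "row_start \<alpha> i"]) auto
  qed (use tab_row_bounds(1) in auto)
  finally show ?thesis using row_sets_type[OF assms(1)] by (simp add: cycle_type_def)
qed

lemma ex_cycle_type:
  assumes "\<rho> \<in> partitions n" shows "\<exists>p\<in>Sym n. cycle_type n p = \<rho>"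
  using ex_permutation_with_row_orbits[of \<rho>] cycle_type_row_orbits[of \<rho>] assms
  by (auto simp: partitions_def)

lemma perm_char_eq_card:
  assumes "sum_mset \<alpha> = n"
  shows "perm_char \<alpha> p = of_nat (card {h \<in> Sym n. inv h \<circ> inv p \<circ> h \<in> row_group \<alpha>}) / of_nat (card (row_group \<alpha>))"
proof -
  have c: "coef (row_sum \<alpha>) g = (if g \<in> row_group \<alpha> then 1 else 0)" for g
    using finite_row_group[of \<alpha>] by (simp add: row_sum_def lookup_sum lookup_single when_def)
  have "(\<Sum>h\<in>Sym n. coef (row_sum \<alpha>) (inv h \<circ> inv p \<circ> h)) =
     of_nat (card {h \<in> Sym n. inv h \<circ> inv p \<circ> h \<in> row_group \<alpha>})"
    unfolding c by (simp add: sum.If_cases Int_def)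
  then show ?thesis
    unfolding perm_char_def assms conj_sum_scale by (simp add: conj_sum_def)
qed

lemma cycle_type_row_group:
  assumes q: "q \<in> row_group \<alpha>" and "0 \<notin># \<alpha>"
  shows "cycle_type (sum_mset \<alpha>) q = \<alpha> \<or> size \<alpha> < size (cycle_type (sum_mset \<alpha>) q)"
proof -
  let ?n = "sum_mset \<alpha>" and ?O = "orbits (sum_mset \<alpha>) q"
  have qS: "q \<in> Sym ?n" using perm_groupD(2)[OF perm_group_row q] by simp
  have perm: "permutation q" by (rule Sym_permutation[OF qS])
  have row: "tab_row \<alpha> (q x) = tab_row \<alpha> x" if "x < ?n" for x
    using q that by (simp add: row_group_def)
  have rowo: "y < ?n \<and> tab_row \<alpha> y = tab_row \<alpha> x" if "y \<in> orbit q x" "x < ?n" for x y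
    using that(1)
  proof induction
    case base
    then show ?case using row[OF that(2)] permutes_in_image[of q "{..<?n}" x] qS that(2) by simp
  next
    case (step y)
    then show ?case using row[of y] permutes_in_image[of q "{..<?n}" y] qS by simp
  qed
  define r where "r c = tab_row \<alpha> (SOME x. x \<in> c)" for c
  have r: "r (orbit q x) = tab_row \<alpha> x" if "x < ?n" for x
  proof -
    have "(SOME y. y \<in> orbit q x) \<in> orbit q x"
      by (rule someI[of _ x]) (rule permutation_self_in_orbit[OF perm])
    then show ?thesis using rowo[OF _ that] by (simp add: r_def)
  qed
  have im: "r ` ?O = {..<size \<alpha>}"
  proof (intro equalityI subsetI)
    fix i assume "i \<in> r ` ?O"
    then show "i \<in> {..<size \<alpha>}" using r tab_row_bounds(1) by auto
  next
    fix i assume "i \<in> {..<size \<alpha>}"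
    then have i: "i < size \<alpha>" by simp
    show "i \<in> r ` ?O"
      using r[OF row_start_in_row_set(1)[OF assms(2) i]] row_start_in_row_set[OF assms(2) i]
      by (intro image_eqI[of _ _ "orbit q (row_start \<alpha> i)"]) auto
  qed
  have size: "size (cycle_type ?n q) = card ?O" by (simp add: cycle_type_def)
  have le: "size \<alpha> \<le> card ?O"
    using card_image_le[of ?O r] unfolding im by simp
  show ?thesis
  proof (cases "size \<alpha> = card ?O")
    case True
    then have inj: "inj_on r ?O" using im by (intro eq_card_imp_inj_on) simp_all
    have "orbit q x = row_set \<alpha> (tab_row \<alpha> x)" if x: "x < ?n" for x
    proof (intro equalityI subsetI)
      fix y assume "y \<in> row_set \<alpha> (tab_row \<alpha> x)"
      then have y: "y < ?n" "tab_row \<alpha> y = tab_row \<alpha> x" by (auto simp: row_set_def)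
      then have "orbit q y = orbit q x" using x r[OF x] r[OF y(1)] by (intro inj_onD[OF inj]) auto
      then show "y \<in> orbit q x" using permutation_self_in_orbit[OF perm, of y] by simp
    qed (use rowo[OF _ x] in \<open>auto simp: row_set_def\<close>)
    then show ?thesis using cycle_type_row_orbits[OF assms(2), of q] by simp
  next
    case False
    with le size show ?thesis by simp
  qed
qed

lemma perm_char_nonzero:
  assumes "\<alpha> \<in> partitions n" "p \<in> Sym n" "perm_char \<alpha> p \<noteq> 0"
  shows "cycle_type n p = \<alpha> \<or> size \<alpha> < size (cycle_type n p)"
proof -
  have n: "sum_mset \<alpha> = n" and z: "0 \<notin># \<alpha>" using assms(1) by (auto simp: partitions_def)
  have "{h \<in> Sym n. inv h \<circ> inv p \<circ> h \<in> row_group \<alpha>} \<noteq> {}"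
  proof
    assume e: "{h \<in> Sym n. inv h \<circ> inv p \<circ> h \<in> row_group \<alpha>} = {}"
    show False using assms(3) unfolding perm_char_eq_card[OF n] e by simp
  qed
  then obtain h where h: "h \<in> Sym n" "inv h \<circ> inv p \<circ> h \<in> row_group \<alpha>" by blast
  have "inv h \<circ> inv p \<circ> inv (inv h) = inv h \<circ> inv p \<circ> h"
    using h(1) by (simp add: permutes_inv_inv)
  then have "cycle_type n (inv h \<circ> inv p \<circ> h) = cycle_type n (inv p)"
    using cycle_type_conj[of "inv p" n "inv h"] h(1) assms(2) by (simp add: permutes_inv)
  then have "cycle_type n (inv h \<circ> inv p \<circ> h) = cycle_type n p"
    by (simp only: cycle_type_inv[OF assms(2)])
  then show ?thesis using cycle_type_row_group[OF h(2) z] by (simp only: n)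
qed

lemma card_size_preserving:
  "card {\<pi>. \<pi> permutes {..<size \<alpha>} \<and> (\<forall>i<size \<alpha>. parts_list \<alpha> ! \<pi> i = parts_list \<alpha> ! i)} =
    (\<Prod>j\<in>set_mset \<alpha>. fact (count \<alpha> j))"
proof -
  have "(!) (parts_list \<alpha>) ` {..<size \<alpha>} = set (parts_list \<alpha>)"
    by (auto simp: set_conv_nth)
  also have "\<dots> = set_mset \<alpha>" by (metis mset_parts_list set_mset_mset)
  finally have im: "(!) (parts_list \<alpha>) ` {..<size \<alpha>} = set_mset \<alpha>" .
  have c: "card {i \<in> {..<size \<alpha>}. parts_list \<alpha> ! i = j} = count \<alpha> j" for j
  proof -
    have "count \<alpha> j = count (mset (parts_list \<alpha>)) j" by simp
    also have "\<dots> = card {i. i < length (parts_list \<alpha>) \<and> parts_list \<alpha> ! i = j}"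
      unfolding count_mset count_list_eq_length_filter length_filter_conv_card by (simp only: eq_commute[of j])
    finally show ?thesis by simp
  qed
  then show ?thesis
    using card_fun_preserving_permutations[of "{..<size \<alpha>}" "(!) (parts_list \<alpha>)"]
    unfolding im c by (simp only: Ball_def lessThan_iff finite_lessThan simp_thms)
qed

text \<open>The permutations mapping rows onto rows form a union of cosets of the row group, one for
  every permutation of the rows that preserves their lengths.\<close>

lemma card_row_permuting:
  assumes "0 \<notin># \<alpha>" and n: "sum_mset \<alpha> = n"
  shows "card {k \<in> Sym n. \<forall>y<n. \<forall>z<n. tab_row \<alpha> y = tab_row \<alpha> z \<longrightarrow> tab_row \<alpha> (k y) = tab_row \<alpha> (k z)} =
    (\<Prod>j\<in>set_mset \<alpha>. fact (count \<alpha> j)) * card (row_group \<alpha>)"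
proof -
  let ?r = "tab_row \<alpha>" and ?s = "row_start \<alpha>" and ?l = "size \<alpha>" and ?p = "parts_list \<alpha>"
  let ?M = "{k \<in> Sym n. \<forall>y<n. \<forall>z<n. ?r y = ?r z \<longrightarrow> ?r (k y) = ?r (k z)}"
  let ?P = "{\<pi>. \<pi> permutes {..<?l} \<and> (\<forall>i<?l. ?p ! \<pi> i = ?p ! i)}"
  define F where "F k i = (if i < ?l then ?r (k (?s i)) else i)" for k i
  note start = row_start_in_row_set[OF assms(1), unfolded n]
  have lt: "k x < n" if "k \<in> Sym n" "x < n" for k x
    using permutes_in_image[of k "{..<n}" x] that by simp
  have rl: "?r x < ?l" if "x < n" for x using tab_row_bounds(1)[of x \<alpha>] that n by simp
  have Mp: "k permutes {..<n}" and Mr: "\<And>y z. y < n \<Longrightarrow> z < n \<Longrightarrow> ?r y = ?r z \<Longrightarrow> ?r (k y) = ?r (k z)"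
    if "k \<in> ?M" for k
    using CollectD[OF that] by blast+
  have Fr: "F k (?r x) = ?r (k x)" if "k \<in> ?M" "x < n" for k x
  proof -
    have "F k (?r x) = ?r (k (?s (?r x)))" using rl[OF that(2)] by (simp only: F_def if_True)
    also have "\<dots> = ?r (k x)"
      by (rule Mr[OF that(1) start(1)[OF rl[OF that(2)]] that(2) start(2)[OF rl[OF that(2)]]])
    finally show ?thesis .
  qed
  have FP: "F k \<in> ?P" if k: "k \<in> ?M" for k
  proof -
    have kp: "k permutes {..<n}" by (rule Mp[OF k])
    then have kS: "k \<in> Sym n" by simp
    have "{..<?l} \<subseteq> F k ` {..<?l}"
    proof
      fix i assume "i \<in> {..<?l}"
      then have i: "i < ?l" by simp
      define x where "x = inv k (?s i)"
      have x: "x < n" "k x = ?s i"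
        using start(1)[OF i] permutes_in_image[OF permutes_inv[OF kp], of "?s i"] permutes_inverses[OF kp]
        by (auto simp: x_def)
      then have "F k (?r x) = i" using Fr[OF k x(1)] start(2)[OF i] by simp
      then show "i \<in> F k ` {..<?l}" using rl[OF x(1)] by (intro image_eqI[of _ _ "?r x"]) simp_all
    qed
    moreover have "F k ` {..<?l} \<subseteq> {..<?l}"
    proof (rule image_subsetI)
      fix i assume "i \<in> {..<?l}"
      then have i: "i < ?l" by simp
      show "F k i \<in> {..<?l}" using i rl[OF lt[OF kS start(1)[OF i]]] by (simp add: F_def)
    qed
    ultimately have im: "F k ` {..<?l} = {..<?l}" by (intro equalityI)
    then have inj: "inj_on (F k) {..<?l}" by (intro eq_card_imp_inj_on) (simp_all only: finite_lessThan)
    have "bij_betw (F k) {..<?l} {..<?l}" using im inj by (simp add: bij_betw_def)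
    then have perm: "F k permutes {..<?l}" by (rule bij_imp_permutes) (simp add: F_def)
    have "?p ! F k i = ?p ! i" if i: "i < ?l" for i
    proof -
      have Fi: "F k i < ?l" using im i by auto
      have "k ` row_set \<alpha> i = row_set \<alpha> (F k i)"
      proof (intro equalityI subsetI)
        fix y assume "y \<in> k ` row_set \<alpha> i"
        then obtain x where x: "x < n" "?r x = i" "y = k x" by (auto simp: row_set_def n)
        then show "y \<in> row_set \<alpha> (F k i)" using Fr[OF k x(1)] lt[OF kS x(1)] by (simp add: row_set_def n)
      next
        fix y assume "y \<in> row_set \<alpha> (F k i)"
        then have y: "y < n" "?r y = F k i" by (auto simp: row_set_def n)
        define x where "x = inv k y"
        have x: "x < n" "k x = y"
          using y(1) permutes_in_image[OF permutes_inv[OF kp], of y] permutes_inverses[OF kp]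
          by (auto simp: x_def)
        have "F k (?r x) = F k i" using Fr[OF k x(1)] x(2) y(2) by simp
        then have "?r x = i" using inj_onD[OF inj] rl[OF x(1)] i by blast
        then show "y \<in> k ` row_set \<alpha> i" using x by (intro image_eqI[of _ _ x]) (auto simp: row_set_def n)
      qed
      moreover have "card (k ` row_set \<alpha> i) = card (row_set \<alpha> i)"
        by (intro card_image inj_on_subset[OF permutes_inj[OF kp]]) simp
      ultimately show ?thesis using card_row_set[OF i] card_row_set[OF Fi] by simp
    qed
    with perm show ?thesis by simp
  qed
  have fiber: "card {k \<in> ?M. F k = \<pi>} = card (row_group \<alpha>)" if "\<pi> \<in> ?P" for \<pi>
  proof -
    have \<pi>: "\<pi> permutes {..<?l}" "\<And>i. i < ?l \<Longrightarrow> ?p ! \<pi> i = ?p ! i" using that by auto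
    have \<pi>l: "\<pi> i < ?l" if "i < ?l" for i using permutes_in_image[OF \<pi>(1), of i] that by simp
    define k0 where "k0 x = (if x < n then ?s (\<pi> (?r x)) + tab_col \<alpha> x else x)" for x
    have k0: "k0 x < n" "?r (k0 x) = \<pi> (?r x)" "tab_col \<alpha> (k0 x) = tab_col \<alpha> x" if "x < n" for x
    proof -
      have "tab_col \<alpha> x < ?p ! \<pi> (?r x)"
        using tab_col_less[of x \<alpha>] that n \<pi>(2)[OF rl[OF that]] by simp
      from tab_row_row_start_add[OF \<pi>l[OF rl[OF that]] this] n that
      show "k0 x < n" "?r (k0 x) = \<pi> (?r x)" "tab_col \<alpha> (k0 x) = tab_col \<alpha> x" by (simp_all add: k0_def)
    qed
    have "inj_on k0 {..<n}"
    proof (rule inj_onI)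
      fix x y assume xy: "x \<in> {..<n}" "y \<in> {..<n}" "k0 x = k0 y"
      then have l: "x < n" "y < n" by auto
      have "\<pi> (?r x) = \<pi> (?r y)" using k0(2)[OF l(1)] k0(2)[OF l(2)] xy(3) by simp
      then have "?r x = ?r y" using permutes_inj[OF \<pi>(1)] by (auto dest: injD)
      moreover have "tab_col \<alpha> x = tab_col \<alpha> y" using k0(3)[OF l(1)] k0(3)[OF l(2)] xy(3) by simp
      ultimately show "x = y" using tab_inj[of x \<alpha> y] l n by simp
    qed
    moreover have "k0 ` {..<n} \<subseteq> {..<n}" using k0(1) by auto
    ultimately have "bij_betw k0 {..<n} {..<n}" by (simp add: bij_betw_def endo_inj_surj)
    then have k0p: "k0 permutes {..<n}" by (rule bij_imp_permutes) (simp add: k0_def)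
    have k0b: "bij k0" by (rule permutes_bij[OF k0p])
    have "{k \<in> ?M. F k = \<pi>} = (\<lambda>p. p \<circ> k0) ` row_group \<alpha>"
    proof (intro equalityI subsetI)
      fix k assume kk: "k \<in> {k \<in> ?M. F k = \<pi>}"
      then have k: "k \<in> ?M" by (rule CollectE) (rule conjunct1)
      have Fk: "F k = \<pi>" using kk by (rule CollectE) (rule conjunct2)
      have kp: "k permutes {..<n}" by (rule Mp[OF k])
      have "k \<circ> inv k0 permutes {..<n}" by (rule permutes_compose[OF permutes_inv[OF k0p] kp])
      moreover have "?r ((k \<circ> inv k0) x) = ?r x" if x: "x < n" for x
      proof -
        have ix: "inv k0 x < n" using permutes_in_image[OF permutes_inv[OF k0p], of x] x by simp
        have "?r ((k \<circ> inv k0) x) = \<pi> (?r (inv k0 x))" using Fr[OF k ix] Fk by simp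
        also have "\<dots> = ?r (k0 (inv k0 x))" by (rule k0(2)[OF ix, symmetric])
        also have "\<dots> = ?r x" by (simp only: permutes_inverses[OF k0p])
        finally show ?thesis .
      qed
      ultimately have mem: "k \<circ> inv k0 \<in> row_group \<alpha>" by (simp add: row_group_def n)
      have eq: "k = (k \<circ> inv k0) \<circ> k0"
        by (simp add: comp_assoc permutes_inv_o[OF k0p])
      show "k \<in> (\<lambda>p. p \<circ> k0) ` row_group \<alpha>"
        by (rule image_eqI[of _ "\<lambda>p. p \<circ> k0" "k \<circ> inv k0"]) (rule eq, rule mem)
    next
      fix k assume "k \<in> (\<lambda>p. p \<circ> k0) ` row_group \<alpha>"
      then obtain p where p: "p permutes {..<n}" "\<And>x. x < n \<Longrightarrow> ?r (p x) = ?r x" and k: "k = p \<circ> k0"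
        by (auto simp: row_group_def n)
      have rk: "?r (k x) = \<pi> (?r x)" if "x < n" for x
        using p(2)[OF k0(1)[OF that]] k0(2)[OF that] by (simp add: k)
      have "k permutes {..<n}" unfolding k by (rule permutes_compose[OF k0p p(1)])
      moreover have "?r (k y) = ?r (k z)" if "y < n" "z < n" "?r y = ?r z" for y z
        by (simp only: rk[OF that(1)] rk[OF that(2)] that(3))
      ultimately have kM: "k \<in> ?M" by blast
      have "F k = \<pi>"
      proof
        fix i show "F k i = \<pi> i"
          using rk[OF start(1)[of i]] start(2)[of i] permutes_not_in[OF \<pi>(1), of i]
          by (cases "i < ?l") (simp_all add: F_def)
      qed
      with kM have "k \<in> ?M \<and> F k = \<pi>" by (rule conjI)
      then show "k \<in> {k \<in> ?M. F k = \<pi>}" by (rule CollectI[of "\<lambda>k. k \<in> ?M \<and> F k = \<pi>"])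
    qed
    moreover have "inj_on (\<lambda>p. p \<circ> k0) (row_group \<alpha>)"
    proof (rule inj_onI)
      fix p p' assume "p \<circ> k0 = p' \<circ> k0"
      then have "p = p' \<circ> k0 \<circ> inv k0" unfolding comp_eq_iff_right[OF k0b] .
      then show "p = p'" by (simp only: comp_assoc permutes_inv_o[OF k0p] comp_id)
    qed
    ultimately show ?thesis by (simp only: card_image)
  qed
  have finM: "finite ?M"
    by (rule finite_subset[OF _ finite_Sym[of n]], rule subsetI, erule CollectE, erule conjunct1)
  have finP: "finite ?P"
    by (rule finite_subset[OF _ finite_Sym[of ?l]], rule Collect_mono, rule impI, erule conjunct1)
  have "F ` ?M \<subseteq> ?P"
  proof (rule image_subsetI)
    fix k assume "k \<in> ?M"
    then show "F k \<in> ?P" by (rule FP)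
  qed
  then have s: "(\<Sum>\<pi>\<in>?P. \<Sum>k\<in>{k. k \<in> ?M \<and> F k = \<pi>}. 1) = (\<Sum>k\<in>?M. 1::nat)"
    by (rule sum.group[OF finM finP])
  have "card ?M = (\<Sum>\<pi>\<in>?P. card {k \<in> ?M. F k = \<pi>})"
    unfolding card_eq_sum s ..
  also have "\<dots> = (\<Sum>\<pi>\<in>?P. card (row_group \<alpha>))" by (rule sum.cong[OF refl fiber])
  also have "\<dots> = card ?P * card (row_group \<alpha>)" by (simp only: sum_constant of_nat_id)
  finally show ?thesis unfolding card_size_preserving .
qed

lemma perm_char_diag:
  assumes "\<alpha> \<in> partitions n" "p \<in> Sym n" "cycle_type n p = \<alpha>"
  shows "perm_char \<alpha> p = (\<Prod>j\<in>set_mset \<alpha>. fact (count \<alpha> j))"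
proof -
  have n: "sum_mset \<alpha> = n" and z: "0 \<notin># \<alpha>" using assms(1) by (auto simp: partitions_def)
  obtain q where q: "q \<in> Sym n" and orb: "\<forall>x<n. orbit q x = row_set \<alpha> (tab_row \<alpha> x)"
    using ex_permutation_with_row_orbits[OF z] unfolding n by blast
  have "cycle_type n q = \<alpha>" using cycle_type_row_orbits[OF z, unfolded n, OF orb] .
  then obtain h where h: "h \<in> Sym n" "q = h \<circ> p \<circ> inv h"
    using same_cycle_type_conj[OF assms(2) q] assms(3) by auto
  have "perm_char \<alpha> p = perm_char \<alpha> q"
    unfolding perm_char_def n h(2) conj_sum_conj[OF assms(2) h(1)] ..
  also have "\<dots> = of_nat (card {h \<in> Sym n. inv h \<circ> inv q \<circ> h \<in> row_group \<alpha>}) / of_nat (card (row_group \<alpha>))"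
    by (rule perm_char_eq_card[OF n])
  also have "card {h \<in> Sym n. inv h \<circ> inv q \<circ> h \<in> row_group \<alpha>} =
      card {k \<in> Sym n. \<forall>y<n. \<forall>z<n. tab_row \<alpha> y = tab_row \<alpha> z \<longrightarrow> tab_row \<alpha> (k y) = tab_row \<alpha> (k z)}"
  proof (rule bij_betw_same_card[of inv])
    let ?r = "tab_row \<alpha>"
    have iq: "inv q \<in> Sym n" using q by (simp add: permutes_inv)
    have orb': "orbit (inv q) x = row_set \<alpha> (?r x)" if "x < n" for x
      using orb that orbit_inv_eq[OF Sym_permutation[OF q]] by simp
    have iff: "k \<circ> inv q \<circ> inv k \<in> row_group \<alpha> \<longleftrightarrow>
        (\<forall>y<n. \<forall>z<n. ?r y = ?r z \<longrightarrow> ?r (k y) = ?r (k z))" if k: "k permutes {..<n}" for k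
    proof
      assume "k \<circ> inv q \<circ> inv k \<in> row_group \<alpha>"
      then have *: "?r (k (inv q (inv k x))) = ?r x" if "x < n" for x
        using that by (simp add: row_group_def n)
      have step: "?r (k (inv q y)) = ?r (k y)" if "y < n" for y
      proof -
        have "k y < n" using permutes_in_image[OF k, of y] that by simp
        from *[OF this] show ?thesis by (simp only: permutes_inverses[OF k])
      qed
      have "z < n \<and> ?r (k z) = ?r (k y)" if "z \<in> orbit (inv q) y" "y < n" for y z
        using that(1)
      proof induction
        case base
        then show ?case using step[OF that(2)] permutes_in_image[of "inv q" "{..<n}" y] iq that(2) by simp
      next
        case (step z)
        then show ?case using \<open>\<And>y. y < n \<Longrightarrow> ?r (k (inv q y)) = ?r (k y)\<close>[of z]
            permutes_in_image[of "inv q" "{..<n}" z] iq by simp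
      qed
      note orbit_const = this
      show "\<forall>y<n. \<forall>z<n. ?r y = ?r z \<longrightarrow> ?r (k y) = ?r (k z)"
      proof (intro allI impI)
        fix y z assume yz: "y < n" "z < n" "?r y = ?r z"
        have "y \<in> orbit (inv q) z" unfolding orb'[OF yz(2)] using yz by (simp add: row_set_def n)
        from orbit_const[OF this yz(2)] show "?r (k y) = ?r (k z)" by (rule conjunct2)
      qed
    next
      assume *: "\<forall>y<n. \<forall>z<n. ?r y = ?r z \<longrightarrow> ?r (k y) = ?r (k z)"
      have "?r (k (inv q (inv k x))) = ?r x" if "x < n" for x
      proof -
        have ix: "inv k x < n" using permutes_in_image[OF permutes_inv[OF k], of x] that by simp
        have "inv q (inv k x) \<in> orbit (inv q) (inv k x)" by (rule orbit.base)
        then have "inv q (inv k x) < n \<and> ?r (inv q (inv k x)) = ?r (inv k x)"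
          unfolding orb'[OF ix] by (simp add: row_set_def n)
        then have "?r (k (inv q (inv k x))) = ?r (k (inv k x))" using * ix by blast
        then show ?thesis by (simp only: permutes_inverses[OF k])
      qed
      moreover have "k \<circ> inv q \<circ> inv k permutes {..<n}"
        using permutes_compose[OF permutes_inv[OF k] permutes_compose[OF _ k]] iq by simp
      ultimately show "k \<circ> inv q \<circ> inv k \<in> row_group \<alpha>" by (simp add: row_group_def n)
    qed
    let ?A = "{h \<in> Sym n. inv h \<circ> inv q \<circ> h \<in> row_group \<alpha>}"
    let ?B = "{k \<in> Sym n. \<forall>y<n. \<forall>z<n. ?r y = ?r z \<longrightarrow> ?r (k y) = ?r (k z)}"
    have B: "?B = {k \<in> Sym n. k \<circ> inv q \<circ> inv k \<in> row_group \<alpha>}"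
      using iff by blast
    show "bij_betw inv ?A ?B"
      unfolding B by (rule bij_betwI[where g = inv]) (auto simp: permutes_inv permutes_inv_inv)
  qed
  finally show ?thesis
    unfolding card_row_permuting[OF z n] using perm_groupD(5)[OF perm_group_row, of \<alpha>] finite_row_group[of \<alpha>]
    by (auto simp: card_gt_0_iff)
qed

subsection \<open>Transition from permutation characters to irreducible characters\<close>

definition class_rep :: "partition \<Rightarrow> nat \<Rightarrow> nat" where
  "class_rep \<rho> = (SOME p. p permutes {..<sum_mset \<rho>} \<and> cycle_type (sum_mset \<rho>) p = \<rho>)"

lemma class_rep:
  assumes "\<rho> \<in> partitions n"
  shows "class_rep \<rho> \<in> Sym n" "cycle_type n (class_rep \<rho>) = \<rho>"
proof -
  have "\<exists>p. p permutes {..<sum_mset \<rho>} \<and> cycle_type (sum_mset \<rho>) p = \<rho>"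
    using ex_cycle_type[OF assms] by (auto simp: partitions_sum_mset[OF assms])
  then have "class_rep \<rho> permutes {..<sum_mset \<rho>} \<and> cycle_type (sum_mset \<rho>) (class_rep \<rho>) = \<rho>"
    unfolding class_rep_def by (rule someI_ex)
  then show "class_rep \<rho> \<in> Sym n" "cycle_type n (class_rep \<rho>) = \<rho>"
    by (auto simp: partitions_sum_mset[OF assms])
qed

lemma irr_char_class_eq:
  assumes "\<alpha> \<in> partitions n" "\<rho> \<in> partitions n"
  shows "irr_char_class \<alpha> \<rho> = irr_char \<alpha> (class_rep \<rho>)"
  using assms by (simp add: irr_char_class_def class_rep_def partitions_sum_mset)

lemma conj_sum_cong_type:
  assumes "p \<in> Sym n" "q \<in> Sym n" "cycle_type n p = cycle_type n q"
  shows "conj_sum n x p = conj_sum n x q"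
proof -
  obtain h where "h \<in> Sym n" "q = h \<circ> p \<circ> inv h"
    using same_cycle_type_conj[OF assms] by blast
  then show ?thesis using conj_sum_conj[OF assms(1)] by simp
qed

lemma irr_char_cong_type:
  assumes "\<alpha> \<in> partitions n" "p \<in> Sym n" "q \<in> Sym n" "cycle_type n p = cycle_type n q"
  shows "irr_char \<alpha> p = irr_char \<alpha> q"
  using conj_sum_cong_type[OF assms(2-4)] assms by (simp add: irr_char_eq)

lemma perm_char_cong_type:
  assumes "\<alpha> \<in> partitions n" "p \<in> Sym n" "q \<in> Sym n" "cycle_type n p = cycle_type n q"
  shows "perm_char \<alpha> p = perm_char \<alpha> q"
  using conj_sum_cong_type[OF assms(2-4)] by (simp add: perm_char_def partitions_sum_mset[OF assms(1)])

lemma sum_Sym_by_type: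
  assumes f: "\<And>p q. p \<in> Sym n \<Longrightarrow> q \<in> Sym n \<Longrightarrow> cycle_type n p = cycle_type n q \<Longrightarrow> f p = f q"
  shows "(\<Sum>g\<in>Sym n. f g) =
    (\<Sum>\<rho>\<in>partitions n. of_nat (card {g \<in> Sym n. cycle_type n g = \<rho>}) * (f (class_rep \<rho>) :: rat))"
proof -
  have im: "cycle_type n ` Sym n \<subseteq> partitions n"
    using cycle_type_partition by blast
  have "(\<Sum>g\<in>Sym n. f g) = (\<Sum>\<rho>\<in>partitions n. \<Sum>g\<in>{g. g \<in> Sym n \<and> cycle_type n g = \<rho>}. f g)"
    by (rule sum.group[OF finite_Sym finite_partitions im, symmetric])
  also have "\<dots> = (\<Sum>\<rho>\<in>partitions n. \<Sum>g\<in>{g. g \<in> Sym n \<and> cycle_type n g = \<rho>}. f (class_rep \<rho>))"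
  proof (rule sum.cong[OF refl], rule sum.cong[OF refl])
    fix \<rho> g assume "\<rho> \<in> partitions n" "g \<in> {g. g \<in> Sym n \<and> cycle_type n g = \<rho>}"
    then show "f g = f (class_rep \<rho>)" using class_rep[of \<rho> n] by (intro f) simp_all
  qed
  finally show ?thesis by simp
qed

text \<open>Multiplicity of the irreducible character of \<open>\<beta>\<close> in the permutation character of \<open>\<alpha>\<close>
  (a Kostka number).\<close>

definition kostka :: "partition \<Rightarrow> partition \<Rightarrow> rat" where
  "kostka \<alpha> \<beta> = (\<Sum>g\<in>Sym (sum_mset \<alpha>). perm_char \<alpha> g * irr_char \<beta> (inv g)) / fact (sum_mset \<alpha>)"

lemma kostka_diag: "\<alpha> \<in> partitions n \<Longrightarrow> kostka \<alpha> \<alpha> = 1"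
  using sum_Sym_perm_char_irr_char[of \<alpha> n \<alpha>] by (simp add: kostka_def partitions_sum_mset)

lemma kostka_nonzero:
  assumes "\<alpha> \<in> partitions n" "\<beta> \<in> partitions n" "kostka \<alpha> \<beta> \<noteq> 0"
  shows "\<beta> = \<alpha> \<or> row_stat \<beta> < row_stat \<alpha>"
proof (rule ccontr)
  assume "\<not> ?thesis"
  then show False
    using sum_Sym_perm_char_irr_char[OF assms(1,2)] assms(3)
    by (auto simp: kostka_def partitions_sum_mset[OF assms(1)] split: if_splits)
qed

lemma sum_partitions_as_index:
  assumes "distinct ps" "set ps = P"
  shows "(\<Sum>\<rho>\<in>P. f \<rho>) = (\<Sum>i<length ps. f (ps ! i))"
  unfolding assms(2)[symmetric] sum.distinct_set_conv_list[OF assms(1)]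
  by (simp add: sum_list_sum_nth atLeast0LessThan)

text \<open>The second orthogonality relation, obtained from the first one because a one-sided inverse
  of a square matrix is two-sided.\<close>

lemma irr_char_column_orth:
  assumes "\<rho> \<in> partitions n" "\<sigma> \<in> partitions n"
  shows "(\<Sum>\<beta>\<in>partitions n. of_nat (card {g \<in> Sym n. cycle_type n g = \<rho>}) / fact n *
      irr_char_class \<beta> \<rho> * irr_char_class \<beta> \<sigma>) = (if \<rho> = \<sigma> then 1 else (0::rat))"
proof -
  obtain ps where ps: "set ps = partitions n" "distinct ps"
    using finite_distinct_list[OF finite_partitions[of n]] by (elim exE conjE)
  note ps = ps(2,1)
  define N where "N = length ps"
  have mem: "ps ! i \<in> partitions n" if "i < N" for i unfolding ps(2)[symmetric] using that by (simp add: N_def)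
  define c where "c \<rho> = (of_nat (card {g \<in> Sym n. cycle_type n g = \<rho>}) / fact n :: rat)" for \<rho>
  define X where "X = mat N N (\<lambda>(i, j). irr_char_class (ps ! i) (ps ! j))"
  define Y where "Y = mat N N (\<lambda>(i, j). c (ps ! i) * irr_char_class (ps ! j) (ps ! i))"
  have X: "X \<in> carrier_mat N N" and Y: "Y \<in> carrier_mat N N" by (simp_all add: X_def Y_def)
  have row: "(\<Sum>\<rho>\<in>partitions n. irr_char_class \<alpha> \<rho> * (c \<rho> * irr_char_class \<beta> \<rho>)) = (if \<alpha> = \<beta> then 1 else 0)"
    if \<alpha>: "\<alpha> \<in> partitions n" and \<beta>: "\<beta> \<in> partitions n" for \<alpha> \<beta>
  proof -
    have inv: "irr_char \<beta> (inv g) = irr_char \<beta> g" if "g \<in> Sym n" for g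
      using that by (intro irr_char_cong_type[OF \<beta>]) (auto simp: permutes_inv cycle_type_inv)
    have "(if \<alpha> = \<beta> then fact n else 0) = (\<Sum>g\<in>Sym n. irr_char \<alpha> g * irr_char \<beta> g)"
      using sum_Sym_irr_char_orth[OF \<alpha> \<beta>] by (simp add: inv)
    also have "\<dots> = (\<Sum>\<rho>\<in>partitions n. of_nat (card {g \<in> Sym n. cycle_type n g = \<rho>}) *
        (irr_char \<alpha> (class_rep \<rho>) * irr_char \<beta> (class_rep \<rho>)))"
      by (intro sum_Sym_by_type arg_cong2[of _ _ _ _ "(*)"] irr_char_cong_type[OF \<alpha>] irr_char_cong_type[OF \<beta>])
    also have "\<dots> = (\<Sum>\<rho>\<in>partitions n. fact n * (irr_char_class \<alpha> \<rho> * (c \<rho> * irr_char_class \<beta> \<rho>)))"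
      by (intro sum.cong refl) (simp add: c_def irr_char_class_eq[OF \<alpha>] irr_char_class_eq[OF \<beta>])
    also have "\<dots> = fact n * (\<Sum>\<rho>\<in>partitions n. irr_char_class \<alpha> \<rho> * (c \<rho> * irr_char_class \<beta> \<rho>))"
      by (rule sum_distrib_left[symmetric])
    finally show ?thesis by (auto split: if_splits)
  qed
  have "X * Y = 1\<^sub>m N"
  proof (rule eq_matI)
    fix i j assume ij: "i < dim_row (1\<^sub>m N)" "j < dim_col (1\<^sub>m N)"
    then have "(X * Y) $$ (i, j) = (\<Sum>k<N. irr_char_class (ps ! i) (ps ! k) * (c (ps ! k) * irr_char_class (ps ! j) (ps ! k)))"
      by (simp add: X_def Y_def scalar_prod_def atLeast0LessThan)
    also have "\<dots> = (if ps ! i = ps ! j then 1 else 0)"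
      using row[OF mem mem, of i j] ij by (simp add: sum_partitions_as_index[OF ps] N_def)
    finally show "(X * Y) $$ (i, j) = 1\<^sub>m N $$ (i, j)"
      using ij ps(1) by (simp add: nth_eq_iff_index_eq N_def)
  qed (simp_all add: X_def Y_def)
  then have YX: "Y * X = 1\<^sub>m N" by (rule mat_mult_left_right_inverse[OF X Y])
  obtain i j where ij: "i < N" "j < N" "\<rho> = ps ! i" "\<sigma> = ps ! j"
    using assms ps(2) unfolding N_def by (metis in_set_conv_nth)
  have "(Y * X) $$ (i, j) = (\<Sum>k<N. c \<rho> * irr_char_class (ps ! k) \<rho> * irr_char_class (ps ! k) \<sigma>)"
    using ij by (simp add: X_def Y_def scalar_prod_def atLeast0LessThan)
  also have "\<dots> = (\<Sum>\<beta>\<in>partitions n. c \<rho> * irr_char_class \<beta> \<rho> * irr_char_class \<beta> \<sigma>)"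
    by (simp add: sum_partitions_as_index[OF ps] N_def)
  finally have "(\<Sum>\<beta>\<in>partitions n. c \<rho> * irr_char_class \<beta> \<rho> * irr_char_class \<beta> \<sigma>) = 1\<^sub>m N $$ (i, j)"
    unfolding YX ..
  then show ?thesis using ij ps(1) by (simp add: nth_eq_iff_index_eq N_def c_def)
qed

lemma perm_char_eq_sum_kostka:
  assumes \<alpha>: "\<alpha> \<in> partitions n" and \<sigma>: "\<sigma> \<in> partitions n"
  shows "perm_char \<alpha> (class_rep \<sigma>) = (\<Sum>\<beta>\<in>partitions n. kostka \<alpha> \<beta> * irr_char_class \<beta> \<sigma>)"
proof -
  define c where "c \<rho> = (of_nat (card {g \<in> Sym n. cycle_type n g = \<rho>}) / fact n :: rat)" for \<rho>
  let ?\<psi> = "\<lambda>\<rho>. perm_char \<alpha> (class_rep \<rho>)"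
  have K: "kostka \<alpha> \<beta> = (\<Sum>\<rho>\<in>partitions n. ?\<psi> \<rho> * (c \<rho> * irr_char_class \<beta> \<rho>))"
    if \<beta>: "\<beta> \<in> partitions n" for \<beta>
  proof -
    have inv: "irr_char \<beta> (inv g) = irr_char \<beta> g" if "g \<in> Sym n" for g
      using that by (intro irr_char_cong_type[OF \<beta>]) (auto simp: permutes_inv cycle_type_inv)
    have "(\<Sum>g\<in>Sym n. perm_char \<alpha> g * irr_char \<beta> (inv g)) = (\<Sum>g\<in>Sym n. perm_char \<alpha> g * irr_char \<beta> g)"
      by (intro sum.cong refl) (simp add: inv)
    also have "\<dots> = (\<Sum>\<rho>\<in>partitions n. of_nat (card {g \<in> Sym n. cycle_type n g = \<rho>}) *
        (?\<psi> \<rho> * irr_char \<beta> (class_rep \<rho>)))"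
      by (intro sum_Sym_by_type arg_cong2[of _ _ _ _ "(*)"] perm_char_cong_type[OF \<alpha>] irr_char_cong_type[OF \<beta>])
    finally show ?thesis
      by (simp add: kostka_def partitions_sum_mset[OF \<alpha>] sum_divide_distrib c_def irr_char_class_eq[OF \<beta>] mult_ac)
  qed
  have "(\<Sum>\<beta>\<in>partitions n. kostka \<alpha> \<beta> * irr_char_class \<beta> \<sigma>) =
      (\<Sum>\<beta>\<in>partitions n. \<Sum>\<rho>\<in>partitions n. ?\<psi> \<rho> * (c \<rho> * irr_char_class \<beta> \<rho> * irr_char_class \<beta> \<sigma>))"
    by (intro sum.cong refl) (simp only: K sum_distrib_right mult.assoc)
  also have "\<dots> = (\<Sum>\<rho>\<in>partitions n. \<Sum>\<beta>\<in>partitions n. ?\<psi> \<rho> * (c \<rho> * irr_char_class \<beta> \<rho> * irr_char_class \<beta> \<sigma>))"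
    by (rule sum.swap)
  also have "\<dots> = (\<Sum>\<rho>\<in>partitions n. ?\<psi> \<rho> * (if \<rho> = \<sigma> then 1 else 0))"
    by (intro sum.cong refl) (simp add: irr_char_column_orth[OF _ \<sigma>, folded c_def] flip: sum_distrib_left)
  also have "\<dots> = ?\<psi> \<sigma>"
    using \<sigma> by (simp add: finite_partitions if_distrib cong: if_cong)
  finally show ?thesis ..
qed

section \<open>Lattices spanned by products\<close>

unbundle fps_syntax
no_notation vec_index (infixl \<open>$\<close> 100)

lemma const_simps:
  "const (a + b) = const a + const b" "const (a - b) = const a - const b" "const (- a) = - const a"
  "const (a * b) = const a * const b" "const 0 = 0" "const 1 = 1"
  by (simp_all add: const_def single_add single_diff single_uminus mult_single single_one)

lemma const_of_int: "const (of_int k) = of_int k"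
  by (simp add: const_def single_of_int)

lemma const_of_nat: "const (of_nat k) = of_nat k"
  by (simp add: const_def single_of_nat)

lemma const_sum: "const (\<Sum>i\<in>I. f i) = (\<Sum>i\<in>I. const (f i))"
  by (induction I rule: infinite_finite_induct) (simp_all add: const_simps)

lemma const_power: "const (a ^ k) = const a ^ k"
  by (induction k) (simp_all add: const_simps)

interpretation zmod: Modules.module "\<lambda>(k::int) (p::qpoly). of_int k * p"
  by unfold_locales (simp_all add: algebra_simps)

interpretation qvec: vector_space "\<lambda>(c::rat) (p::qpoly). const c * p"
  by unfold_locales (simp_all add: algebra_simps const_simps)

lemma zspan_mult:
  assumes "x \<in> zmod.span S" "y \<in> zmod.span T"
    and ST: "\<And>s t. s \<in> S \<Longrightarrow> t \<in> T \<Longrightarrow> s * t \<in> zmod.span U"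
  shows "x * y \<in> zmod.span U"
  using assms(1)
proof (induction rule: zmod.span_induct_alt)
  case base
  then show ?case by (simp add: zmod.span_zero)
next
  case (step c s x)
  have "s * y \<in> zmod.span U"
    using assms(2)
  proof (induction rule: zmod.span_induct_alt)
    case base
    then show ?case by (simp add: zmod.span_zero)
  next
    case (step d t y)
    have "s * (of_int d * t + y) = of_int d * (s * t) + s * y" by (simp add: algebra_simps)
    then show ?case
      using zmod.span_add[OF zmod.span_scale[OF ST[OF \<open>s \<in> S\<close> step(1)], of d] step(2)] by simp
  qed
  moreover have "(of_int c * s + x) * y = of_int c * (s * y) + x * y" by (simp add: algebra_simps)
  ultimately show ?case
    using zmod.span_add[OF zmod.span_scale[of "s * y" U c] step(2)] by simp
qed

lemma qspan_mult:
  assumes "x \<in> qvec.span S" "y \<in> qvec.span T"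
    and ST: "\<And>s t. s \<in> S \<Longrightarrow> t \<in> T \<Longrightarrow> s * t \<in> qvec.span U"
  shows "x * y \<in> qvec.span U"
  using assms(1)
proof (induction rule: qvec.span_induct_alt)
  case base
  then show ?case by (simp add: qvec.span_zero)
next
  case (step c s x)
  have "s * y \<in> qvec.span U"
    using assms(2)
  proof (induction rule: qvec.span_induct_alt)
    case base
    then show ?case by (simp add: qvec.span_zero)
  next
    case (step d t y)
    have "s * (const d * t + y) = const d * (s * t) + s * y" by (simp add: algebra_simps)
    then show ?case
      using qvec.span_add[OF qvec.span_scale[OF ST[OF \<open>s \<in> S\<close> step(1)], of d] step(2)] by simp
  qed
  moreover have "(const c * s + x) * y = const c * (s * y) + x * y" by (simp add: algebra_simps)
  ultimately show ?case
    using qvec.span_add[OF qvec.span_scale[of "s * y" U c] step(2)] by simp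
qed

definition mprod :: "(nat \<Rightarrow> qpoly) \<Rightarrow> nat multiset \<Rightarrow> qpoly" where
  "mprod f \<mu> = (\<Prod>x\<in>#\<mu>. f x)"

lemma mprod_simps [simp]:
  "mprod f {#} = 1" "mprod f (add_mset x \<mu>) = f x * mprod f \<mu>" "mprod f (\<mu> + \<nu>) = mprod f \<mu> * mprod f \<nu>"
  by (simp_all add: mprod_def)

definition sqs :: "nat multiset \<Rightarrow> nat" where
  "sqs \<mu> = (\<Sum>x\<in>#\<mu>. x * x)"

lemma sqs_simps [simp]:
  "sqs {#} = 0" "sqs (add_mset x \<mu>) = x * x + sqs \<mu>" "sqs (\<mu> + \<nu>) = sqs \<mu> + sqs \<nu>"
  by (simp_all add: sqs_def)

lemma sqs_le: "sqs \<mu> \<le> sum_mset \<mu> * sum_mset \<mu>"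
  by (induction \<mu>) (auto simp: algebra_simps)

text \<open>Multisets with zeros are allowed here; they do no harm as \<open>f 0 = 1\<close> in all applications.\<close>

definition lat :: "(nat \<Rightarrow> qpoly) \<Rightarrow> nat \<Rightarrow> nat \<Rightarrow> qpoly set" where
  "lat f n k = zmod.span {mprod f \<mu> |\<mu>. sum_mset \<mu> = n \<and> k \<le> sqs \<mu>}"

lemma mprod_in_lat: "sum_mset \<mu> = n \<Longrightarrow> k \<le> sqs \<mu> \<Longrightarrow> mprod f \<mu> \<in> lat f n k"
  unfolding lat_def by (intro zmod.span_base) auto

lemma lat_mult: "x \<in> lat f a k \<Longrightarrow> y \<in> lat f b l \<Longrightarrow> x * y \<in> lat f (a + b) (k + l)"
  unfolding lat_def
proof (erule zspan_mult, assumption)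
  fix s t
  assume "s \<in> {mprod f \<mu> |\<mu>. sum_mset \<mu> = a \<and> k \<le> sqs \<mu>}" "t \<in> {mprod f \<mu> |\<mu>. sum_mset \<mu> = b \<and> l \<le> sqs \<mu>}"
  then obtain \<mu> \<nu> where "s = mprod f \<mu>" "t = mprod f \<nu>" "sum_mset (\<mu> + \<nu>) = a + b" "k + l \<le> sqs (\<mu> + \<nu>)"
    by auto
  then have "s * t = mprod f (\<mu> + \<nu>)" by simp
  then show "s * t \<in> zmod.span {mprod f \<mu> |\<mu>. sum_mset \<mu> = a + b \<and> k + l \<le> sqs \<mu>}"
    using \<open>sum_mset (\<mu> + \<nu>) = a + b\<close> \<open>k + l \<le> sqs (\<mu> + \<nu>)\<close> by (intro zmod.span_base) blast
qed

lemma lat_antimono: "k \<le> l \<Longrightarrow> lat f n l \<subseteq> lat f n k"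
  unfolding lat_def by (intro zmod.span_mono) auto

lemma lat_add: "x \<in> lat f n k \<Longrightarrow> y \<in> lat f n k \<Longrightarrow> x + y \<in> lat f n k"
  unfolding lat_def by (rule zmod.span_add)

lemma lat_scale: "x \<in> lat f n k \<Longrightarrow> of_int c * x \<in> lat f n k"
  unfolding lat_def by (rule zmod.span_scale)

lemma lat_sum: "(\<And>i. i \<in> I \<Longrightarrow> f' i \<in> lat f n k) \<Longrightarrow> (\<Sum>i\<in>I. f' i) \<in> lat f n k"
  unfolding lat_def by (rule zmod.span_sum)

lemma lat_one: "1 \<in> lat f 0 0"
  using mprod_in_lat[of "{#}" 0 0 f] by simp

lemma lat_single: "f x \<in> lat f x (x * x)"
  using mprod_in_lat[of "{#x#}" x "x * x" f] by simp

lemma lat_prod_leading: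
  fixes m :: nat
  assumes "\<And>i. i < m \<Longrightarrow> y i \<in> lat f (a i) (k i)" "\<And>i. i < m \<Longrightarrow> x i - y i \<in> lat f (a i) (Suc (k i))"
  shows "(\<Prod>i<m. y i) \<in> lat f (\<Sum>i<m. a i) (\<Sum>i<m. k i)"
    and "(\<Prod>i<m. x i) - (\<Prod>i<m. y i) \<in> lat f (\<Sum>i<m. a i) (Suc (\<Sum>i<m. k i))"
proof -
  have "(\<Prod>i<m. y i) \<in> lat f (\<Sum>i<m. a i) (\<Sum>i<m. k i) \<and>
     (\<Prod>i<m. x i) - (\<Prod>i<m. y i) \<in> lat f (\<Sum>i<m. a i) (Suc (\<Sum>i<m. k i))"
    using assms
  proof (induction m)
    case 0
    then show ?case by (simp add: lat_one) (simp add: lat_def zmod.span_zero)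
  next
    case (Suc m)
    let ?X = "\<Prod>i<m. x i" and ?Y = "\<Prod>i<m. y i" and ?A = "\<Sum>i<m. a i" and ?K = "\<Sum>i<m. k i"
    have IH: "?Y \<in> lat f ?A ?K" "?X - ?Y \<in> lat f ?A (Suc ?K)" using Suc by auto
    have y: "y m \<in> lat f (a m) (k m)" and xy: "x m - y m \<in> lat f (a m) (Suc (k m))"
      using Suc.prems by auto
    have x: "x m \<in> lat f (a m) (k m)"
      using lat_add[OF y subsetD[OF lat_antimono xy]] by simp
    have "?X * x m - ?Y * y m = (?X - ?Y) * x m + ?Y * (x m - y m)"
      by (simp add: algebra_simps)
    moreover have "(?X - ?Y) * x m \<in> lat f (?A + a m) (Suc (?K + k m))"
      using lat_mult[OF IH(2) x] by simp
    moreover have "?Y * (x m - y m) \<in> lat f (?A + a m) (Suc (?K + k m))"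
      using lat_mult[OF IH(1) xy] by simp
    ultimately show ?case using lat_mult[OF IH(1) y] by (simp add: lat_add)
  qed
  then show "(\<Prod>i<m. y i) \<in> lat f (\<Sum>i<m. a i) (\<Sum>i<m. k i)"
    "(\<Prod>i<m. x i) - (\<Prod>i<m. y i) \<in> lat f (\<Sum>i<m. a i) (Suc (\<Sum>i<m. k i))" by auto
qed

lemma half_square_expand:
  "h * ((c * z + y) * (c * z + y)) = c * c * (h * (z * z)) + c * (y * z) * (h * 2) + h * (y * y)"
  for h :: "'a :: comm_ring_1"
  by (simp add: algebra_simps)

lemma const_half: "const (1 / 2) * 2 = 1"
  using const_simps(4)[of "1 / 2" 2] const_of_nat[of 2] const_simps(6) by simp

lemma lat_half_square:
  assumes f: "\<And>x. 0 < x \<Longrightarrow> const (1 / 2) * (f x * f x) \<in> lat f (2 * x) 0"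
    and n: "0 < n" and y: "y \<in> lat f n 0"
  shows "const (1 / 2) * (y * y) \<in> lat f (2 * n) 0"
proof -
  have "y \<in> lat f n 0 \<and> const (1 / 2) * (y * y) \<in> lat f (2 * n) 0"
    using y[unfolded lat_def]
  proof (induction rule: zmod.span_induct_alt)
    case base
    then show ?case by (simp add: lat_def zmod.span_zero)
  next
    case (step c z y)
    from step(1) obtain \<mu> where \<mu>: "z = mprod f \<mu>" "sum_mset \<mu> = n" by auto
    have z: "z \<in> lat f n 0" unfolding \<mu>(1) by (rule mprod_in_lat[OF \<mu>(2)]) simp
    have "\<exists>x\<in>#\<mu>. 0 < x" using \<mu>(2) n by (metis gr0I sum_mset.neutral less_not_refl)
    then obtain x where x0: "x \<in># \<mu>" "0 < x" by (elim bexE)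
    obtain \<nu> where x: "\<mu> = add_mset x \<nu>" using multi_member_split[OF x0(1)] by (elim exE)
    have "mprod f \<nu> \<in> lat f (sum_mset \<nu>) 0" by (rule mprod_in_lat) auto
    from lat_mult[OF f[OF x0(2)] lat_mult[OF this this]]
    have "const (1 / 2) * (f x * f x) * (mprod f \<nu> * mprod f \<nu>) \<in> lat f (2 * x + (sum_mset \<nu> + sum_mset \<nu>)) 0"
      by simp
    moreover have "2 * x + (sum_mset \<nu> + sum_mset \<nu>) = 2 * n"
    proof -
      have "x + sum_mset \<nu> = n" using \<mu>(2) x by simp
      then show ?thesis by linarith
    qed
    moreover have "const (1 / 2) * (f x * f x) * (mprod f \<nu> * mprod f \<nu>) = const (1 / 2) * (z * z)"
      by (simp add: \<mu>(1) x mult_ac)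
    ultimately have zz: "const (1 / 2) * (z * z) \<in> lat f (2 * n) 0" by simp
    have y: "y \<in> lat f n 0" and yy: "const (1 / 2) * (y * y) \<in> lat f (2 * n) 0"
      using step(2) by auto
    have yz: "y * z \<in> lat f (2 * n) 0"
      using lat_mult[OF y z] by (simp add: mult_2)
    have "const (1 / 2) * ((of_int c * z + y) * (of_int c * z + y)) =
        of_int (c * c) * (const (1 / 2) * (z * z)) + of_int c * (y * z) + const (1 / 2) * (y * y)"
      unfolding half_square_expand const_half by simp
    then have "const (1 / 2) * ((of_int c * z + y) * (of_int c * z + y)) \<in> lat f (2 * n) 0"
      using lat_add[OF lat_add[OF lat_scale[OF zz, of "c * c"] lat_scale[OF yz, of c]] yy] by simp
    moreover have "of_int c * z + y \<in> lat f n 0" by (rule lat_add[OF lat_scale[OF z] y])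
    ultimately show ?case by simp
  qed
  then show ?thesis by simp
qed

section \<open>The functions q\<close>

lemma exp_series_mult:
  "Abs_fps (\<lambda>k. const (1 / fact k)) * (Abs_fps (\<lambda>k. const (1 / fact k)) oo - fps_X) = 1"
proof (rule fps_ext)
  fix n
  have "(Abs_fps (\<lambda>k. const (1 / fact k)) * (Abs_fps (\<lambda>k. const (1 / fact k)) oo - fps_X)) $ n =
      (\<Sum>i=0..n. const (1 / fact i) * ((- 1) ^ (n - i) * const (1 / fact (n - i))))"
    by (simp add: fps_mult_nth fps_compose_uminus')
  also have "\<dots> = const (\<Sum>i=0..n. 1 / fact i * ((- 1) ^ (n - i) * (1 / fact (n - i))))"
    by (simp only: const_sum const_simps const_power)
  also have "(\<Sum>i=0..n. 1 / fact i * ((- 1) ^ (n - i) * (1 / fact (n - i)))) = (fps_exp 1 * fps_exp (- 1 :: rat)) $ n"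
    by (simp add: fps_mult_nth)
  also have "fps_exp 1 * fps_exp (- 1 :: rat) = 1"
    by (simp flip: fps_exp_add_mult)
  finally show "(Abs_fps (\<lambda>k. const (1 / fact k)) * (Abs_fps (\<lambda>k. const (1 / fact k)) oo - fps_X)) $ n = 1 $ n"
    by (simp add: const_simps)
qed

lemma q_gen_mult_neg: "q_gen * Abs_fps (\<lambda>n. (- 1) ^ n * q_gen $ n) = 1"
proof -
  define E :: "qpoly fps" where "E = Abs_fps (\<lambda>k. const (1 / fact k))"
  define f :: "qpoly fps" where "f = Abs_fps (\<lambda>j. if odd j then tvar j else 0)"
  have f0: "f $ 0 = 0" by (simp add: f_def)
  have q: "q_gen = E oo f" by (simp add: q_gen_def E_def f_def)
  have fX: "f oo - fps_X = (- fps_X) oo f"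
  proof -
    have "f oo - fps_X = - f" by (rule fps_ext) (simp add: fps_compose_uminus' f_def)
    also have "\<dots> = (- fps_X) oo f"
      using f0 by (simp add: fps_compose_uminus fps_X_fps_compose_startby0)
    finally show ?thesis .
  qed
  have "Abs_fps (\<lambda>n. (- 1) ^ n * q_gen $ n) = q_gen oo - fps_X"
    by (simp add: fps_compose_uminus')
  also have "\<dots> = E oo (f oo - fps_X)"
    unfolding q by (rule fps_compose_assoc[symmetric]) (simp_all add: f0)
  also have "\<dots> = (E oo - fps_X) oo f"
    unfolding fX by (rule fps_compose_assoc) (simp_all add: f0)
  finally have "q_gen * Abs_fps (\<lambda>n. (- 1) ^ n * q_gen $ n) = (E * (E oo - fps_X)) oo f"
    unfolding q by (simp add: fps_compose_mult_distrib[OF f0])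
  then show ?thesis by (simp add: E_def exp_series_mult)
qed

lemma q_fun_0: "q_fun 0 = 1"
  by (simp add: q_fun_def q_gen_def const_simps)

lemma q_fun_relation:
  assumes "0 < m" shows "(\<Sum>i=0..m. (- 1) ^ i * (q_fun (m - i) * q_fun i)) = 0"
proof -
  have "(q_gen * Abs_fps (\<lambda>n. (- 1) ^ n * q_gen $ n)) $ m = 0"
    using assms by (simp add: q_gen_mult_neg)
  then have "(\<Sum>i=0..m. q_fun i * ((- 1) ^ (m - i) * q_fun (m - i))) = 0"
    by (simp add: fps_mult_nth q_fun_def)
  then show ?thesis
    by (subst sum.atLeastAtMost_rev) (simp add: mult_ac)
qed

lemma Q_pair_diag:
  assumes "0 < m" shows "Q_pair m m = 0"
proof -
  let ?g = "\<lambda>i. (- 1) ^ i * (q_fun (2 * m - i) * q_fun i)"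
  let ?h = "\<lambda>j. (- 1) ^ j * q_fun (m + j) * q_fun (m - j)"
  have lower: "(\<Sum>i=0..<m. ?g i) = (- 1) ^ m * (\<Sum>j=1..m. ?h j)"
    unfolding sum_distrib_left
  proof (rule sum.reindex_bij_witness[of _ "\<lambda>j. m - j" "\<lambda>i. m - i"])
    fix i assume i: "i \<in> {0..<m}"
    have e: "(- 1 :: qpoly) ^ m * (- 1) ^ (m - i) = (- 1) ^ i"
    proof -
      have "m + (m - i) = 2 * (m - i) + i" using i by simp
      then have "(- 1 :: qpoly) ^ (m + (m - i)) = (- 1) ^ (2 * (m - i) + i)" by (simp only:)
      then show ?thesis by (simp add: power_add power_mult)
    qed
    have "m + (m - i) = 2 * m - i" "m - (m - i) = i" using i by auto
    then show "(- 1) ^ m * ?h (m - i) = ?g i" by (simp only: mult.assoc flip: e)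
  qed auto
  have upper: "(\<Sum>i=m+1..2*m. ?g i) = (- 1) ^ m * (\<Sum>j=1..m. ?h j)"
    unfolding sum_distrib_left
  proof (rule sum.reindex_bij_witness[of _ "\<lambda>j. m + j" "\<lambda>i. i - m"])
    fix i assume "i \<in> {m+1..2*m}"
    then obtain j where j: "i = m + j" "j \<le> m"
      by (intro that[of "i - m"]) auto
    then show "(- 1) ^ m * ?h (i - m) = ?g i" by (simp add: power_add mult_ac mult_2)
  qed auto
  have U: "{0..2*m} = {0..<m} \<union> insert m {m+1..2*m}" by auto
  have "(\<Sum>i=0..2*m. ?g i) = (\<Sum>i=0..<m. ?g i) + (\<Sum>i\<in>insert m {m+1..2*m}. ?g i)"
    unfolding U by (rule sum.union_disjoint) auto
  also have "(\<Sum>i\<in>insert m {m+1..2*m}. ?g i) = ?g m + (\<Sum>i=m+1..2*m. ?g i)"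
    by (rule sum.insert) simp_all
  finally have "(\<Sum>i=0..2*m. ?g i) = (\<Sum>i=0..<m. ?g i) + (?g m + (\<Sum>i=m+1..2*m. ?g i))" .
  also have "\<dots> = (- 1) ^ m * Q_pair m m"
  proof -
    have "?g m = (- 1) ^ m * (q_fun m * q_fun m)" by (simp add: mult_2)
    then show ?thesis unfolding lower upper Q_pair_def by (simp only: distrib_left mult_2 add_ac)
  qed
  finally have "(- 1 :: qpoly) ^ m * Q_pair m m = 0"
    using q_fun_relation[of "2 * m"] assms by simp
  then show ?thesis by simp
qed

lemma Q_pair_leading:
  assumes "s \<le> r" shows "Q_pair r s - q_fun r * q_fun s \<in> lat q_fun (r + s) (Suc (r * r + s * s))"
proof -
  have "(- 1) ^ i * q_fun (r + i) * q_fun (s - i) \<in> lat q_fun (r + s) (Suc (r * r + s * s))" if i: "i \<in> {1..s}" for i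
  proof -
    obtain j where j: "s = i + j" using i le_Suc_ex[of i s] by auto
    have "Suc (r * r + s * s) \<le> (r + i) * (r + i) + (s - i) * (s - i)"
    proof -
      have "s * i \<le> r * i" using assms by simp
      moreover have "1 \<le> i * i" using i by (cases i) auto
      moreover have "s * s = i * i + 2 * (i * j) + j * j" "s * i = i * i + i * j"
        by (simp_all add: j algebra_simps)
      moreover have "(r + i) * (r + i) = r * r + 2 * (r * i) + i * i" by (simp add: algebra_simps)
      moreover have "s - i = j" by (simp add: j)
      ultimately show ?thesis by (simp only:)
    qed
    then have "q_fun (r + i) * q_fun (s - i) \<in> lat q_fun (r + s) (Suc (r * r + s * s))"
      using mprod_in_lat[of "{#r + i, s - i#}" "r + s" _ q_fun] i by simp
    from lat_scale[OF this, of "(- 1) ^ i"] show ?thesis by (simp add: mult.assoc)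
  qed
  then have "of_int 2 * (\<Sum>i=1..s. (- 1) ^ i * q_fun (r + i) * q_fun (s - i)) \<in> lat q_fun (r + s) (Suc (r * r + s * s))"
    by (intro lat_scale lat_sum)
  then show ?thesis by (simp add: Q_pair_def)
qed

lemma q_fun_half_square:
  assumes "0 < x" shows "const (1 / 2) * (q_fun x * q_fun x) \<in> lat q_fun (2 * x) 0"
proof -
  let ?S = "\<Sum>i=1..x. (- 1) ^ i * q_fun (x + i) * q_fun (x - i)"
  have "q_fun x * q_fun x = - (2 * ?S)"
    using Q_pair_diag[OF assms] by (simp add: Q_pair_def eq_neg_iff_add_eq_0)
  then have "const (1 / 2) * (q_fun x * q_fun x) = - (const (1 / 2) * 2 * ?S)" by (simp add: mult.assoc)
  also have "const (1 / 2) * 2 = 1" by (rule const_half)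
  also have "- (1 * ?S) = of_int (- 1) * ?S" by simp
  finally have eq: "const (1 / 2) * (q_fun x * q_fun x) = of_int (- 1) * ?S" .
  show ?thesis unfolding eq
  proof (intro lat_scale lat_sum)
    fix i assume i: "i \<in> {1..x}"
    have "q_fun (x + i) * q_fun (x - i) \<in> lat q_fun (2 * x) 0"
      using mprod_in_lat[of "{#x + i, x - i#}" "2 * x" 0 q_fun] i by simp
    from lat_scale[OF this, of "(- 1) ^ i"]
    show "(- 1) ^ i * q_fun (x + i) * q_fun (x - i) \<in> lat q_fun (2 * x) 0" by (simp add: mult.assoc)
  qed
qed

lemma mprod_q_fun_repeated:
  assumes "0 < x" shows "mprod q_fun (add_mset x (add_mset x \<mu>)) \<in>
    lat q_fun (2 * x + sum_mset \<mu>) (Suc (sqs (add_mset x (add_mset x \<mu>))))"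
proof -
  have "q_fun x * q_fun x = of_int (- 1) * (Q_pair x x - q_fun x * q_fun x)"
    using Q_pair_diag[OF assms] by simp
  then have "q_fun x * q_fun x \<in> lat q_fun (x + x) (Suc (x * x + x * x))"
    using lat_scale[OF Q_pair_leading[OF order.refl, of x], of "- 1"] by simp
  from lat_mult[OF this mprod_in_lat[OF refl order.refl, where \<mu> = \<mu> and f = q_fun]]
  show ?thesis by (simp add: mult_2 mult.assoc add_ac)
qed

section \<open>Schur Q-functions and the lattice of q-products\<close>

definition matchings :: "nat \<Rightarrow> (nat \<Rightarrow> nat) set" where
  "matchings m = {\<sigma>. \<sigma> permutes {..<2 * m} \<and>
       (\<forall>i<m. \<sigma> (2 * i) < \<sigma> (2 * i + 1)) \<and>
       (\<forall>i<m. \<forall>j<m. i < j \<longrightarrow> \<sigma> (2 * i) < \<sigma> (2 * j))}"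

lemma matchingsD:
  assumes "\<sigma> \<in> matchings m"
  shows "\<sigma> permutes {..<2 * m}" "i < m \<Longrightarrow> \<sigma> (2 * i) < \<sigma> (2 * i + 1)"
    "i < j \<Longrightarrow> j < m \<Longrightarrow> \<sigma> (2 * i) < \<sigma> (2 * j)"
  using assms unfolding matchings_def by (blast dest: order.strict_trans)+

lemma finite_matchings: "finite (matchings m)"
  by (rule finite_subset[OF _ finite_Sym[of "2 * m"]]) (auto simp: matchings_def)

lemma matching_fixed_prefix:
  assumes \<sigma>: "\<sigma> \<in> matchings m" and pre: "\<forall>j<2 * k. \<sigma> j = j" and k: "k < m"
  shows "\<sigma> (2 * k) = 2 * k"
    and "\<sigma> (2 * k + 1) \<noteq> 2 * k + 1 \<Longrightarrow> k + 1 < m \<and> \<sigma> (2 * k + 2) = 2 * k + 1"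
proof -
  note perm = matchingsD(1)[OF \<sigma>] and lt = matchingsD(2)[OF \<sigma>] and mono = matchingsD(3)[OF \<sigma>]
  have ge: "2 * k \<le> \<sigma> p" if "2 * k \<le> p" for p
  proof (rule ccontr)
    assume "\<not> 2 * k \<le> \<sigma> p"
    then have "\<sigma> (\<sigma> p) = \<sigma> p" using pre by simp
    then have "\<sigma> p = p" using permutes_inj[OF perm] by (auto dest: injD)
    with that \<open>\<not> _\<close> show False by simp
  qed
  have ex: "\<exists>p. 2 * k \<le> p \<and> p < 2 * m \<and> \<sigma> p = v" if "2 * k \<le> v" "v < 2 * m" for v
  proof -
    have "v \<in> \<sigma> ` {..<2 * m}" unfolding permutes_image[OF perm] using that by simp
    then obtain p where p: "p < 2 * m" "\<sigma> p = v" by auto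
    have "2 * k \<le> p" using pre p(2) that(1) by (cases "p < 2 * k") auto
    with p show ?thesis by blast
  qed
  have "2 * k < 2 * m" using k by simp
  then obtain p where p: "2 * k \<le> p" "p < 2 * m" "\<sigma> p = 2 * k" using ex[of "2 * k"] by auto
  have "even p"
  proof (rule ccontr)
    assume "odd p"
    then obtain i where i: "p = 2 * i + 1" by (rule oddE)
    then have "k \<le> i" "i < m" using p by auto
    then have "\<sigma> (2 * i) < 2 * k" "2 * k \<le> \<sigma> (2 * i)" using lt[of i] ge[of "2 * i"] i p(3) by auto
    then show False by simp
  qed
  then obtain i where i: "p = 2 * i" by (rule evenE)
  then have ki: "k \<le> i" "i < m" using p by auto
  have "\<not> k < i" using mono[of k i] ge[of "2 * k"] ki(2) i p(3) by auto
  then show 2: "\<sigma> (2 * k) = 2 * k" using i ki p(3) by auto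
  assume ne: "\<sigma> (2 * k + 1) \<noteq> 2 * k + 1"
  have ge': "2 * k + 1 \<le> \<sigma> p" if "2 * k + 1 \<le> p" for p
  proof -
    have "\<sigma> p \<noteq> 2 * k" using 2 permutes_inj[OF perm] that by (metis injD not_less_eq_eq Suc_eq_plus1 order.refl)
    then show ?thesis using ge[of p] that by simp
  qed
  have "2 * k + 1 < 2 * m" using k by simp
  then obtain p where p: "2 * k \<le> p" "p < 2 * m" "\<sigma> p = 2 * k + 1" using ex[of "2 * k + 1"] by auto
  have "p \<noteq> 2 * k" using 2 p(3) by auto
  moreover have "p \<noteq> 2 * k + 1" using ne p(3) by auto
  ultimately have p2: "2 * k + 2 \<le> p" using p(1) by simp
  have "even p"
  proof (rule ccontr)
    assume "odd p"
    then obtain i where i: "p = 2 * i + 1" by (rule oddE)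
    then have "i < m" "2 * k + 1 \<le> 2 * i" using p2 p(2) by auto
    then have "\<sigma> (2 * i) < 2 * k + 1" "2 * k + 1 \<le> \<sigma> (2 * i)" using lt[of i] ge'[of "2 * i"] i p(3) by auto
    then show False by simp
  qed
  then obtain i where i: "p = 2 * i" by (rule evenE)
  then have ki: "k + 1 \<le> i" "i < m" using p2 p(2) by auto
  have "\<not> k + 1 < i"
  proof
    assume "k + 1 < i"
    then have "\<sigma> (2 * (k + 1)) < \<sigma> (2 * i)" using mono ki(2) by blast
    moreover have "2 * k + 1 \<le> \<sigma> (2 * (k + 1))" by (rule ge') simp
    ultimately show False using i p(3) by simp
  qed
  then have "i = k + 1" using ki by simp
  then show "k + 1 < m \<and> \<sigma> (2 * k + 2) = 2 * k + 1" using ki i p(3) by simp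
qed

text \<open>The sum is the Pfaffian of the skew-symmetric matrix with all entries above the diagonal
  equal to \<open>1\<close>. Matchings that do not pair the two smallest free points cancel by exchanging the
  partners of these two points.\<close>

lemma sum_sign_matchings: "(\<Sum>\<sigma>\<in>matchings m. sign \<sigma>) = 1"
proof -
  define A where "A k = {\<sigma> \<in> matchings m. \<forall>j<2 * k. \<sigma> j = j}" for k
  have finA: "finite (A k)" for k unfolding A_def by (rule finite_subset[OF _ finite_matchings]) auto
  have step: "(\<Sum>\<sigma>\<in>A k. sign \<sigma>) = (\<Sum>\<sigma>\<in>A (Suc k). sign \<sigma>)" if k: "k < m" for k
  proof -
    let ?B = "{\<sigma> \<in> A k. \<sigma> (2 * k + 1) \<noteq> 2 * k + 1}"
    let ?t = "Transposition.transpose (2 * k + 1) (2 * k + 3)"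
    let ?f = "\<lambda>\<sigma>. \<sigma> \<circ> ?t"
    have sub: "A (Suc k) \<subseteq> A k" by (auto simp: A_def)
    have diff: "A k - A (Suc k) = ?B"
    proof (intro equalityI subsetI)
      fix \<sigma> assume s: "\<sigma> \<in> A k - A (Suc k)"
      then have \<sigma>: "\<sigma> \<in> matchings m" "\<forall>j<2 * k. \<sigma> j = j" by (auto simp: A_def)
      have "\<sigma> (2 * k) = 2 * k" by (rule matching_fixed_prefix(1)[OF \<sigma> k])
      then have "\<sigma> (2 * k + 1) = 2 * k + 1 \<Longrightarrow> \<sigma> \<in> A (Suc k)"
        using \<sigma> by (auto simp: A_def less_Suc_eq)
      with s show "\<sigma> \<in> ?B" by auto
    next
      fix \<sigma> assume "\<sigma> \<in> ?B"
      then show "\<sigma> \<in> A k - A (Suc k)" by (auto simp: A_def)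
    qed
    have fB: "?f \<sigma> \<in> ?B \<and> sign (?f \<sigma>) = - sign \<sigma>" if B: "\<sigma> \<in> ?B" for \<sigma>
    proof -
      have \<sigma>: "\<sigma> \<in> matchings m" "\<forall>j<2 * k. \<sigma> j = j" and ne: "\<sigma> (2 * k + 1) \<noteq> 2 * k + 1"
        using B by (auto simp: A_def)
      note perm = matchingsD(1)[OF \<sigma>(1)]
      have s0: "\<sigma> (2 * k) = 2 * k" and k1: "k + 1 < m" and s2: "\<sigma> (2 * k + 2) = 2 * k + 1"
        using matching_fixed_prefix[OF \<sigma> k] ne by auto
      have lt1: "2 * k + 1 < \<sigma> (2 * k + 1)" using matchingsD(2)[OF \<sigma>(1) k] s0 ne by simp
      have lt3: "2 * k + 1 < \<sigma> (2 * k + 3)"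
        using matchingsD(2)[OF \<sigma>(1) k1] s2 by (simp add: numeral_3_eq_3)
      have tp: "?t permutes {..<2 * m}" using k1 by (intro permutes_swap_id) auto
      have fp: "?f \<sigma> permutes {..<2 * m}" by (rule permutes_compose[OF tp perm])
      have ev: "?t (2 * i) = 2 * i" for i
        unfolding transpose_def by (auto; presburger)
      have odd: "?t (2 * i + 1) = (if i = k then 2 * k + 3 else if i = k + 1 then 2 * k + 1 else 2 * i + 1)" for i
        unfolding transpose_def by auto
      have "?f \<sigma> (2 * i) < ?f \<sigma> (2 * i + 1)" if "i < m" for i
        using matchingsD(2)[OF \<sigma>(1) that] s0 s2 lt1 lt3 by (auto simp: ev odd[simplified] simp del: Suc_eq_plus1)
      moreover have "?f \<sigma> (2 * i) < ?f \<sigma> (2 * j)" if "i < j" "j < m" for i j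
        using matchingsD(3)[OF \<sigma>(1) that] by (simp only: comp_apply ev)
      ultimately have "?f \<sigma> \<in> matchings m" using fp by (simp add: matchings_def)
      moreover have "\<forall>j<2 * k. ?f \<sigma> j = j" using \<sigma>(2) by (simp add: transpose_def)
      moreover have "?f \<sigma> (2 * k + 1) \<noteq> 2 * k + 1" using lt3 by simp
      moreover have "sign (?f \<sigma>) = - sign \<sigma>"
      proof -
        have "permutation \<sigma>" by (rule permutes_imp_permutation[OF _ perm]) simp
        then have "sign (?f \<sigma>) = sign \<sigma> * sign ?t"
          by (rule sign_compose[OF _ permutation_swap_id])
        then show ?thesis by (simp add: sign_swap_id)
      qed
      ultimately show ?thesis by (simp add: A_def)
    qed
    have inv: "?f (?f \<sigma>) = \<sigma>" for \<sigma> :: "nat \<Rightarrow> nat"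
      by (rule ext) simp
    have mB: "?f \<sigma> \<in> ?B" if "\<sigma> \<in> ?B" for \<sigma>
      by (rule conjunct1[OF fB[OF that]])
    have sB: "- sign (?f \<sigma>) = sign \<sigma>" if "\<sigma> \<in> ?B" for \<sigma>
      unfolding conjunct2[OF fB[OF that]] by (rule minus_minus)
    have "(\<Sum>\<sigma>\<in>?B. sign \<sigma>) = (\<Sum>\<sigma>\<in>?B. - sign \<sigma>)"
      by (rule sum.reindex_bij_witness[of _ ?f ?f])
        (rule inv, erule mB, rule inv, erule mB, erule sB)
    then have "(\<Sum>\<sigma>\<in>?B. sign \<sigma>) = 0" by (simp add: sum_negf)
    then show ?thesis using sum.subset_diff[OF sub finA, of sign] unfolding diff by simp
  qed
  have "(\<Sum>\<sigma>\<in>A 0. sign \<sigma>) = (\<Sum>\<sigma>\<in>A k. sign \<sigma>)" if "k \<le> m" for k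
    using that by (induction k) (auto simp: step)
  then have "(\<Sum>\<sigma>\<in>A 0. sign \<sigma>) = (\<Sum>\<sigma>\<in>A m. sign \<sigma>)" by simp
  moreover have "A 0 = matchings m" by (simp add: A_def)
  moreover have "A m = {id}"
  proof (intro equalityI subsetI)
    fix \<sigma> assume "\<sigma> \<in> A m"
    then have s: "\<sigma> permutes {..<2 * m}" "\<And>j. j < 2 * m \<Longrightarrow> \<sigma> j = j"
      using matchingsD(1) by (auto simp: A_def)
    have "\<sigma> = id"
    proof
      fix j show "\<sigma> j = id j"
        using s(2)[of j] permutes_not_in[OF s(1), of j] by (cases "j < 2 * m") auto
    qed
    then show "\<sigma> \<in> {id}" by simp
  qed (auto simp: A_def matchings_def permutes_id)
  ultimately show ?thesis by simp
qed

lemma sum_pairs: "(\<Sum>j<2 * m. h j) = (\<Sum>i<m. h (2 * i) + h (2 * i + 1))"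
  for h :: "nat \<Rightarrow> 'a :: comm_monoid_add"
  by (induction m) (simp_all add: add_ac)

lemma prod_pairs: "(\<Prod>j<2 * m. h j) = (\<Prod>i<m. h (2 * i) * h (2 * i + 1))"
  for h :: "nat \<Rightarrow> 'a :: comm_monoid_mult"
  by (induction m) (simp_all add: mult_ac)

lemma sum_list_nth: "(\<Sum>x\<in>#mset ls. h x) = (\<Sum>j<length ls. h (ls ! j))"
  by (simp add: sum_mset_sum_list sum_list_sum_nth atLeast0LessThan flip: mset_map)

lemma mprod_nth: "mprod h (mset ls) = (\<Prod>j<length ls. h (ls ! j))"
  by (induction ls rule: rev_induct) (simp_all add: nth_append mult.commute cong: prod.cong_simp)

lemma schur_Q_leading:
  assumes "sum_mset \<alpha> = n"
  shows "schur_Q \<alpha> - mprod q_fun \<alpha> \<in> lat q_fun n (Suc (sqs \<alpha>))"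
proof -
  define ls where "ls = parts_list \<alpha> @ (if odd (size \<alpha>) then [0] else [])"
  define m where "m = length ls div 2"
  have len: "length ls = 2 * m" by (auto simp: ls_def m_def)
  have mls: "mset ls = (if odd (size \<alpha>) then add_mset 0 \<alpha> else \<alpha>)" by (simp add: ls_def)
  have dec: "ls ! j \<le> ls ! i" if "i < j" "j < 2 * m" for i j
  proof -
    have "sorted (rev ls)" by (auto simp: ls_def parts_list_def sorted_append)
    then show ?thesis using sorted_rev_nth_mono[of ls i j] that len by simp
  qed
  have schur: "schur_Q \<alpha> = (\<Sum>\<sigma>\<in>matchings m. of_int (sign \<sigma>) * (\<Prod>i<m. Q_pair (ls ! \<sigma> (2 * i)) (ls ! \<sigma> (2 * i + 1))))"
    unfolding schur_Q_def Let_def pfaffian_def matchings_def ls_def[symmetric] m_def ..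
  have trm: "(\<Prod>i<m. Q_pair (ls ! \<sigma> (2 * i)) (ls ! \<sigma> (2 * i + 1))) - mprod q_fun \<alpha> \<in> lat q_fun n (Suc (sqs \<alpha>))"
    if \<sigma>: "\<sigma> \<in> matchings m" for \<sigma>
  proof -
    note perm = matchingsD(1)[OF \<sigma>]
    let ?y = "\<lambda>i. q_fun (ls ! \<sigma> (2 * i)) * q_fun (ls ! \<sigma> (2 * i + 1))"
    let ?a = "\<lambda>i. ls ! \<sigma> (2 * i) + ls ! \<sigma> (2 * i + 1)"
    let ?k = "\<lambda>i. ls ! \<sigma> (2 * i) * ls ! \<sigma> (2 * i) + ls ! \<sigma> (2 * i + 1) * ls ! \<sigma> (2 * i + 1)"
    have y: "?y i \<in> lat q_fun (?a i) (?k i)" for i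
      by (rule lat_mult[OF lat_single lat_single])
    have x: "Q_pair (ls ! \<sigma> (2 * i)) (ls ! \<sigma> (2 * i + 1)) - ?y i \<in> lat q_fun (?a i) (Suc (?k i))" if "i < m" for i
    proof -
      have "\<sigma> (2 * i + 1) < 2 * m" using permutes_in_image[OF perm, of "2 * i + 1"] that by simp
      then show ?thesis by (intro Q_pair_leading dec matchingsD(2)[OF \<sigma> that])
    qed
    have "(\<Sum>i<m. ?a i) = (\<Sum>j<2 * m. ls ! \<sigma> j)" by (rule sum_pairs[symmetric])
    also have "\<dots> = (\<Sum>j<2 * m. ls ! j)" using sum.permute[OF perm, of "(!) ls"] by (simp add: comp_def)
    also have "\<dots> = n" using sum_list_nth[of "\<lambda>x. x" ls] len assms mls by (auto split: if_splits)
    finally have a: "(\<Sum>i<m. ?a i) = n" .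
    have "(\<Sum>i<m. ?k i) = (\<Sum>j<2 * m. ls ! \<sigma> j * ls ! \<sigma> j)" by (rule sum_pairs[symmetric])
    also have "\<dots> = (\<Sum>j<2 * m. ls ! j * ls ! j)"
      using sum.permute[OF perm, of "\<lambda>j. ls ! j * ls ! j"] by (simp add: comp_def)
    also have "\<dots> = sqs \<alpha>"
      using sum_list_nth[of "\<lambda>x. x * x" ls] len mls by (auto simp: sqs_def split: if_splits)
    finally have k: "(\<Sum>i<m. ?k i) = sqs \<alpha>" .
    have "(\<Prod>i<m. ?y i) = (\<Prod>j<2 * m. q_fun (ls ! \<sigma> j))" by (rule prod_pairs[symmetric])
    also have "\<dots> = (\<Prod>j<2 * m. q_fun (ls ! j))"
      using prod.permute[OF perm, of "\<lambda>j. q_fun (ls ! j)"] by (simp add: comp_def)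
    also have "\<dots> = mprod q_fun \<alpha>"
      using mprod_nth[of q_fun ls] len mls by (auto simp: q_fun_0 split: if_splits)
    finally have p: "(\<Prod>i<m. ?y i) = mprod q_fun \<alpha>" .
    show ?thesis
      using lat_prod_leading(2)[of m ?y q_fun ?a ?k, OF y x] unfolding a k p by blast
  qed
  have "schur_Q \<alpha> - mprod q_fun \<alpha> = schur_Q \<alpha> - of_int (\<Sum>\<sigma>\<in>matchings m. sign \<sigma>) * mprod q_fun \<alpha>"
    by (simp add: sum_sign_matchings)
  also have "\<dots> = (\<Sum>\<sigma>\<in>matchings m. of_int (sign \<sigma>) *
      ((\<Prod>i<m. Q_pair (ls ! \<sigma> (2 * i)) (ls ! \<sigma> (2 * i + 1))) - mprod q_fun \<alpha>))"
    unfolding schur by (simp only: of_int_sum sum_distrib_right right_diff_distrib sum_subtractf)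
  also have "\<dots> \<in> lat q_fun n (Suc (sqs \<alpha>))"
    by (intro lat_sum lat_scale trm)
  finally show ?thesis .
qed

definition strict_partitions :: "nat \<Rightarrow> partition set" where
  "strict_partitions n = {\<alpha> \<in> partitions n. \<forall>x. count \<alpha> x \<le> 1}"

lemma schur_Q_in_lat: "sum_mset \<alpha> = n \<Longrightarrow> schur_Q \<alpha> \<in> lat q_fun n 0"
  using lat_add[OF subsetD[OF lat_antimono schur_Q_leading[of \<alpha> n]] mprod_in_lat[of \<alpha> n 0 q_fun]] by simp

lemma filter_nonzero_mset:
  fixes \<mu> :: "nat multiset"
  defines "\<mu>' \<equiv> filter_mset (\<lambda>x. x \<noteq> 0) \<mu>"
  shows "sum_mset \<mu>' = sum_mset \<mu>" "sqs \<mu>' = sqs \<mu>" "f 0 = 1 \<Longrightarrow> mprod f \<mu>' = mprod f \<mu>"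
    "0 \<notin># \<mu>'" "size \<mu>' \<le> size \<mu>"
  unfolding \<mu>'_def by (induction \<mu>) (auto intro: le_SucI)

lemma repeated_or_strict:
  "(\<forall>x. count \<mu> x \<le> 1) \<or> (\<exists>x \<nu>. \<mu> = add_mset x (add_mset x \<nu>))"
proof (cases "\<forall>x. count \<mu> x \<le> 1")
  case False
  then obtain x where "\<not> count \<mu> x \<le> 1" by blast
  then have x: "2 \<le> count \<mu> x" by simp
  then have "x \<in># \<mu>" by (simp flip: count_greater_zero_iff)
  from multi_member_split[OF this] obtain \<nu> where \<nu>: "\<mu> = add_mset x \<nu>" ..
  with x have "x \<in># \<nu>" by (simp flip: count_greater_zero_iff)
  from multi_member_split[OF this] obtain \<kappa> where "\<nu> = add_mset x \<kappa>" ..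
  then show ?thesis using \<nu> by (intro disjI2 exI[of _ x] exI[of _ \<kappa>]) (simp only:)
qed simp

lemma lat_q_fun_subset: "lat q_fun n k \<subseteq> zmod.span (schur_Q ` strict_partitions n)"
proof (induction "Suc (n * n) - k" arbitrary: k)
  case 0
  have e: "{mprod q_fun \<mu> |\<mu>. sum_mset \<mu> = n \<and> k \<le> sqs \<mu>} = {}"
  proof -
    have "sqs \<mu> < k" if "sum_mset \<mu> = n" for \<mu> using sqs_le[of \<mu>] that 0 by simp
    then show ?thesis by (auto simp: not_le)
  qed
  show ?case unfolding lat_def e zmod.span_empty by (simp add: zmod.span_zero)
next
  case (Suc d)
  have IH: "lat q_fun n (Suc k) \<subseteq> zmod.span (schur_Q ` strict_partitions n)"
    by (rule Suc.hyps(1)) (use Suc.hyps(2) in simp)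
  have "mprod q_fun \<mu> \<in> zmod.span (schur_Q ` strict_partitions n)" if \<mu>: "sum_mset \<mu> = n" "k \<le> sqs \<mu>" for \<mu>
  proof -
    define \<mu>' where "\<mu>' = filter_mset (\<lambda>x. x \<noteq> 0) \<mu>"
    note filter = filter_nonzero_mset[where \<mu> = \<mu>, folded \<mu>'_def]
    have m: "mprod q_fun \<mu>' = mprod q_fun \<mu>" by (rule filter(3)[where f = q_fun, OF q_fun_0])
    have le: "lat q_fun n (Suc (sqs \<mu>')) \<subseteq> lat q_fun n (Suc k)"
      by (rule lat_antimono) (use filter(2) \<mu>(2) in simp)
    from repeated_or_strict[of \<mu>'] show ?thesis
    proof
      assume "\<forall>x. count \<mu>' x \<le> 1"
      then have sp: "\<mu>' \<in> strict_partitions n"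
        using filter(1,4) \<mu>(1) by (simp add: strict_partitions_def partitions_def)
      have "schur_Q \<mu>' - mprod q_fun \<mu>' \<in> zmod.span (schur_Q ` strict_partitions n)"
        by (rule subsetD[OF IH], rule subsetD[OF le], rule schur_Q_leading) (simp only: filter(1) \<mu>(1))
      from zmod.span_diff[OF zmod.span_base[OF imageI[OF sp]] this]
      show ?thesis by (simp add: m)
    next
      assume "\<exists>x \<nu>. \<mu>' = add_mset x (add_mset x \<nu>)"
      then obtain x \<nu> where x: "\<mu>' = add_mset x (add_mset x \<nu>)" by blast
      then have "0 < x" using filter(4) by (cases x) simp_all
      moreover have "2 * x + sum_mset \<nu> = n" using filter(1) \<mu>(1) x by simp
      ultimately have "mprod q_fun \<mu>' \<in> lat q_fun n (Suc (sqs \<mu>'))"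
        using mprod_q_fun_repeated[of x \<nu>] unfolding x by (simp only:)
      then have "mprod q_fun \<mu>' \<in> zmod.span (schur_Q ` strict_partitions n)"
        by (rule subsetD[OF order.trans[OF le IH]])
      then show ?thesis by (simp only: m)
    qed
  qed
  then show ?case
    unfolding lat_def by (intro zmod.span_minimal zmod.subspace_span) auto
qed

lemma span_schur_Q: "zmod.span (schur_Q ` strict_partitions n) = lat q_fun n 0"
proof
  show "zmod.span (schur_Q ` strict_partitions n) \<subseteq> lat q_fun n 0"
  proof (rule zmod.span_minimal)
    show "schur_Q ` strict_partitions n \<subseteq> lat q_fun n 0"
      by (auto simp: strict_partitions_def partitions_def intro: schur_Q_in_lat)
    show "zmod.subspace (lat q_fun n 0)" unfolding lat_def by (rule zmod.subspace_span)
  qed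
qed (rule lat_q_fun_subset)

text \<open>Modulo decomposables \<open>q\<^bsub>2m\<^esub>\<close> is \<open>\<plusminus> q\<^bsub>m\<^esub>\<^sup>2 / 2\<close>; iterating this produces the generator below from
  the function \<open>q\<close> of the odd part of the index.\<close>

definition odd_part :: "nat \<Rightarrow> nat" where "odd_part x = x div 2 ^ multiplicity 2 x"
definition two_part :: "nat \<Rightarrow> nat" where "two_part x = 2 ^ multiplicity 2 x"

definition div_pow :: "nat \<Rightarrow> qpoly" where
  "div_pow x = const (1 / 2 ^ (two_part x - 1)) * q_fun (odd_part x) ^ two_part x"

lemma two_part_odd_part: "two_part x * odd_part x = x"
  by (simp add: two_part_def odd_part_def multiplicity_dvd)

lemma two_part_pos: "0 < two_part x" by (simp add: two_part_def)

lemma odd_odd_part: "0 < x \<Longrightarrow> odd (odd_part x)"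
  unfolding odd_part_def using multiplicity_decompose[of x 2] by simp

lemma parts_odd: "odd x \<Longrightarrow> two_part x = 1" "odd x \<Longrightarrow> odd_part x = x" "two_part 0 = 1" "odd_part 0 = 0"
  by (simp_all add: two_part_def odd_part_def not_dvd_imp_multiplicity_0)

lemma parts_double: "0 < x \<Longrightarrow> two_part (2 * x) = 2 * two_part x" "0 < x \<Longrightarrow> odd_part (2 * x) = odd_part x"
  by (simp_all add: two_part_def odd_part_def multiplicity_times_same)

lemma div_pow_odd: "odd x \<Longrightarrow> div_pow x = q_fun x"
  by (simp add: div_pow_def parts_odd const_simps)

lemma div_pow_0: "div_pow 0 = 1"
  by (simp add: div_pow_def parts_odd const_simps q_fun_0)

lemma div_pow_double:
  assumes "0 < x" shows "const (1 / 2) * (div_pow x * div_pow x) = div_pow (2 * x)"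
proof -
  obtain t where t: "two_part x = Suc t" using gr0_implies_Suc[OF two_part_pos[of x]] by (elim exE)
  have regroup: "h * ((a * u) * (a * u)) = (h * (a * a)) * (u * u)" for h a u :: qpoly
    by (simp only: mult_ac)
  have d: "div_pow x = const (1 / 2 ^ t) * q_fun (odd_part x) ^ Suc t"
    unfolding div_pow_def t diff_Suc_1 ..
  have "const (1 / 2) * (div_pow x * div_pow x) =
      (const (1 / 2) * (const (1 / 2 ^ t) * const (1 / 2 ^ t))) * (q_fun (odd_part x) ^ Suc t * q_fun (odd_part x) ^ Suc t)"
    unfolding d by (rule regroup)
  also have "const (1 / 2) * (const (1 / 2 ^ t) * const (1 / 2 ^ t)) = const (1 / 2 ^ (2 * Suc t - 1))"
  proof -
    have "2 * Suc t - 1 = Suc (t + t)" by simp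
    then have "(1 / 2 :: rat) * (1 / 2 ^ t * (1 / 2 ^ t)) = 1 / 2 ^ (2 * Suc t - 1)"
      by (simp only: power_Suc power_add times_divide_times_eq mult_1_left)
    then show ?thesis by (simp only: const_simps(4)[symmetric])
  qed
  also have "q_fun (odd_part x) ^ Suc t * q_fun (odd_part x) ^ Suc t = q_fun (odd_part x) ^ (2 * Suc t)"
    unfolding mult_2 power_add ..
  finally show ?thesis unfolding div_pow_def[of "2 * x"] parts_double[OF assms] t .
qed

lemma lat_subset_generators:
  assumes "\<And>x. f x \<in> lat g x 0" shows "lat f n 0 \<subseteq> lat g n 0"
proof -
  have "mprod f \<mu> \<in> lat g (sum_mset \<mu>) 0" for \<mu>
  proof (induction \<mu>)
    case (add x \<mu>)
    from lat_mult[OF assms[of x] add.IH] show ?case by simp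
  qed (simp add: lat_one)
  then show ?thesis
    unfolding lat_def[of f] by (intro zmod.span_minimal) (auto simp: lat_def)
qed

lemma div_pow_in_lat: "div_pow x \<in> lat q_fun x 0"
proof (induction x rule: less_induct)
  case (less x)
  show ?case
  proof (cases "x = 0 \<or> odd x")
    case True
    then have "div_pow x = q_fun x" by (auto simp: div_pow_odd div_pow_0 q_fun_0)
    then show ?thesis using mprod_in_lat[of "{#x#}" x 0 q_fun] by simp
  next
    case False
    then obtain y where y: "x = 2 * y" "0 < y" by (auto elim: evenE)
    show ?thesis
      using lat_half_square[OF q_fun_half_square y(2) less.IH[of y]] y by (simp add: div_pow_double)
  qed
qed

lemma div_pow_half_square:
  "0 < x \<Longrightarrow> const (1 / 2) * (div_pow x * div_pow x) \<in> lat div_pow (2 * x) 0"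
  using mprod_in_lat[of "{#2 * x#}" "2 * x" 0 div_pow] by (simp add: div_pow_double)

lemma q_fun_in_lat: "q_fun x \<in> lat div_pow x 0"
proof (induction x rule: less_induct)
  case (less x)
  show ?case
  proof (cases "x = 0 \<or> odd x")
    case True
    then have "div_pow x = q_fun x" by (auto simp: div_pow_odd div_pow_0 q_fun_0)
    then show ?thesis using mprod_in_lat[of "{#x#}" x 0 div_pow] by simp
  next
    case False
    then obtain y where y: "x = 2 * y" "0 < y" by (auto elim: evenE)
    have solve: "a + (b + c) = 0 \<Longrightarrow> c = of_int (- 1) * (a + b)" for a b c :: qpoly
    proof -
      assume "a + (b + c) = 0"
      moreover have "c = (a + (b + c)) - (a + b)" by simp
      ultimately show ?thesis by simp
    qed
    let ?h = "\<lambda>i. (- 1) ^ i * q_fun (y + i) * q_fun (y - i)"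
    let ?T = "\<Sum>i=1..<y. ?h i"
    have "{1..y} = insert y {1..<y}" using y(2) by auto
    then have "(\<Sum>i=1..y. ?h i) = ?h y + ?T" by (simp only: sum.insert finite_atLeastLessThan atLeastLessThan_iff) simp
    then have "(\<Sum>i=1..y. ?h i) = ?T + ?h y" by (simp only: add.commute)
    moreover have "?h y = (- 1) ^ y * q_fun x" by (simp add: y(1) q_fun_0 mult_2)
    ultimately have "q_fun y * q_fun y + 2 * (?T + (- 1) ^ y * q_fun x) = 0"
      using Q_pair_diag[OF y(2)] by (simp only: Q_pair_def)
    then have "const (1 / 2) * (q_fun y * q_fun y + 2 * (?T + (- 1) ^ y * q_fun x)) = 0" by simp
    then have "const (1 / 2) * (q_fun y * q_fun y) + (const (1 / 2) * 2) * (?T + (- 1) ^ y * q_fun x) = 0"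
      by (simp only: distrib_left mult.assoc)
    then have "(- 1) ^ y * q_fun x = of_int (- 1) * (const (1 / 2) * (q_fun y * q_fun y) + ?T)"
      unfolding const_half mult_1_left by (rule solve)
    then have "(- 1) ^ y * ((- 1) ^ y * q_fun x) =
        of_int ((- 1) ^ y) * (of_int (- 1) * (const (1 / 2) * (q_fun y * q_fun y) + ?T))" by simp
    moreover have "(- 1) ^ y * ((- 1) ^ y * q_fun x) = q_fun x"
    proof -
      have "(- 1 :: qpoly) ^ y * (- 1) ^ y = 1" by (simp only: power_mult_distrib[symmetric]) simp
      then show ?thesis by (simp only: mult.assoc[symmetric] mult_1_left)
    qed
    moreover have "const (1 / 2) * (q_fun y * q_fun y) \<in> lat div_pow x 0"
      using lat_half_square[OF div_pow_half_square y(2) less.IH[of y]] y by simp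
    moreover have "?T \<in> lat div_pow x 0"
    proof (rule lat_sum)
      fix i assume i: "i \<in> {1..<y}"
      then have "q_fun (y + i) \<in> lat div_pow (y + i) 0" "q_fun (y - i) \<in> lat div_pow (y - i) 0"
        using y by (auto intro: less.IH)
      from lat_scale[OF lat_mult[OF this], of "(- 1) ^ i"] show "?h i \<in> lat div_pow x 0"
        using i y(1) by (simp add: mult.assoc mult_2)
    qed
    ultimately show ?thesis by (simp only: lat_add lat_scale)
  qed
qed

lemma lat_div_pow: "lat div_pow n 0 = lat q_fun n 0"
  using lat_subset_generators[OF div_pow_in_lat] lat_subset_generators[OF q_fun_in_lat] by blast

lemma mprod_div_pow_in_span:
  "mprod div_pow \<mu> \<in> zmod.span (mprod div_pow ` strict_partitions (sum_mset \<mu>))"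
proof (induction "size \<mu>" arbitrary: \<mu> rule: less_induct)
  case less
  define \<mu>' where "\<mu>' = filter_mset (\<lambda>x. x \<noteq> 0) \<mu>"
  note filter = filter_nonzero_mset[where \<mu> = \<mu>, folded \<mu>'_def]
  have m: "mprod div_pow \<mu>' = mprod div_pow \<mu>" by (rule filter(3)[where f = div_pow, OF div_pow_0])
  from repeated_or_strict[of \<mu>'] show ?case
  proof
    assume "\<forall>x. count \<mu>' x \<le> 1"
    then have "\<mu>' \<in> strict_partitions (sum_mset \<mu>)"
      using filter(1,4) by (simp add: strict_partitions_def partitions_def)
    from zmod.span_base[OF imageI[OF this, of "mprod div_pow"]] show ?thesis by (simp only: m)
  next
    assume "\<exists>x \<nu>. \<mu>' = add_mset x (add_mset x \<nu>)"
    then obtain x \<nu> where x: "\<mu>' = add_mset x (add_mset x \<nu>)" by blast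
    then have x0: "0 < x" using filter(4) by (cases x) simp_all
    let ?\<kappa> = "add_mset (2 * x) \<nu>"
    have "size ?\<kappa> < size \<mu>" using filter(5) x by simp
    moreover have s: "sum_mset ?\<kappa> = sum_mset \<mu>" using filter(1) x by simp
    ultimately have IH: "mprod div_pow ?\<kappa> \<in> zmod.span (mprod div_pow ` strict_partitions (sum_mset \<mu>))"
      using less.hyps[of ?\<kappa>] by (simp only:)
    have "of_int 2 * (const (1 / 2) * (div_pow x * div_pow x)) = of_int 2 * div_pow (2 * x)"
      by (simp only: div_pow_double[OF x0])
    moreover have "of_int 2 * (const (1 / 2) * (div_pow x * div_pow x)) = (const (1 / 2) * 2) * (div_pow x * div_pow x)"
      by (simp add: mult_ac)
    ultimately have "div_pow x * div_pow x = of_int 2 * div_pow (2 * x)" unfolding const_half by simp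
    then have "mprod div_pow \<mu>' = of_int 2 * mprod div_pow ?\<kappa>"
      by (simp only: x mprod_simps flip: mult.assoc)
    then show ?thesis using zmod.span_scale[OF IH, of 2] m by simp
  qed
qed

lemma span_div_pow: "zmod.span (mprod div_pow ` strict_partitions n) = lat q_fun n 0"
  unfolding lat_div_pow[symmetric]
proof
  show "zmod.span (mprod div_pow ` strict_partitions n) \<subseteq> lat div_pow n 0"
    unfolding lat_def by (intro zmod.span_mono) (auto simp: strict_partitions_def partitions_def)
  show "lat div_pow n 0 \<subseteq> zmod.span (mprod div_pow ` strict_partitions n)"
    unfolding lat_def using mprod_div_pow_in_span
    by (intro zmod.span_minimal zmod.subspace_span) auto
qed

lemma glaisher_eq: "glaisher \<alpha> = (\<Sum>x\<in>#\<alpha>. replicate_mset (two_part x) (odd_part x))"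
  by (simp add: glaisher_def two_part_def odd_part_def)

lemma glaisher_add [simp]:
  "glaisher {#} = {#}" "glaisher (add_mset x \<alpha>) = replicate_mset (two_part x) (odd_part x) + glaisher \<alpha>"
  by (simp_all add: glaisher_eq)

lemma size_le_glaisher: "size \<alpha> \<le> size (glaisher \<alpha>)"
proof (induction \<alpha>)
  case (add x \<alpha>)
  then show ?case using two_part_pos[of x] by simp
qed simp

lemma mprod_replicate: "mprod f (replicate_mset k x) = f x ^ k"
  by (induction k) simp_all

lemma mprod_div_pow:
  "mprod div_pow \<alpha> = const (1 / 2 ^ (size (glaisher \<alpha>) - size \<alpha>)) * mprod q_fun (glaisher \<alpha>)"
proof (induction \<alpha>)
  case empty
  then show ?case by (simp add: const_simps)
next
  case (add x \<alpha>)
  have "size (glaisher (add_mset x \<alpha>)) - size (add_mset x \<alpha>) = (two_part x - 1) + (size (glaisher \<alpha>) - size \<alpha>)"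
    using two_part_pos[of x] size_le_glaisher[of \<alpha>] by simp
  then have "const (1 / 2 ^ (size (glaisher (add_mset x \<alpha>)) - size (add_mset x \<alpha>))) =
      const (1 / 2 ^ (two_part x - 1)) * const (1 / 2 ^ (size (glaisher \<alpha>) - size \<alpha>))"
    by (simp only: power_add const_simps(4)[symmetric]) simp
  then show ?case by (simp only: mprod_simps glaisher_add mprod_replicate add.IH) (simp only: div_pow_def mult_ac)
qed

section \<open>Monomials and coefficient matrices\<close>

definition ev :: "nat multiset \<Rightarrow> nat \<Rightarrow>\<^sub>0 nat" where
  "ev \<rho> = (\<Sum>x\<in>#\<rho>. Poly_Mapping.single x 1)"

definition tm :: "nat multiset \<Rightarrow> qpoly" where
  "tm \<rho> = Poly_Mapping.single (ev \<rho>) 1"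

lemma coef_ev: "coef (ev \<rho>) j = count \<rho> j"
  by (induction \<rho>) (simp_all add: ev_def lookup_add lookup_single when_def)

lemma ev_eq_iff [simp]: "ev \<rho> = ev \<sigma> \<longleftrightarrow> \<rho> = \<sigma>"
  by (metis coef_ev multiset_eqI)

lemma keys_ev: "Poly_Mapping.keys (ev \<rho>) = set_mset \<rho>"
  by (simp add: set_eq_iff in_keys_iff coef_ev)

lemma tm_add: "tm (\<rho> + \<sigma>) = tm \<rho> * tm \<sigma>"
  by (simp add: tm_def ev_def mult_single)

lemma tm_eq_mprod: "tm \<rho> = mprod tvar \<rho>"
proof (induction \<rho>)
  case empty
  then show ?case by (simp add: tm_def ev_def)
next
  case (add x \<rho>)
  have "tm (add_mset x \<rho>) = tvar x * tm \<rho>"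
    by (simp add: tm_def ev_def tvar_def mult_single)
  with add show ?case by simp
qed

lemma coef_tm: "coef (tm \<rho>) (ev \<sigma>) = (if \<rho> = \<sigma> then 1 else 0)"
  by (simp add: tm_def lookup_single when_def)

lemma coef_const_mult: "coef (const c * p) m = c * coef p m"
  unfolding const_def mult_map_scale_conv_mult[symmetric]
  by (simp add: Poly_Mapping.map.rep_eq when_def)

lemma qspan_image:
  assumes "finite S" "x \<in> qvec.span (g ` S)"
  shows "\<exists>c. x = (\<Sum>\<mu>\<in>S. const (c \<mu>) * g \<mu>)"
  using assms(2)
proof (induction rule: qvec.span_induct_alt)
  case base
  show ?case by (rule exI[of _ "\<lambda>_. 0"]) (simp add: const_simps)
next
  case (step c0 y x)
  from step(1) obtain s where s: "s \<in> S" "y = g s" by auto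
  from step(2) obtain c where c: "x = (\<Sum>\<mu>\<in>S. const (c \<mu>) * g \<mu>)" by (elim exE)
  have "(\<Sum>\<mu>\<in>S. const (c \<mu> + (if \<mu> = s then c0 else 0)) * g \<mu>) =
      (\<Sum>\<mu>\<in>S. const (c \<mu>) * g \<mu>) + (\<Sum>\<mu>\<in>S. if \<mu> = s then const c0 * g s else 0)"
    unfolding sum.distrib[symmetric]
    by (intro sum.cong refl) (simp add: const_simps distrib_right)
  also have "\<dots> = x + const c0 * y" using s assms(1) c by simp
  finally show ?case by (intro exI[of _ "\<lambda>\<mu>. c \<mu> + (if \<mu> = s then c0 else 0)"]) (simp add: add.commute)
qed

lemma zspan_image:
  assumes "finite S" "x \<in> zmod.span (g ` S)"
  shows "\<exists>c. x = (\<Sum>\<mu>\<in>S. of_int (c \<mu>) * g \<mu>)"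
  using assms(2)
proof (induction rule: zmod.span_induct_alt)
  case base
  show ?case by (rule exI[of _ "\<lambda>_. 0"]) simp
next
  case (step c0 y x)
  from step(1) obtain s where s: "s \<in> S" "y = g s" by auto
  from step(2) obtain c where c: "x = (\<Sum>\<mu>\<in>S. of_int (c \<mu>) * g \<mu>)" by (elim exE)
  have "(\<Sum>\<mu>\<in>S. of_int (c \<mu> + (if \<mu> = s then c0 else 0)) * g \<mu>) =
      (\<Sum>\<mu>\<in>S. of_int (c \<mu>) * g \<mu>) + (\<Sum>\<mu>\<in>S. if \<mu> = s then of_int c0 * g s else 0)"
    unfolding sum.distrib[symmetric]
    by (intro sum.cong refl) (simp add: distrib_right)
  also have "\<dots> = x + of_int c0 * y" using s assms(1) c by simp
  finally show ?case by (intro exI[of _ "\<lambda>\<mu>. c \<mu> + (if \<mu> = s then c0 else 0)"]) (simp add: add.commute)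
qed

definition coefmat :: "partition list \<Rightarrow> (partition \<Rightarrow> qpoly) \<Rightarrow> rat mat" where
  "coefmat ps f = mat (length ps) (length ps) (\<lambda>(i, j). coef (f (ps ! i)) (ev (ps ! j)))"

lemma coefmat_carrier [simp]: "coefmat ps f \<in> carrier_mat (length ps) (length ps)"
  by (simp add: coefmat_def)

lemma coefmat_mult:
  assumes A: "A \<in> carrier_mat (length ps) (length ps)"
    and f: "\<And>i. i < length ps \<Longrightarrow> f (ps ! i) = (\<Sum>j<length ps. const (A $$ (i, j)) * g (ps ! j))"
  shows "coefmat ps f = A * coefmat ps g"
proof (rule eq_matI)
  fix i j assume ij: "i < dim_row (A * coefmat ps g)" "j < dim_col (A * coefmat ps g)"
  then have i: "i < length ps" and j: "j < length ps" using A by (simp_all add: coefmat_def)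
  have "coefmat ps f $$ (i, j) = (\<Sum>k<length ps. A $$ (i, k) * coef (g (ps ! k)) (ev (ps ! j)))"
    using i j by (simp add: coefmat_def f lookup_sum coef_const_mult)
  also have "\<dots> = (A * coefmat ps g) $$ (i, j)"
    using i j A by (simp add: coefmat_def scalar_prod_def atLeast0LessThan)
  finally show "coefmat ps f $$ (i, j) = (A * coefmat ps g) $$ (i, j)" .
qed (use A in \<open>simp_all add: coefmat_def\<close>)

text \<open>In the Leibniz formula a permutation \<open>p\<close> with nonzero contribution has \<open>w (p i) \<ge> w (\<beta> i)\<close>
  for all \<open>i\<close>; both sides have the same sum over \<open>i\<close>, so \<open>p = \<beta>\<close>.\<close>

lemma abs_det_triangular:
  fixes A :: "rat mat" and w :: "nat \<Rightarrow> int"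
  assumes A: "A \<in> carrier_mat N N" and \<beta>: "\<beta> permutes {0..<N}"
    and tri: "\<And>i j. i < N \<Longrightarrow> j < N \<Longrightarrow> A $$ (i, j) \<noteq> 0 \<Longrightarrow> j = \<beta> i \<or> w (\<beta> i) < w j"
  shows "\<bar>det A\<bar> = (\<Prod>i<N. \<bar>A $$ (i, \<beta> i)\<bar>)"
proof -
  let ?t = "\<lambda>p. of_int (sign p) * (\<Prod>i=0..<N. A $$ (i, p i))"
  have zero: "?t p = 0" if p: "p permutes {0..<N}" and ne: "p \<noteq> \<beta>" for p
  proof (rule ccontr)
    assume "?t p \<noteq> 0"
    then have "(\<Prod>i=0..<N. A $$ (i, p i)) \<noteq> 0" by auto
    then have nz: "A $$ (i, p i) \<noteq> 0" if "i < N" for i using that by (auto simp: prod_zero_iff)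
    have pl: "p i < N" if "i < N" for i using permutes_in_image[OF p, of i] that by simp
    have le: "w (\<beta> i) \<le> w (p i)" if "i < N" for i using tri[OF that pl[OF that] nz[OF that]] by auto
    have "(\<Sum>i\<in>{0..<N}. w (p i)) = (\<Sum>i\<in>{0..<N}. w (\<beta> i))"
      using sum.permute[OF p, of w] sum.permute[OF \<beta>, of w] by (simp add: comp_def)
    then have eq: "w (\<beta> i) = w (p i)" if "i < N" for i
      using sum_mono_inv[of "\<lambda>i. w (\<beta> i)" "{0..<N}" "\<lambda>i. w (p i)" i] le that by simp
    have "p i = \<beta> i" for i
    proof (cases "i < N")
      case True
      then show ?thesis using tri[OF True pl[OF True] nz[OF True]] eq[OF True] by simp
    next
      case False
      then show ?thesis using permutes_not_in[OF p, of i] permutes_not_in[OF \<beta>, of i] by simp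
    qed
    with ne show False by auto
  qed
  have "det A = (\<Sum>p | p permutes {0..<N}. ?t p)"
    using A by (simp add: det_def)
  also have "\<dots> = (\<Sum>p\<in>{\<beta>}. ?t p)"
    by (rule sum.mono_neutral_right) (use \<beta> zero in \<open>auto simp: finite_permutations\<close>)
  finally have "det A = ?t \<beta>" by simp
  then show ?thesis by (simp add: abs_mult abs_prod sign_def atLeast0LessThan)
qed

locale enumerated =
  fixes n :: nat and ps :: "partition list"
  assumes distinct: "distinct ps" and set_ps: "set ps = partitions n"
begin

lemma nth_mem_partitions: "i < length ps \<Longrightarrow> ps ! i \<in> partitions n"
  unfolding set_ps[symmetric] by simp

lemma abs_det_coefmat_triangular:
  fixes w :: "partition \<Rightarrow> int"
  assumes \<beta>: "bij_betw \<beta> (partitions n) (partitions n)"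
    and tri: "\<And>\<mu>. \<mu> \<in> partitions n \<Longrightarrow>
      f \<mu> - const (d \<mu>) * g (\<beta> \<mu>) \<in> qvec.span (g ` {\<nu> \<in> partitions n. w (\<beta> \<mu>) < w \<nu>})"
  shows "\<bar>det (coefmat ps f)\<bar> = (\<Prod>\<mu>\<in>partitions n. \<bar>d \<mu>\<bar>) * \<bar>det (coefmat ps g)\<bar>"
proof -
  let ?P = "partitions n" and ?N = "length ps"
  let ?S = "\<lambda>\<mu>. {\<nu> \<in> ?P. w (\<beta> \<mu>) < w \<nu>}"
  have fin: "finite (?S \<mu>)" for \<mu> using finite_partitions[of n] by simp
  have \<beta>P: "\<beta> \<mu> \<in> ?P" if "\<mu> \<in> ?P" for \<mu> using bij_betwE[OF \<beta>] that by blast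
  have "\<forall>\<mu>\<in>?P. \<exists>c. f \<mu> - const (d \<mu>) * g (\<beta> \<mu>) = (\<Sum>\<nu>\<in>?S \<mu>. const (c \<nu>) * g \<nu>)"
    by (intro ballI qspan_image[OF fin tri])
  then have "\<exists>c. \<forall>\<mu>\<in>?P. f \<mu> - const (d \<mu>) * g (\<beta> \<mu>) = (\<Sum>\<nu>\<in>?S \<mu>. const (c \<mu> \<nu>) * g \<nu>)"
    by (rule bchoice)
  then obtain c where "\<forall>\<mu>\<in>?P. f \<mu> - const (d \<mu>) * g (\<beta> \<mu>) = (\<Sum>\<nu>\<in>?S \<mu>. const (c \<mu> \<nu>) * g \<nu>)" ..
  note c = bspec[OF this]
  define a where "a \<mu> \<nu> = (if \<nu> = \<beta> \<mu> then d \<mu> else 0) + (if w (\<beta> \<mu>) < w \<nu> then c \<mu> \<nu> else 0)" for \<mu> \<nu>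
  have f: "f \<mu> = (\<Sum>\<nu>\<in>?P. const (a \<mu> \<nu>) * g \<nu>)" if "\<mu> \<in> ?P" for \<mu>
  proof -
    have "(\<Sum>\<nu>\<in>?P. const (a \<mu> \<nu>) * g \<nu>) =
        (\<Sum>\<nu>\<in>?P. if \<nu> = \<beta> \<mu> then const (d \<mu>) * g (\<beta> \<mu>) else 0) +
        (\<Sum>\<nu>\<in>?P. if w (\<beta> \<mu>) < w \<nu> then const (c \<mu> \<nu>) * g \<nu> else 0)"
      unfolding sum.distrib[symmetric]
      by (intro sum.cong refl) (simp add: a_def const_simps distrib_right)
    also have "(\<Sum>\<nu>\<in>?P. if \<nu> = \<beta> \<mu> then const (d \<mu>) * g (\<beta> \<mu>) else 0) = const (d \<mu>) * g (\<beta> \<mu>)"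
      using \<beta>P[OF that] finite_partitions by simp
    also have "(\<Sum>\<nu>\<in>?P. if w (\<beta> \<mu>) < w \<nu> then const (c \<mu> \<nu>) * g \<nu> else 0) = (\<Sum>\<nu>\<in>?S \<mu>. const (c \<mu> \<nu>) * g \<nu>)"
      by (rule sum.inter_filter[symmetric]) (rule finite_partitions)
    finally show ?thesis using c[OF that] by (simp add: algebra_simps)
  qed
  define A where "A = mat ?N ?N (\<lambda>(i, j). a (ps ! i) (ps ! j))"
  have A: "A \<in> carrier_mat ?N ?N" by (simp add: A_def)
  have "coefmat ps f = A * coefmat ps g"
  proof (rule coefmat_mult[OF A])
    fix i assume i: "i < ?N"
    have "f (ps ! i) = (\<Sum>j<?N. const (a (ps ! i) (ps ! j)) * g (ps ! j))"
      unfolding f[OF nth_mem_partitions[OF i]] by (rule sum_partitions_as_index[OF distinct set_ps])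
    then show "f (ps ! i) = (\<Sum>j<?N. const (A $$ (i, j)) * g (ps ! j))"
      using i by (simp add: A_def)
  qed
  then have "det (coefmat ps f) = det A * det (coefmat ps g)"
    using det_mult[OF A coefmat_carrier] by simp
  moreover have "\<bar>det A\<bar> = (\<Prod>\<mu>\<in>?P. \<bar>d \<mu>\<bar>)"
  proof -
    have bps: "bij_betw ((!) ps) {0..<?N} ?P"
      using bij_betw_nth[OF distinct _ set_ps[symmetric]] by (simp add: atLeast0LessThan)
    define \<pi> where "\<pi> i = (if i < ?N then the_inv_into {0..<?N} ((!) ps) (\<beta> (ps ! i)) else i)" for i
    have \<pi>: "\<pi> i < ?N" "ps ! \<pi> i = \<beta> (ps ! i)" if i: "i < ?N" for i
    proof -
      have m: "\<beta> (ps ! i) \<in> (!) ps ` {0..<?N}"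
        using \<beta>P[OF nth_mem_partitions[OF i]] bps by (simp add: bij_betw_def)
      have inj: "inj_on ((!) ps) {0..<?N}" using bps by (rule bij_betw_imp_inj_on)
      show "\<pi> i < ?N" using the_inv_into_into[OF inj m order.refl] i by (simp add: \<pi>_def)
      show "ps ! \<pi> i = \<beta> (ps ! i)" using f_the_inv_into_f[OF inj m] i by (simp add: \<pi>_def)
    qed
    have "inj_on \<pi> {0..<?N}"
    proof (rule inj_onI)
      fix i j assume ij: "i \<in> {0..<?N}" "j \<in> {0..<?N}" "\<pi> i = \<pi> j"
      then have l: "i < ?N" "j < ?N" by auto
      have "\<beta> (ps ! i) = \<beta> (ps ! j)" using \<pi>(2)[OF l(1)] \<pi>(2)[OF l(2)] ij(3) by simp
      then have "ps ! i = ps ! j"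
        using inj_onD[OF bij_betw_imp_inj_on[OF \<beta>]] nth_mem_partitions[OF l(1)] nth_mem_partitions[OF l(2)] by blast
      then show "i = j" using distinct l by (simp add: nth_eq_iff_index_eq)
    qed
    moreover have "\<pi> ` {0..<?N} \<subseteq> {0..<?N}" using \<pi>(1) by auto
    ultimately have "bij_betw \<pi> {0..<?N} {0..<?N}" by (simp add: bij_betw_def endo_inj_surj)
    then have perm: "\<pi> permutes {0..<?N}" by (rule bij_imp_permutes) (simp add: \<pi>_def)
    have "\<bar>det A\<bar> = (\<Prod>i<?N. \<bar>A $$ (i, \<pi> i)\<bar>)"
    proof (rule abs_det_triangular[OF A perm, of "\<lambda>i. w (ps ! i)"])
      fix i j assume ij: "i < ?N" "j < ?N" "A $$ (i, j) \<noteq> 0"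
      then have "ps ! j = \<beta> (ps ! i) \<or> w (\<beta> (ps ! i)) < w (ps ! j)"
        by (auto simp: A_def a_def split: if_splits)
      then show "j = \<pi> i \<or> w (ps ! \<pi> i) < w (ps ! j)"
        using ij \<pi>[OF ij(1)] distinct by (metis nth_eq_iff_index_eq)
    qed
    also have "\<dots> = (\<Prod>i<?N. \<bar>d (ps ! i)\<bar>)"
      by (intro prod.cong refl) (simp add: A_def a_def \<pi>)
    also have "\<dots> = (\<Prod>\<mu>\<in>?P. \<bar>d \<mu>\<bar>)"
      using prod.reindex_bij_betw[OF bps, of "\<lambda>\<mu>. \<bar>d \<mu>\<bar>"] by (simp add: atLeast0LessThan)
    finally show ?thesis .
  qed
  ultimately show ?thesis by (simp add: abs_mult)
qed

lemma abs_det_coefmat_lattice: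
  assumes f: "\<And>\<mu>. \<mu> \<in> partitions n \<Longrightarrow> f \<mu> \<in> zmod.span (g ` partitions n)"
    and g: "\<And>\<mu>. \<mu> \<in> partitions n \<Longrightarrow> g \<mu> \<in> zmod.span (f ` partitions n)"
    and nz: "det (coefmat ps g) \<noteq> 0"
  shows "\<bar>det (coefmat ps f)\<bar> = \<bar>det (coefmat ps g)\<bar>"
proof -
  let ?N = "length ps"
  have ex: "\<exists>A\<in>carrier_mat ?N ?N. coefmat ps f = A * coefmat ps g \<and> det A \<in> \<int>"
    if f: "\<And>\<mu>. \<mu> \<in> partitions n \<Longrightarrow> f \<mu> \<in> zmod.span (g ` partitions n)" for f g
  proof -
    have "\<forall>\<mu>\<in>partitions n. \<exists>c. f \<mu> = (\<Sum>\<nu>\<in>partitions n. of_int (c \<nu>) * g \<nu>)"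
      by (intro ballI zspan_image[OF finite_partitions f])
    then have "\<exists>c. \<forall>\<mu>\<in>partitions n. f \<mu> = (\<Sum>\<nu>\<in>partitions n. of_int (c \<mu> \<nu>) * g \<nu>)"
      by (rule bchoice)
    then obtain c where "\<forall>\<mu>\<in>partitions n. f \<mu> = (\<Sum>\<nu>\<in>partitions n. of_int (c \<mu> \<nu>) * g \<nu>)" ..
    note c = bspec[OF this]
    define A :: "rat mat" where "A = mat ?N ?N (\<lambda>(i, j). of_int (c (ps ! i) (ps ! j)))"
    have A: "A \<in> carrier_mat ?N ?N" by (simp add: A_def)
    have "coefmat ps f = A * coefmat ps g"
    proof (rule coefmat_mult[OF A])
      fix i assume i: "i < ?N"
      have "f (ps ! i) = (\<Sum>j<?N. of_int (c (ps ! i) (ps ! j)) * g (ps ! j))"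
        unfolding c[OF nth_mem_partitions[OF i]] by (rule sum_partitions_as_index[OF distinct set_ps])
      then show "f (ps ! i) = (\<Sum>j<?N. const (A $$ (i, j)) * g (ps ! j))"
        using i by (simp add: A_def const_of_int)
    qed
    moreover have "det A \<in> \<int>"
    proof -
      have "det A = (\<Sum>p | p permutes {0..<?N}. of_int (sign p) * (\<Prod>i=0..<?N. A $$ (i, p i)))"
        using A by (simp add: det_def)
      also have "\<dots> \<in> \<int>"
      proof (intro Ints_sum Ints_mult Ints_of_int Ints_prod)
        fix p i assume "p \<in> {p. p permutes {0..<?N}}" "i \<in> {0..<?N}"
        then have "i < ?N" "p i < ?N" using permutes_in_image[of p "{0..<?N}" i] by auto
        then show "A $$ (i, p i) \<in> \<int>" by (simp add: A_def)
      qed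
      finally show ?thesis .
    qed
    ultimately show ?thesis by (intro bexI[OF _ A] conjI)
  qed
  have exA: "\<exists>A\<in>carrier_mat ?N ?N. coefmat ps f = A * coefmat ps g \<and> det A \<in> \<int>"
    by (rule ex) (rule f)
  have exB: "\<exists>A\<in>carrier_mat ?N ?N. coefmat ps g = A * coefmat ps f \<and> det A \<in> \<int>"
    by (rule ex) (rule g)
  obtain A where A: "A \<in> carrier_mat ?N ?N" "coefmat ps f = A * coefmat ps g" "det A \<in> \<int>"
    using exA by (elim bexE conjE)
  obtain B where B: "B \<in> carrier_mat ?N ?N" "coefmat ps g = B * coefmat ps f" "det B \<in> \<int>"
    using exB by (elim bexE conjE)
  have 1: "det (coefmat ps f) = det A * det (coefmat ps g)"
    using det_mult[OF A(1) coefmat_carrier[of ps g]] A(2) by simp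
  have 2: "det (coefmat ps g) = det B * det (coefmat ps f)"
    using det_mult[OF B(1) coefmat_carrier[of ps f]] B(2) by simp
  have "det (coefmat ps g) * (det B * det A) = det B * (det A * det (coefmat ps g))"
    by (simp only: mult_ac)
  also have "\<dots> = det (coefmat ps g) * 1"
    unfolding 1[symmetric] 2[symmetric] by simp
  finally have BA: "det B * det A = 1" unfolding mult_left_cancel[OF nz] .
  obtain a b where ab: "det A = of_int a" "det B = of_int b" using A(3) B(3) by (elim Ints_cases)
  then have "of_int (b * a) = (of_int 1 :: rat)" using BA by simp
  then have "b * a = 1" by (simp only: of_int_eq_iff)
  then have "a = 1 \<or> a = - 1" using zmult_eq_1_iff by blast
  then have "\<bar>det A\<bar> = 1" using ab(1) by auto
  then show ?thesis using 1 by (simp add: abs_mult)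
qed

lemma det_coefmat_tm: "det (coefmat ps tm) = 1"
proof -
  have "coefmat ps tm = 1\<^sub>m (length ps)"
    by (rule eq_matI) (use distinct in \<open>auto simp: coefmat_def coef_tm nth_eq_iff_index_eq\<close>)
  then show ?thesis by simp
qed

end

section \<open>Leading terms\<close>

definition hom_space :: "nat \<Rightarrow> nat \<Rightarrow> qpoly set" where
  "hom_space n l = qvec.span (tm ` {\<rho> \<in> partitions n. l \<le> size \<rho>})"

lemma hom_space_mult:
  assumes "x \<in> hom_space a k" "y \<in> hom_space b l" shows "x * y \<in> hom_space (a + b) (k + l)"
  using assms unfolding hom_space_def
proof (rule qspan_mult)
  fix s t
  assume "s \<in> tm ` {\<rho> \<in> partitions a. k \<le> size \<rho>}" "t \<in> tm ` {\<rho> \<in> partitions b. l \<le> size \<rho>}"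
  then obtain \<rho> \<sigma> where "s = tm \<rho>" "t = tm \<sigma>"
    and "\<rho> \<in> partitions a" "k \<le> size \<rho>" "\<sigma> \<in> partitions b" "l \<le> size \<sigma>" by auto
  then have "s * t = tm (\<rho> + \<sigma>)" "\<rho> + \<sigma> \<in> {\<rho> \<in> partitions (a + b). k + l \<le> size \<rho>}"
    by (auto simp: tm_add partitions_def)
  then show "s * t \<in> qvec.span (tm ` {\<rho> \<in> partitions (a + b). k + l \<le> size \<rho>})"
    by (simp only: qvec.span_base imageI)
qed

lemma hom_space_antimono: "k \<le> l \<Longrightarrow> hom_space n l \<subseteq> hom_space n k"
  unfolding hom_space_def by (intro qvec.span_mono) auto

lemma hom_space_add: "x \<in> hom_space n k \<Longrightarrow> y \<in> hom_space n k \<Longrightarrow> x + y \<in> hom_space n k"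
  unfolding hom_space_def by (rule qvec.span_add)

lemma hom_space_scale: "x \<in> hom_space n k \<Longrightarrow> const c * x \<in> hom_space n k"
  unfolding hom_space_def by (rule qvec.span_scale)

lemma hom_space_sum: "(\<And>i. i \<in> I \<Longrightarrow> f i \<in> hom_space n k) \<Longrightarrow> (\<Sum>i\<in>I. f i) \<in> hom_space n k"
  unfolding hom_space_def by (rule qvec.span_sum)

lemma hom_space_zero: "0 \<in> hom_space n k"
  unfolding hom_space_def by (rule qvec.span_zero)

lemma tm_in_hom_space: "\<rho> \<in> partitions n \<Longrightarrow> k \<le> size \<rho> \<Longrightarrow> tm \<rho> \<in> hom_space n k"
  unfolding hom_space_def by (intro qvec.span_base imageI) simp

lemma hom_space_leading:
  assumes "x - y \<in> hom_space n (Suc k)" "y \<in> hom_space n k" shows "x \<in> hom_space n k"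
proof -
  have "x - y \<in> hom_space n k" by (rule subsetD[OF hom_space_antimono assms(1)]) simp
  from hom_space_add[OF this assms(2)] show ?thesis by simp
qed

lemma hom_space_mult_leading:
  assumes x: "x - x' \<in> hom_space a (Suc k)" "x' \<in> hom_space a k"
    and y: "y - y' \<in> hom_space b (Suc l)" "y' \<in> hom_space b l"
  shows "x * y - x' * y' \<in> hom_space (a + b) (Suc (k + l))"
proof -
  have "x * y - x' * y' = (x - x') * y + x' * (y - y')" by (simp add: algebra_simps)
  moreover have "(x - x') * y \<in> hom_space (a + b) (Suc (k + l))"
    using hom_space_mult[OF x(1) hom_space_leading[OF y]] by simp
  moreover have "x' * (y - y') \<in> hom_space (a + b) (Suc (k + l))"
    using hom_space_mult[OF x(2) y(1)] by simp
  ultimately show ?thesis by (simp only: hom_space_add)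
qed

lemma hom_space_expand:
  assumes "x \<in> hom_space n k"
  shows "x = (\<Sum>\<rho>\<in>partitions n. const (coef x (ev \<rho>)) * tm \<rho>)"
proof -
  have "x \<in> qvec.span (tm ` partitions n)"
    using assms unfolding hom_space_def by (rule subsetD[OF qvec.span_mono, rotated]) auto
  from qspan_image[OF finite_partitions this]
  obtain c where c: "x = (\<Sum>\<rho>\<in>partitions n. const (c \<rho>) * tm \<rho>)" by (elim exE)
  have "coef x (ev \<rho>) = c \<rho>" if "\<rho> \<in> partitions n" for \<rho>
  proof -
    have "coef x (ev \<rho>) = (\<Sum>\<sigma>\<in>partitions n. if \<sigma> = \<rho> then c \<sigma> else 0)"
      unfolding c lookup_sum by (intro sum.cong refl) (simp add: coef_const_mult coef_tm)
    then show ?thesis using that finite_partitions by simp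
  qed
  then have "(\<Sum>\<rho>\<in>partitions n. const (coef x (ev \<rho>)) * tm \<rho>) = (\<Sum>\<rho>\<in>partitions n. const (c \<rho>) * tm \<rho>)"
    by (intro sum.cong refl) simp
  with c show ?thesis by (simp only:)
qed

lemma q_fun_recursion:
  "of_nat (Suc m) * q_fun (Suc m) =
    (\<Sum>i=0..m. q_fun i * (of_nat (Suc (m - i)) * (if odd (Suc (m - i)) then tvar (Suc (m - i)) else 0)))"
proof -
  define E :: "qpoly fps" where "E = Abs_fps (\<lambda>k. const (1 / fact k))"
  define f :: "qpoly fps" where "f = Abs_fps (\<lambda>j. if odd j then tvar j else 0)"
  have f0: "f $ 0 = 0" by (simp add: f_def)
  have q: "q_gen = E oo f" by (simp add: q_gen_def E_def f_def)
  have "fps_deriv E = E"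
  proof (rule fps_ext)
    fix k
    have "of_nat (Suc k) * (1 / fact (Suc k)) = (1 / fact k :: rat)" by simp
    then have "const (of_nat (Suc k)) * const (1 / fact (Suc k)) = const (1 / fact k)"
      by (simp only: const_simps(4)[symmetric])
    then show "fps_deriv E $ k = E $ k" by (simp add: E_def const_of_nat del: fact_Suc of_nat_Suc)
  qed
  then have "fps_deriv q_gen = q_gen * fps_deriv f"
    using fps_compose_deriv[OF f0, of E] by (simp only: q)
  then have "fps_deriv q_gen $ m = (q_gen * fps_deriv f) $ m" by simp
  then show ?thesis by (simp add: fps_mult_nth q_fun_def f_def del: of_nat_Suc)
qed

lemma q_fun_leading:
  assumes "0 < m"
  shows "q_fun m - (if odd m then tvar m else 0) \<in> hom_space m 2"
  using assms
proof (induction m rule: less_induct)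
  case (less m)
  let ?f = "\<lambda>m. if odd m then tvar m else 0"
  have f1: "?f k \<in> hom_space k 1" if "0 < k" for k
    using tm_in_hom_space[of "{#k#}" k 1] that hom_space_zero by (simp add: partitions_def tm_eq_mprod)
  obtain k where k: "m = Suc k" using less.prems by (cases m) auto
  have q1: "q_fun i \<in> hom_space i 1" if "0 < i" "i < m" for i
    using hom_space_leading[of "q_fun i" "?f i" i 1] less.IH[OF that(2,1)] f1[OF that(1)] by (simp add: numeral_2_eq_2)
  let ?T = "\<lambda>i. q_fun i * (of_nat (Suc (k - i)) * ?f (Suc (k - i)))"
  have "{0..k} = insert 0 {1..k}" by auto
  then have "(\<Sum>i=0..k. ?T i) = ?T 0 + (\<Sum>i=1..k. ?T i)" by (simp only: sum.insert) simp
  then have "of_nat m * q_fun m = of_nat m * ?f m + (\<Sum>i=1..k. ?T i)"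
    using q_fun_recursion[of k] by (simp only: k q_fun_0 mult_1_left diff_zero)
  then have "const (of_nat m) * (q_fun m - ?f m) = (\<Sum>i=1..k. ?T i)"
    by (simp only: const_of_nat right_diff_distrib) simp
  moreover have "?T i \<in> hom_space m 2" if i: "i \<in> {1..k}" for i
  proof -
    have "0 < i" "i < m" "i + Suc (k - i) = m" using i k by auto
    have "of_nat (Suc (k - i)) * ?f (Suc (k - i)) \<in> hom_space (Suc (k - i)) 1"
      unfolding const_of_nat[symmetric] by (intro hom_space_scale f1) simp
    from hom_space_mult[OF q1[OF \<open>0 < i\<close> \<open>i < m\<close>] this]
    show ?thesis unfolding \<open>i + Suc (k - i) = m\<close> by (simp only: one_add_one)
  qed
  ultimately have "const (of_nat m) * (q_fun m - ?f m) \<in> hom_space m 2" by (simp only: hom_space_sum)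
  from hom_space_scale[OF this, of "1 / of_nat m"]
  have "const (1 / of_nat m) * (const (of_nat m) * (q_fun m - ?f m)) \<in> hom_space m 2" .
  moreover have "const (1 / of_nat m) * (const (of_nat m) * x) = x" for x
  proof -
    have "const (1 / of_nat m) * const (of_nat m) = 1"
      unfolding const_simps(4)[symmetric] using less.prems by (simp add: const_simps)
    then show ?thesis by (simp only: mult.assoc[symmetric] mult_1_left)
  qed
  ultimately show ?case by (simp only:)
qed

lemma one_in_hom_space: "1 \<in> hom_space 0 0"
  using tm_in_hom_space[of "{#}" 0 0] by (simp add: partitions_def tm_eq_mprod)

lemma mprod_q_fun_leading:
  assumes "\<forall>x\<in>#\<rho>. odd x"
  shows "mprod q_fun \<rho> - tm \<rho> \<in> hom_space (sum_mset \<rho>) (Suc (size \<rho>))"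
  using assms
proof (induction \<rho>)
  case empty
  then show ?case by (simp add: tm_eq_mprod hom_space_zero)
next
  case (add x \<rho>)
  have x: "odd x" "0 < x" using add.prems by (auto intro: odd_pos)
  have a: "q_fun x - tvar x \<in> hom_space x (Suc 1)"
    using q_fun_leading[OF x(2)] x(1) by (simp add: numeral_2_eq_2)
  have b: "tvar x \<in> hom_space x 1"
    using tm_in_hom_space[of "{#x#}" x 1] x(2) by (simp add: partitions_def tm_eq_mprod)
  have c: "mprod q_fun \<rho> - tm \<rho> \<in> hom_space (sum_mset \<rho>) (Suc (size \<rho>))"
    by (rule add.IH) (use add.prems in simp)
  have "0 \<notin># \<rho>"
  proof
    assume "0 \<in># \<rho>"
    then have "odd (0::nat)" by (intro bspec[OF add.prems]) simp
    then show False by simp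
  qed
  then have "\<rho> \<in> partitions (sum_mset \<rho>)" by (simp add: partitions_def)
  then have d: "tm \<rho> \<in> hom_space (sum_mset \<rho>) (size \<rho>)" by (rule tm_in_hom_space) simp
  have "q_fun x * mprod q_fun \<rho> - tvar x * tm \<rho> \<in> hom_space (x + sum_mset \<rho>) (Suc (1 + size \<rho>))"
    by (rule hom_space_mult_leading[OF a b c d])
  then show ?case by (simp add: tm_eq_mprod)
qed

lemma q_fun_in_hom_space: "q_fun m \<in> hom_space m 0"
proof (cases "m = 0")
  case True
  then show ?thesis by (simp add: q_fun_0 one_in_hom_space)
next
  case False
  have a: "(if odd m then tvar m else 0) \<in> hom_space m 0"
    using tm_in_hom_space[of "{#m#}" m 0] False hom_space_zero by (simp add: partitions_def tm_eq_mprod)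
  have b: "q_fun m - (if odd m then tvar m else 0) \<in> hom_space m 0"
    by (rule subsetD[OF hom_space_antimono q_fun_leading]) (use False in simp_all)
  from hom_space_add[OF b a] show ?thesis by (simp only: diff_add_cancel)
qed

lemma lat_q_fun_subset_hom_space: "lat q_fun n 0 \<subseteq> hom_space n 0"
proof
  have m: "mprod q_fun \<mu> \<in> hom_space (sum_mset \<mu>) 0" for \<mu>
  proof (induction \<mu>)
    case (add x \<mu>)
    from hom_space_mult[OF q_fun_in_hom_space[of x] add.IH] show ?case by simp
  qed (simp add: one_in_hom_space)
  fix x assume "x \<in> lat q_fun n 0"
  then show "x \<in> hom_space n 0"
    unfolding lat_def
  proof (induction rule: zmod.span_induct_alt)
    case base
    show ?case by (rule hom_space_zero)
  next
    case (step c s y)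
    from step(1) m have "s \<in> hom_space n 0" by auto
    from hom_space_add[OF hom_space_scale[OF this, of "of_int c"] step(2)]
    show ?case by (simp only: const_of_int)
  qed
qed

section \<open>Schur functions and permutation characters\<close>

lemma const_prod: "const (\<Prod>i\<in>I. f i) = (\<Prod>i\<in>I. const (f i))"
  by (induction I rule: infinite_finite_induct) (simp_all add: const_simps)

definition mult_fact :: "partition \<Rightarrow> rat" where
  "mult_fact \<rho> = (\<Prod>j\<in>set_mset \<rho>. fact (count \<rho> j))"

lemma mult_fact_nonzero: "mult_fact \<rho> \<noteq> 0"
  by (simp add: mult_fact_def prod_zero_iff)

lemma schur_eq:
  assumes "\<alpha> \<in> partitions n"
  shows "schur \<alpha> = (\<Sum>\<rho>\<in>partitions n. const (irr_char_class \<alpha> \<rho> / mult_fact \<rho>) * tm \<rho>)"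
  unfolding schur_def partitions_sum_mset[OF assms]
proof (rule sum.cong[OF refl])
  fix \<rho>
  have "(\<Prod>j\<in>set_mset \<rho>. const (1 / fact (count \<rho> j)) * tvar j ^ count \<rho> j) =
      const (\<Prod>j\<in>set_mset \<rho>. 1 / fact (count \<rho> j)) * tm \<rho>"
    unfolding prod.distrib const_prod tm_eq_mprod mprod_def image_prod_mset_multiplicity ..
  also have "(\<Prod>j\<in>set_mset \<rho>. 1 / fact (count \<rho> j)) = 1 / mult_fact \<rho>"
    unfolding mult_fact_def prod_dividef by simp
  finally have "(\<Prod>j\<in>set_mset \<rho>. const (1 / fact (count \<rho> j)) * tvar j ^ count \<rho> j) = const (1 / mult_fact \<rho>) * tm \<rho>" .
  moreover have "irr_char_class \<alpha> \<rho> / mult_fact \<rho> = irr_char_class \<alpha> \<rho> * (1 / mult_fact \<rho>)" by simp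
  ultimately show "const (irr_char_class \<alpha> \<rho>) * (\<Prod>j\<in>set_mset \<rho>. const (1 / fact (count \<rho> j)) * tvar j ^ count \<rho> j) =
      const (irr_char_class \<alpha> \<rho> / mult_fact \<rho>) * tm \<rho>"
    by (simp only: const_simps(4) mult.assoc)
qed

text \<open>The complete symmetric function of \<open>\<alpha>\<close>, as the characteristic of a permutation character.\<close>

definition perm_fun :: "partition \<Rightarrow> qpoly" where
  "perm_fun \<alpha> = (\<Sum>\<rho>\<in>partitions (sum_mset \<alpha>). const (perm_char \<alpha> (class_rep \<rho>) / mult_fact \<rho>) * tm \<rho>)"

lemma perm_fun_eq_sum_schur:
  assumes \<alpha>: "\<alpha> \<in> partitions n"
  shows "perm_fun \<alpha> = (\<Sum>\<beta>\<in>partitions n. const (kostka \<alpha> \<beta>) * schur \<beta>)"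
proof -
  have "(\<Sum>\<beta>\<in>partitions n. const (kostka \<alpha> \<beta>) * schur \<beta>) =
      (\<Sum>\<beta>\<in>partitions n. \<Sum>\<rho>\<in>partitions n. const (kostka \<alpha> \<beta> * irr_char_class \<beta> \<rho> / mult_fact \<rho>) * tm \<rho>)"
  proof (rule sum.cong[OF refl])
    fix \<beta> assume \<beta>: "\<beta> \<in> partitions n"
    show "const (kostka \<alpha> \<beta>) * schur \<beta> =
        (\<Sum>\<rho>\<in>partitions n. const (kostka \<alpha> \<beta> * irr_char_class \<beta> \<rho> / mult_fact \<rho>) * tm \<rho>)"
      unfolding schur_eq[OF \<beta>] sum_distrib_left
      by (intro sum.cong refl) (simp only: const_simps(4)[symmetric] mult.assoc[symmetric] times_divide_eq_right)
  qed
  also have "\<dots> = (\<Sum>\<rho>\<in>partitions n. \<Sum>\<beta>\<in>partitions n. const (kostka \<alpha> \<beta> * irr_char_class \<beta> \<rho> / mult_fact \<rho>) * tm \<rho>)"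
    by (rule sum.swap)
  also have "\<dots> = (\<Sum>\<rho>\<in>partitions n. const (perm_char \<alpha> (class_rep \<rho>) / mult_fact \<rho>) * tm \<rho>)"
    by (rule sum.cong[OF refl])
      (simp only: perm_char_eq_sum_kostka[OF \<alpha>] sum_divide_distrib const_sum sum_distrib_right)
  finally show ?thesis unfolding perm_fun_def partitions_sum_mset[OF \<alpha>] by (rule sym)
qed

lemma perm_fun_schur_leading:
  assumes \<alpha>: "\<alpha> \<in> partitions n"
  shows "perm_fun \<alpha> - schur \<alpha> \<in> qvec.span (schur ` {\<beta> \<in> partitions n. row_stat \<beta> < row_stat \<alpha>})"
proof -
  have "perm_fun \<alpha> - schur \<alpha> = (\<Sum>\<beta>\<in>partitions n - {\<alpha>}. const (kostka \<alpha> \<beta>) * schur \<beta>)"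
    unfolding perm_fun_eq_sum_schur[OF \<alpha>] sum.remove[OF finite_partitions \<alpha>]
    by (simp add: kostka_diag[OF \<alpha>] const_simps)
  moreover have "const (kostka \<alpha> \<beta>) * schur \<beta> \<in> qvec.span (schur ` {\<beta> \<in> partitions n. row_stat \<beta> < row_stat \<alpha>})"
    if "\<beta> \<in> partitions n - {\<alpha>}" for \<beta>
  proof (cases "kostka \<alpha> \<beta> = 0")
    case True
    then show ?thesis by (simp add: const_simps qvec.span_zero)
  next
    case False
    then have "row_stat \<beta> < row_stat \<alpha>" using kostka_nonzero[OF \<alpha>, of \<beta>] that by auto
    then show ?thesis using that by (intro qvec.span_scale qvec.span_base) auto
  qed
  ultimately show ?thesis by (simp only: qvec.span_sum)
qed

lemma perm_fun_leading:
  assumes \<alpha>: "\<alpha> \<in> partitions n"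
  shows "perm_fun \<alpha> - tm \<alpha> \<in> hom_space n (Suc (size \<alpha>))"
proof -
  let ?c = "\<lambda>\<rho>. perm_char \<alpha> (class_rep \<rho>) / mult_fact \<rho>"
  have "?c \<alpha> = 1"
    using perm_char_diag[OF \<alpha> class_rep[OF \<alpha>]] mult_fact_nonzero[of \<alpha>] by (simp add: mult_fact_def)
  then have "perm_fun \<alpha> - tm \<alpha> = (\<Sum>\<rho>\<in>partitions n - {\<alpha>}. const (?c \<rho>) * tm \<rho>)"
    unfolding perm_fun_def partitions_sum_mset[OF \<alpha>] sum.remove[OF finite_partitions \<alpha>]
    by (simp add: const_simps)
  moreover have "const (?c \<rho>) * tm \<rho> \<in> hom_space n (Suc (size \<alpha>))" if "\<rho> \<in> partitions n - {\<alpha>}" for \<rho>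
  proof (cases "?c \<rho> = 0")
    case True
    then show ?thesis by (simp only: const_simps mult_zero_left hom_space_zero)
  next
    case False
    have \<rho>: "\<rho> \<in> partitions n" "\<rho> \<noteq> \<alpha>" using that by auto
    have "size \<alpha> < size \<rho>"
      using perm_char_nonzero[OF \<alpha> class_rep(1)[OF \<rho>(1)]] class_rep(2)[OF \<rho>(1)] False \<rho>(2) by auto
    then show ?thesis by (intro hom_space_scale tm_in_hom_space \<rho>(1)) simp
  qed
  ultimately show ?thesis by (simp only: hom_space_sum)
qed

lemma schur_in_hom_space:
  assumes "\<alpha> \<in> partitions n" shows "schur \<alpha> \<in> hom_space n 0"
  unfolding schur_eq[OF assms] by (intro hom_space_sum hom_space_scale tm_in_hom_space) simp_all

subsection \<open>Doubling the variables\<close>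

lemma poly_subst_superset:
  assumes "finite M" "Poly_Mapping.keys P \<subseteq> M"
  shows "poly_subst f P = (\<Sum>m\<in>M. const (coef P m) * (\<Prod>j\<in>Poly_Mapping.keys m. f j ^ coef m j))"
  unfolding poly_subst_def
  by (rule sum.mono_neutral_left) (use assms in \<open>auto simp: in_keys_iff const_simps\<close>)

lemma poly_subst_add: "poly_subst f (P + Q) = poly_subst f P + poly_subst f Q"
proof -
  let ?M = "Poly_Mapping.keys P \<union> Poly_Mapping.keys Q"
  have "Poly_Mapping.keys (P + Q) \<subseteq> ?M" by (rule keys_add)
  then show ?thesis
    by (simp add: poly_subst_superset[where M = ?M] lookup_add const_simps distrib_right sum.distrib)
qed

lemma poly_subst_const_mult: "poly_subst f (const c * P) = const c * poly_subst f P"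
proof -
  have "Poly_Mapping.keys (const c * P) \<subseteq> Poly_Mapping.keys P"
    by (auto simp: in_keys_iff coef_const_mult)
  then have "poly_subst f (const c * P) = (\<Sum>m\<in>Poly_Mapping.keys P.
      const (coef (const c * P) m) * (\<Prod>j\<in>Poly_Mapping.keys m. f j ^ coef m j))"
    by (rule poly_subst_superset[OF finite_keys])
  then show ?thesis
    by (simp only: poly_subst_def coef_const_mult const_simps(4) sum_distrib_left mult.assoc)
qed

lemma poly_subst_zero: "poly_subst f 0 = 0"
  by (simp add: poly_subst_def)

lemma poly_subst_diff: "poly_subst f (P - Q) = poly_subst f P - poly_subst f Q"
  using poly_subst_add[of f "P - Q" Q] by simp

lemma poly_subst_tm: "poly_subst f (tm \<rho>) = mprod f \<rho>"
  by (simp add: poly_subst_def tm_def keys_ev coef_ev const_simps mprod_def image_prod_mset_multiplicity)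

abbreviation dbl :: "qpoly \<Rightarrow> qpoly" where
  "dbl \<equiv> poly_subst (\<lambda>j. tvar (2 * j))"

abbreviation twice :: "nat multiset \<Rightarrow> nat multiset" where
  "twice \<equiv> image_mset ((*) 2)"

lemma dbl_tm: "dbl (tm \<rho>) = tm (twice \<rho>)"
  unfolding poly_subst_tm by (simp add: tm_eq_mprod mprod_def multiset.map_comp comp_def)

lemma sum_mset_twice: "sum_mset (twice \<nu>) = 2 * sum_mset \<nu>"
  by (induction \<nu>) (simp_all only: image_mset_add_mset sum_mset.add_mset image_mset_empty sum_mset.empty
      distrib_left mult_0_right)

lemma twice_partition: "\<rho> \<in> partitions n \<Longrightarrow> twice \<rho> \<in> partitions (2 * n)"
  by (auto simp: partitions_def sum_mset_twice)

lemma dbl_span: "x \<in> qvec.span S \<Longrightarrow> dbl x \<in> qvec.span (dbl ` S)"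
proof (induction rule: qvec.span_induct_alt)
  case base
  then show ?case by (simp add: poly_subst_zero qvec.span_zero)
next
  case (step c s y)
  show ?case unfolding poly_subst_add poly_subst_const_mult
    by (intro qvec.span_add qvec.span_scale step(2) qvec.span_base imageI step(1))
qed

lemma dbl_hom_space:
  assumes "x \<in> hom_space n l" shows "dbl x \<in> hom_space (2 * n) l"
proof -
  have x: "dbl x \<in> qvec.span (dbl ` tm ` {\<rho> \<in> partitions n. l \<le> size \<rho>})"
    using assms unfolding hom_space_def by (rule dbl_span)
  have "dbl ` tm ` {\<rho> \<in> partitions n. l \<le> size \<rho>} \<subseteq> tm ` {\<rho> \<in> partitions (2 * n). l \<le> size \<rho>}"
    using twice_partition by (auto simp: dbl_tm)
  from subsetD[OF qvec.span_mono[OF this] x] show ?thesis unfolding hom_space_def .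
qed

lemma dbl_perm_fun_leading:
  assumes "\<nu> \<in> partitions n"
  shows "dbl (perm_fun \<nu>) - tm (twice \<nu>) \<in> hom_space (2 * n) (Suc (size \<nu>))"
  using dbl_hom_space[OF perm_fun_leading[OF assms]] by (simp only: poly_subst_diff dbl_tm)

lemma dbl_perm_fun_schur'_leading:
  assumes "\<nu> \<in> partitions n"
  shows "dbl (perm_fun \<nu>) - schur' \<nu> \<in> qvec.span (schur' ` {\<beta> \<in> partitions n. row_stat \<beta> < row_stat \<nu>})"
proof -
  have S: "schur' = (\<lambda>x. dbl (schur x))" by (rule ext) (rule schur'_def)
  show ?thesis
    using dbl_span[OF perm_fun_schur_leading[OF assms]]
    unfolding S poly_subst_diff image_image .
qed

lemma schur'_in_hom_space: "\<nu> \<in> partitions n \<Longrightarrow> schur' \<nu> \<in> hom_space (2 * n) 0"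
  unfolding schur'_def by (intro dbl_hom_space schur_in_hom_space)

section \<open>Strict and double parts\<close>

lemma decompose: "strict_part \<mu> + double_part \<mu> + double_part \<mu> = \<mu>"
proof (rule multiset_eqI)
  fix i
  have "m mod 2 + (m - m mod 2) div 2 + (m - m mod 2) div 2 = m" for m :: nat by presburger
  then show "count (strict_part \<mu> + double_part \<mu> + double_part \<mu>) i = count \<mu> i"
    by (simp add: count_double_part count_strict_part)
qed

lemma recompose:
  assumes "\<forall>x. count \<alpha> x \<le> 1"
  shows "strict_part (\<alpha> + \<nu> + \<nu>) = \<alpha>" "double_part (\<alpha> + \<nu> + \<nu>) = \<nu>"
proof -
  have a: "(a + c + c) mod 2 = a" if "a \<le> 1" for a c :: nat using that by presburger
  have b: "(a + c + c - a) div 2 = c" for a c :: nat by simp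
  have s: "count (strict_part (\<alpha> + \<nu> + \<nu>)) i = count \<alpha> i" for i
    unfolding count_strict_part using a assms by simp
  then show "strict_part (\<alpha> + \<nu> + \<nu>) = \<alpha>" by (rule multiset_eqI)
  show "double_part (\<alpha> + \<nu> + \<nu>) = \<nu>"
    by (rule multiset_eqI) (simp only: count_double_part s count_union b)
qed

lemma decompose_partition:
  assumes "\<mu> \<in> partitions n"
  obtains a b where "strict_part \<mu> \<in> strict_partitions a" "double_part \<mu> \<in> partitions b" "a + 2 * b = n"
proof (rule that)
  have b: "m mod 2 \<le> Suc 0" for m :: nat by presburger
  have "sum_mset (strict_part \<mu> + double_part \<mu> + double_part \<mu>) = n" "0 \<notin># strict_part \<mu> + double_part \<mu> + double_part \<mu>"
    using assms by (simp_all only: decompose) (simp_all add: partitions_def)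
  then show "sum_mset (strict_part \<mu>) + 2 * sum_mset (double_part \<mu>) = n"
    "strict_part \<mu> \<in> strict_partitions (sum_mset (strict_part \<mu>))"
    "double_part \<mu> \<in> partitions (sum_mset (double_part \<mu>))"
    by (simp_all only: partitions_def strict_partitions_def count_strict_part sum_mset.union mult_2
        add.assoc mem_Collect_eq union_iff de_Morgan_disj)
      (simp_all add: b)
qed

lemma recompose_partition:
  assumes "\<alpha> \<in> strict_partitions a" "\<nu> \<in> partitions b" "a + 2 * b = n"
  shows "\<alpha> + \<nu> + \<nu> \<in> partitions n" "strict_part (\<alpha> + \<nu> + \<nu>) = \<alpha>" "double_part (\<alpha> + \<nu> + \<nu>) = \<nu>"
proof -
  have "\<forall>x. count \<alpha> x \<le> 1" using assms(1) by (simp add: strict_partitions_def)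
  then show "strict_part (\<alpha> + \<nu> + \<nu>) = \<alpha>" "double_part (\<alpha> + \<nu> + \<nu>) = \<nu>" by (rule recompose)+
  show "\<alpha> + \<nu> + \<nu> \<in> partitions n"
    using assms by (auto simp: strict_partitions_def partitions_def)
qed

lemma sum_mset_glaisher: "sum_mset (glaisher \<alpha>) = sum_mset \<alpha>"
proof (induction \<alpha>)
  case (add x \<alpha>)
  then show ?case using two_part_odd_part[of x] by simp
qed simp

lemma glaisher_odd:
  assumes "0 \<notin># \<alpha>" "x \<in># glaisher \<alpha>" shows "odd x"
  using assms
proof (induction \<alpha>)
  case (add y \<alpha>)
  then show ?case using odd_odd_part[of y] by (auto split: if_splits)
qed simp

text \<open>Merging two equal parts \<open>x, x\<close> into \<open>2x\<close> does not change the image under \<open>glaisher\<close>.\<close>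

lemma ex_strict_glaisher:
  assumes "\<forall>x\<in>#\<rho>. odd x"
  shows "\<exists>\<alpha>\<in>strict_partitions (sum_mset \<rho>). glaisher \<alpha> = \<rho>"
proof -
  have "\<exists>\<beta>. (\<forall>x. count \<beta> x \<le> 1) \<and> 0 \<notin># \<beta> \<and> glaisher \<beta> = glaisher \<alpha>" if "0 \<notin># \<alpha>" for \<alpha>
    using that
  proof (induction "size \<alpha>" arbitrary: \<alpha> rule: less_induct)
    case less
    from repeated_or_strict[of \<alpha>] show ?case
    proof
      assume "\<forall>x. count \<alpha> x \<le> 1"
      with less.prems show ?thesis by (intro exI[of _ \<alpha>] conjI refl)
    next
      assume "\<exists>x \<nu>. \<alpha> = add_mset x (add_mset x \<nu>)"
      then obtain x \<nu> where x: "\<alpha> = add_mset x (add_mset x \<nu>)" by blast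
      with less.prems have x0: "0 < x" "0 \<notin># \<nu>" by (cases x; simp)+
      have "replicate_mset (2 * two_part x) (odd_part x) =
          replicate_mset (two_part x) (odd_part x) + replicate_mset (two_part x) (odd_part x)"
        by (rule multiset_eqI) simp
      then have "glaisher (add_mset (2 * x) \<nu>) = glaisher \<alpha>"
        by (simp only: x glaisher_add parts_double[OF x0(1)] add.assoc)
      moreover have "size (add_mset (2 * x) \<nu>) < size \<alpha>" "0 \<notin># add_mset (2 * x) \<nu>" using x x0 by simp_all
      ultimately show ?thesis using less.hyps[of "add_mset (2 * x) \<nu>"] by simp
    qed
  qed
  moreover have "0 \<notin># \<rho>"
  proof
    assume "0 \<in># \<rho>"
    then have "odd (0::nat)" by (rule bspec[OF assms])
    then show False by simp
  qed
  moreover have "glaisher \<rho> = \<rho>"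
    using assms
  proof (induction \<rho>)
    case (add x \<rho>)
    then show ?case by (simp add: parts_odd)
  qed simp
  ultimately obtain \<beta> where \<beta>: "\<forall>x. count \<beta> x \<le> 1" "0 \<notin># \<beta>" "glaisher \<beta> = \<rho>" by metis
  then have "\<beta> \<in> strict_partitions (sum_mset \<rho>)"
    using sum_mset_glaisher[of \<beta>] by (simp add: strict_partitions_def partitions_def)
  with \<beta>(3) show ?thesis by (intro bexI[of _ \<beta>])
qed

definition odd_even_form :: "partition \<Rightarrow> partition" where
  "odd_even_form \<mu> = glaisher (strict_part \<mu>) + twice (double_part \<mu>)"

lemma bij_odd_even_form: "bij_betw odd_even_form (partitions n) (partitions n)"
proof -
  have into: "odd_even_form \<mu> \<in> partitions n" if m: "\<mu> \<in> partitions n" for \<mu>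
  proof -
    obtain a b where ab: "strict_part \<mu> \<in> strict_partitions a" "double_part \<mu> \<in> partitions b" "a + 2 * b = n"
      by (rule decompose_partition[OF m])
    have "0 \<notin># strict_part \<mu>" "sum_mset (strict_part \<mu>) = a" using ab(1) by (auto simp: strict_partitions_def partitions_def)
    moreover have "0 \<notin># glaisher (strict_part \<mu>)"
    proof
      assume "0 \<in># glaisher (strict_part \<mu>)"
      then have "odd (0::nat)" by (rule glaisher_odd[OF \<open>0 \<notin># strict_part \<mu>\<close>])
      then show False by simp
    qed
    ultimately show ?thesis
      using twice_partition[OF ab(2)] ab(3) by (auto simp: odd_even_form_def partitions_def sum_mset_glaisher)
  qed
  have onto: "\<kappa> \<in> odd_even_form ` partitions n" if "\<kappa> \<in> partitions n" for \<kappa>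
  proof -
    let ?o = "filter_mset odd \<kappa>" and ?e = "filter_mset even \<kappa>"
    obtain \<alpha> where \<alpha>: "\<alpha> \<in> strict_partitions (sum_mset ?o)" "glaisher \<alpha> = ?o"
      using ex_strict_glaisher[of ?o] by auto
    define \<nu> where "\<nu> = image_mset (\<lambda>x. x div 2) ?e"
    have "twice \<nu> = image_mset (\<lambda>x. x) ?e"
      unfolding \<nu>_def multiset.map_comp by (rule image_mset_cong) auto
    then have tw: "twice \<nu> = ?e" by simp
    have split: "?o + ?e = \<kappa>" using multiset_partition[of \<kappa> odd] by simp
    have z: "0 \<notin># \<kappa>" and s: "sum_mset \<kappa> = n" using that by (auto simp: partitions_def)
    have "0 \<notin># \<nu>"
    proof
      assume "0 \<in># \<nu>"
      then have "0 \<in># twice \<nu>" by force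
      then show False using z unfolding tw by simp
    qed
    then have \<nu>: "\<nu> \<in> partitions (sum_mset \<nu>)" by (simp add: partitions_def)
    have "sum_mset ?o + 2 * sum_mset \<nu> = sum_mset (?o + ?e)"
      unfolding sum_mset_twice[symmetric] tw by (rule sum_mset.union[symmetric])
    then have n: "sum_mset ?o + 2 * sum_mset \<nu> = n" by (simp only: split s)
    note r = recompose_partition[OF \<alpha>(1) \<nu> n]
    have "odd_even_form (\<alpha> + \<nu> + \<nu>) = \<kappa>"
      unfolding odd_even_form_def r(2,3) \<alpha>(2) tw by (rule split)
    with r(1) show ?thesis by (intro image_eqI[of _ _ "\<alpha> + \<nu> + \<nu>"]) simp_all
  qed
  have im: "odd_even_form ` partitions n = partitions n"
    by (intro equalityI subsetI) (use into onto in auto)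
  moreover have "inj_on odd_even_form (partitions n)"
    by (rule finite_surj_inj[OF finite_partitions]) (simp only: im order.refl)
  ultimately show ?thesis by (simp add: bij_betw_def)
qed

lemma size_odd_even_form: "size (odd_even_form \<mu>) = size (glaisher (strict_part \<mu>)) + size (double_part \<mu>)"
  by (simp add: odd_even_form_def)

lemma sum_size_double_part:
  "(\<Sum>\<mu>\<in>partitions n. size (double_part \<mu>)) =
    (\<Sum>\<mu>\<in>partitions n. size (glaisher (strict_part \<mu>)) - size (strict_part \<mu>))"
proof -
  let ?d = "\<lambda>\<mu>. size (double_part \<mu>)" and ?s = "\<lambda>\<mu>. size (strict_part \<mu>)" and ?g = "\<lambda>\<mu>. size (glaisher (strict_part \<mu>))"
  have size: "size \<mu> = ?s \<mu> + ?d \<mu> + ?d \<mu>" for \<mu>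
  proof -
    have "size (strict_part \<mu> + double_part \<mu> + double_part \<mu>) = ?s \<mu> + ?d \<mu> + ?d \<mu>" by (simp only: size_union)
    then show ?thesis unfolding decompose .
  qed
  have "(\<Sum>\<mu>\<in>partitions n. size \<mu>) = (\<Sum>\<mu>\<in>partitions n. ?s \<mu> + ?d \<mu> + ?d \<mu>)"
    by (rule sum.cong[OF refl size])
  then have "(\<Sum>\<mu>\<in>partitions n. size \<mu>) = (\<Sum>\<mu>\<in>partitions n. ?s \<mu>) + (\<Sum>\<mu>\<in>partitions n. ?d \<mu>) + (\<Sum>\<mu>\<in>partitions n. ?d \<mu>)"
    by (simp only: sum.distrib)
  moreover have "(\<Sum>\<mu>\<in>partitions n. size \<mu>) = (\<Sum>\<mu>\<in>partitions n. size (odd_even_form \<mu>))"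
    by (rule sum.reindex_bij_betw[OF bij_odd_even_form, symmetric])
  moreover have "(\<Sum>\<mu>\<in>partitions n. size (odd_even_form \<mu>)) = (\<Sum>\<mu>\<in>partitions n. ?g \<mu>) + (\<Sum>\<mu>\<in>partitions n. ?d \<mu>)"
    by (simp only: size_odd_even_form sum.distrib)
  moreover have "(\<Sum>\<mu>\<in>partitions n. ?g \<mu> - ?s \<mu>) = (\<Sum>\<mu>\<in>partitions n. ?g \<mu>) - (\<Sum>\<mu>\<in>partitions n. ?s \<mu>)"
    by (rule sum_subtractf_nat) (rule size_le_glaisher)
  ultimately show ?thesis by linarith
qed

section \<open>The transition matrix\<close>

lemma zspan_mult_schur':
  assumes f: "\<And>a \<alpha>. \<alpha> \<in> strict_partitions a \<Longrightarrow> f \<alpha> \<in> zmod.span (g ` strict_partitions a)"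
    and \<mu>: "\<mu> \<in> partitions n"
  shows "f (strict_part \<mu>) * schur' (double_part \<mu>) \<in>
    zmod.span ((\<lambda>\<mu>. g (strict_part \<mu>) * schur' (double_part \<mu>)) ` partitions n)"
proof -
  obtain a b where ab: "strict_part \<mu> \<in> strict_partitions a" "double_part \<mu> \<in> partitions b" "a + 2 * b = n"
    using decompose_partition[OF \<mu>] .
  have p: "schur' (double_part \<mu>) \<in> zmod.span {schur' (double_part \<mu>)}" by (rule zmod.span_base) simp
  show ?thesis
  proof (rule zspan_mult[OF f[OF ab(1)] p])
    fix s t assume "s \<in> g ` strict_partitions a" "t \<in> {schur' (double_part \<mu>)}"
    then obtain \<alpha> where \<alpha>: "\<alpha> \<in> strict_partitions a" "s = g \<alpha>" "t = schur' (double_part \<mu>)" by auto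
    note r = recompose_partition[OF \<alpha>(1) ab(2,3)]
    have "s * t = g (strict_part (\<alpha> + double_part \<mu> + double_part \<mu>)) * schur' (double_part (\<alpha> + double_part \<mu> + double_part \<mu>))"
      by (simp only: r(2,3) \<alpha>(2,3))
    then show "s * t \<in> zmod.span ((\<lambda>\<mu>. g (strict_part \<mu>) * schur' (double_part \<mu>)) ` partitions n)"
      using r(1) by (intro zmod.span_base image_eqI)
  qed
qed

context enumerated
begin

lemma abs_det_schur: "\<bar>det (coefmat ps schur)\<bar> = 1"
proof -
  have "\<bar>det (coefmat ps perm_fun)\<bar> = (\<Prod>\<mu>\<in>partitions n. \<bar>1\<bar>) * \<bar>det (coefmat ps schur)\<bar>"
  proof (rule abs_det_coefmat_triangular[where \<beta> = id and w = "\<lambda>\<mu>. - int (row_stat \<mu>)"])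
    fix \<mu> assume "\<mu> \<in> partitions n"
    from perm_fun_schur_leading[OF this]
    show "perm_fun \<mu> - const 1 * schur (id \<mu>) \<in>
      qvec.span (schur ` {\<nu> \<in> partitions n. - int (row_stat (id \<mu>)) < - int (row_stat \<nu>)})"
      by (simp add: const_simps)
  qed (rule bij_betw_id)
  moreover have "\<bar>det (coefmat ps perm_fun)\<bar> = (\<Prod>\<mu>\<in>partitions n. \<bar>1\<bar>) * \<bar>det (coefmat ps tm)\<bar>"
  proof (rule abs_det_coefmat_triangular[where \<beta> = id and w = "\<lambda>\<mu>. int (size \<mu>)"])
    fix \<mu> assume "\<mu> \<in> partitions n"
    from perm_fun_leading[OF this]
    show "perm_fun \<mu> - const 1 * tm (id \<mu>) \<in>
      qvec.span (tm ` {\<nu> \<in> partitions n. int (size (id \<mu>)) < int (size \<nu>)})"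
      by (simp add: const_simps hom_space_def Suc_le_eq)
  qed (rule bij_betw_id)
  ultimately show ?thesis by (simp add: det_coefmat_tm)
qed

lemma abs_det_W:
  "\<bar>det (coefmat ps W)\<bar> = (\<Prod>\<mu>\<in>partitions n. 1 / 2 ^ (size (glaisher (strict_part \<mu>)) - size (strict_part \<mu>)))"
proof -
  let ?V = "\<lambda>\<mu>. mprod div_pow (strict_part \<mu>) * schur' (double_part \<mu>)"
  let ?H = "\<lambda>\<mu>. mprod div_pow (strict_part \<mu>) * dbl (perm_fun (double_part \<mu>))"
  let ?d = "\<lambda>\<mu>. 1 / 2 ^ (size (glaisher (strict_part \<mu>)) - size (strict_part \<mu>)) :: rat"
  have "\<bar>det (coefmat ps ?H)\<bar> = (\<Prod>\<mu>\<in>partitions n. \<bar>1\<bar>) * \<bar>det (coefmat ps ?V)\<bar>"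
  proof (rule abs_det_coefmat_triangular[where \<beta> = id and w = "\<lambda>\<mu>. - int (row_stat (double_part \<mu>))"])
    fix \<mu> assume \<mu>: "\<mu> \<in> partitions n"
    obtain a b where ab: "strict_part \<mu> \<in> strict_partitions a" "double_part \<mu> \<in> partitions b" "a + 2 * b = n"
      using decompose_partition[OF \<mu>] .
    let ?p = "mprod div_pow (strict_part \<mu>)"
    let ?U = "?V ` {\<nu> \<in> partitions n. - int (row_stat (double_part (id \<mu>))) < - int (row_stat (double_part \<nu>))}"
    have p: "?p \<in> qvec.span {?p}" by (rule qvec.span_base) simp
    have "?p * (dbl (perm_fun (double_part \<mu>)) - schur' (double_part \<mu>)) \<in> qvec.span ?U"
    proof (rule qspan_mult[OF p dbl_perm_fun_schur'_leading[OF ab(2)]])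
      fix s t assume "s \<in> {?p}" "t \<in> schur' ` {\<beta> \<in> partitions b. row_stat \<beta> < row_stat (double_part \<mu>)}"
      then obtain \<nu> where \<nu>: "s = ?p" "t = schur' \<nu>" "\<nu> \<in> partitions b" "row_stat \<nu> < row_stat (double_part \<mu>)" by auto
      note r = recompose_partition[OF ab(1) \<nu>(3) ab(3)]
      have "s * t = ?V (strict_part \<mu> + \<nu> + \<nu>)" by (simp only: r(2,3) \<nu>(1,2))
      moreover have "strict_part \<mu> + \<nu> + \<nu> \<in> {\<nu> \<in> partitions n. - int (row_stat (double_part (id \<mu>))) < - int (row_stat (double_part \<nu>))}"
        using r(1) \<nu>(4) by (simp add: r(3))
      ultimately show "s * t \<in> qvec.span ?U" by (intro qvec.span_base image_eqI)
    qed
    then show "?H \<mu> - const 1 * ?V (id \<mu>) \<in> qvec.span ?U"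
      by (simp only: const_simps(6) mult_1_left id_apply right_diff_distrib)
  qed (rule bij_betw_id)
  moreover have "\<bar>det (coefmat ps ?H)\<bar> = (\<Prod>\<mu>\<in>partitions n. \<bar>?d \<mu>\<bar>) * \<bar>det (coefmat ps tm)\<bar>"
  proof (rule abs_det_coefmat_triangular[where w = "\<lambda>\<mu>. int (size \<mu>)", OF bij_odd_even_form])
    fix \<mu> assume \<mu>: "\<mu> \<in> partitions n"
    obtain a b where ab: "strict_part \<mu> \<in> strict_partitions a" "double_part \<mu> \<in> partitions b" "a + 2 * b = n"
      using decompose_partition[OF \<mu>] .
    let ?g = "glaisher (strict_part \<mu>)" and ?\<nu> = "double_part \<mu>"
    have s: "0 \<notin># strict_part \<mu>" "sum_mset ?g = a"
      using ab(1) by (simp_all add: strict_partitions_def partitions_def sum_mset_glaisher)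
    have odd: "\<forall>x\<in>#?g. odd x" using glaisher_odd[OF s(1)] by (rule ballI)
    have x: "mprod q_fun ?g - tm ?g \<in> hom_space a (Suc (size ?g))"
      using mprod_q_fun_leading[OF odd] unfolding s(2) .
    have "0 \<notin># ?g"
    proof
      assume "0 \<in># ?g"
      then have "odd (0::nat)" by (rule bspec[OF odd])
      then show False by simp
    qed
    then have "?g \<in> partitions a" using s(2) by (simp add: partitions_def)
    then have x': "tm ?g \<in> hom_space a (size ?g)" by (rule tm_in_hom_space) simp
    have y': "tm (twice ?\<nu>) \<in> hom_space (2 * b) (size ?\<nu>)"
      by (rule tm_in_hom_space[OF twice_partition[OF ab(2)]]) simp
    have "const (?d \<mu>) * (mprod q_fun ?g * dbl (perm_fun ?\<nu>) - tm ?g * tm (twice ?\<nu>)) \<in>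
        hom_space n (Suc (size ?g + size ?\<nu>))"
      using hom_space_mult_leading[OF x x' dbl_perm_fun_leading[OF ab(2)] y']
      unfolding ab(3) by (rule hom_space_scale)
    moreover have "?H \<mu> - const (?d \<mu>) * tm (odd_even_form \<mu>) =
        const (?d \<mu>) * (mprod q_fun ?g * dbl (perm_fun ?\<nu>) - tm ?g * tm (twice ?\<nu>))"
      unfolding odd_even_form_def tm_add mprod_div_pow by (simp only: right_diff_distrib mult.assoc)
    ultimately have "?H \<mu> - const (?d \<mu>) * tm (odd_even_form \<mu>) \<in> hom_space n (Suc (size (odd_even_form \<mu>)))"
      by (simp only: size_odd_even_form)
    then show "?H \<mu> - const (?d \<mu>) * tm (odd_even_form \<mu>) \<in>
        qvec.span (tm ` {\<nu> \<in> partitions n. int (size (odd_even_form \<mu>)) < int (size \<nu>)})"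
      unfolding hom_space_def by (simp only: Suc_le_eq of_nat_less_iff)
  qed
  ultimately have V: "\<bar>det (coefmat ps ?V)\<bar> = (\<Prod>\<mu>\<in>partitions n. ?d \<mu>)"
    by (simp add: det_coefmat_tm)
  have "(\<Prod>\<mu>\<in>partitions n. ?d \<mu>) \<noteq> 0"
    using finite_partitions[of n] by (simp add: prod_zero_iff)
  then have nz: "det (coefmat ps ?V) \<noteq> 0" using V by auto
  have "\<bar>det (coefmat ps W)\<bar> = \<bar>det (coefmat ps ?V)\<bar>"
  proof (rule abs_det_coefmat_lattice[OF _ _ nz])
    fix \<mu> assume \<mu>: "\<mu> \<in> partitions n"
    have W: "W = (\<lambda>\<mu>. schur_Q (strict_part \<mu>) * schur' (double_part \<mu>))" by (rule ext) (rule W_def)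
    show "W \<mu> \<in> zmod.span (?V ` partitions n)"
      unfolding W by (rule zspan_mult_schur'[OF _ \<mu>])
        (simp only: span_div_pow, simp only: zmod.span_base imageI flip: span_schur_Q)
    show "?V \<mu> \<in> zmod.span (W ` partitions n)"
      unfolding W by (rule zspan_mult_schur'[OF _ \<mu>])
        (simp only: span_schur_Q, simp only: zmod.span_base imageI flip: span_div_pow)
  qed
  then show ?thesis using V by simp
qed

lemma W_in_hom_space:
  assumes "\<mu> \<in> partitions n" shows "W \<mu> \<in> hom_space n 0"
proof -
  obtain a b where ab: "strict_part \<mu> \<in> strict_partitions a" "double_part \<mu> \<in> partitions b" "a + 2 * b = n"
    using decompose_partition[OF assms] .
  have "sum_mset (strict_part \<mu>) = a" using ab(1) by (simp add: strict_partitions_def partitions_def)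
  then have "schur_Q (strict_part \<mu>) \<in> hom_space a 0"
    by (intro subsetD[OF lat_q_fun_subset_hom_space] schur_Q_in_lat)
  from hom_space_mult[OF this schur'_in_hom_space[OF ab(2)]]
  show ?thesis unfolding ab(3) W_def by simp
qed

lemma eq_of_coefmat_eq:
  assumes A: "A \<in> carrier_mat (length ps) (length ps)"
    and f: "\<And>\<mu>. \<mu> \<in> partitions n \<Longrightarrow> f \<mu> \<in> hom_space n 0"
    and g: "\<And>\<mu>. \<mu> \<in> partitions n \<Longrightarrow> g \<mu> \<in> hom_space n 0"
    and eq: "coefmat ps f = A * coefmat ps g" and i: "i < length ps"
  shows "f (ps ! i) = (\<Sum>j<length ps. const (A $$ (i, j)) * g (ps ! j))"
proof -
  let ?G = "\<Sum>j<length ps. const (A $$ (i, j)) * g (ps ! j)"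
  have G: "?G \<in> hom_space n 0"
    by (intro hom_space_sum hom_space_scale g nth_mem_partitions) simp
  have "coef (f (ps ! i)) (ev (ps ! k)) = coef ?G (ev (ps ! k))" if k: "k < length ps" for k
  proof -
    have "coef (f (ps ! i)) (ev (ps ! k)) = (A * coefmat ps g) $$ (i, k)"
      unfolding eq[symmetric] using i k by (simp add: coefmat_def)
    also have "\<dots> = (\<Sum>j<length ps. A $$ (i, j) * coef (g (ps ! j)) (ev (ps ! k)))"
      using i k A by (simp add: coefmat_def scalar_prod_def atLeast0LessThan)
    finally show ?thesis by (simp add: lookup_sum coef_const_mult)
  qed
  then have "coef (f (ps ! i)) (ev \<rho>) = coef ?G (ev \<rho>)" if "\<rho> \<in> partitions n" for \<rho>
    using that unfolding set_ps[symmetric] in_set_conv_nth by auto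
  then have "(\<Sum>\<rho>\<in>partitions n. const (coef (f (ps ! i)) (ev \<rho>)) * tm \<rho>) =
      (\<Sum>\<rho>\<in>partitions n. const (coef ?G (ev \<rho>)) * tm \<rho>)"
    by (intro sum.cong refl) simp
  then show ?thesis
    using hom_space_expand[OF f[OF nth_mem_partitions[OF i]]] hom_space_expand[OF G] by (simp only:)
qed

lemma coefmat_schur_eq:
  "transition_matrix ps \<in> carrier_mat (length ps) (length ps)"
  "coefmat ps schur = transition_matrix ps * coefmat ps W"
proof -
  let ?N = "length ps" and ?M = "coefmat ps W"
  let ?Q = "\<lambda>A. A \<in> carrier_mat ?N ?N \<and> (\<forall>i<?N. schur (ps ! i) = (\<Sum>j<?N. const (A $$ (i, j)) * W (ps ! j)))"
  have M: "?M \<in> carrier_mat ?N ?N" by simp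
  have "\<bar>det ?M\<bar> \<noteq> 0" unfolding abs_det_W using finite_partitions[of n] by (simp add: prod_zero_iff)
  then have nz: "det ?M \<noteq> 0" by simp
  define B where "B = (1 / det ?M) \<cdot>\<^sub>m adj_mat ?M"
  note adj = adj_mat[OF M]
  have B: "B \<in> carrier_mat ?N ?N" using adj(1) by (simp add: B_def)
  have BM: "B * ?M = 1\<^sub>m ?N" and MB: "?M * B = 1\<^sub>m ?N"
  proof -
    have "B * ?M = (1 / det ?M) \<cdot>\<^sub>m (adj_mat ?M * ?M)"
      unfolding B_def by (rule mult_smult_assoc_mat[OF adj(1) M])
    also have "\<dots> = 1\<^sub>m ?N" unfolding adj(3) using nz by (intro eq_matI) auto
    finally show "B * ?M = 1\<^sub>m ?N" .
    then show "?M * B = 1\<^sub>m ?N" by (rule mat_mult_left_right_inverse[OF B M])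
  qed
  let ?A = "coefmat ps schur * B"
  have A: "?A \<in> carrier_mat ?N ?N" using B by (intro mult_carrier_mat[of _ _ ?N]) simp_all
  have eqA: "coefmat ps schur = ?A * ?M"
    unfolding assoc_mult_mat[OF coefmat_carrier B M] BM by (rule right_mult_one_mat[OF coefmat_carrier, symmetric])
  have "?Q ?A"
    using A eq_of_coefmat_eq[OF A schur_in_hom_space W_in_hom_space eqA] by blast
  moreover have "A' = ?A" if "?Q A'" for A'
  proof -
    have A': "A' \<in> carrier_mat ?N ?N" using that by (rule conjunct1)
    have "coefmat ps schur = A' * ?M" by (rule coefmat_mult[OF A']) (use that in blast)
    then have "?A = A' * ?M * B" by simp
    also have "\<dots> = A'" using MB A' by (simp add: assoc_mult_mat[OF A' M B])
    finally show ?thesis by (rule sym)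
  qed
  ultimately have "transition_matrix ps = ?A"
    unfolding transition_matrix_def by (intro the_equality)
  with A eqA show "transition_matrix ps \<in> carrier_mat ?N ?N" "coefmat ps schur = transition_matrix ps * ?M"
    by (simp_all only:)
qed

end

theorem mainTheorem1:
  fixes n :: nat and ps :: "partition list"
  assumes "n \<ge> 1"
    and "distinct ps" and "set ps = partitions n"
  shows "\<bar>det (transition_matrix ps)\<bar> = 2 ^ (\<Sum>\<alpha>\<in>partitions n. size (double_part \<alpha>)) \<and>
    int (\<Sum>\<alpha>\<in>partitions n. size (double_part \<alpha>)) =
      (\<Sum>\<alpha>\<in>partitions n. int (size (glaisher (strict_part \<alpha>))) - int (size (strict_part \<alpha>)))"
proof
  interpret enumerated n ps by unfold_locales (rule assms)+
  let ?k = "\<lambda>\<mu>. size (glaisher (strict_part \<mu>)) - size (strict_part \<mu>)"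
  have "\<bar>det (transition_matrix ps)\<bar> * \<bar>det (coefmat ps W)\<bar> = 1"
    using det_mult[OF coefmat_schur_eq(1) coefmat_carrier[of ps W]] abs_det_schur
    by (simp add: coefmat_schur_eq(2) abs_mult)
  moreover have "\<bar>det (coefmat ps W)\<bar> = 1 / 2 ^ (\<Sum>\<mu>\<in>partitions n. ?k \<mu>)"
    unfolding abs_det_W by (simp add: prod_dividef power_sum)
  ultimately show "\<bar>det (transition_matrix ps)\<bar> = 2 ^ (\<Sum>\<alpha>\<in>partitions n. size (double_part \<alpha>))"
    unfolding sum_size_double_part by (simp add: field_simps)
  show "int (\<Sum>\<alpha>\<in>partitions n. size (double_part \<alpha>)) =
      (\<Sum>\<alpha>\<in>partitions n. int (size (glaisher (strict_part \<alpha>))) - int (size (strict_part \<alpha>)))"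
    unfolding sum_size_double_part using size_le_glaisher by (simp add: of_nat_diff)
qed

end
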